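(* Let $n\ge2$ and $G=G(2,1,n)=\mu(G(2,1,n))$. For each linear character $\tau\in\{\mathrm{triv},\kappa,\det,\kappa\det\}$ of $G$ and each parameter $c=(c_1,c_{-1})\in\mathbb C^2$ for which the $H_c(G)$-module $L_c(\tau)$ is one-dimensional, i.e. $0=1-2(n-1)c_1\tau(s_i)-c_{-1}\tau(t_i^{(-1)})$, the twist $L_c(\tau)_{\mathcal F}$ is a one-dimensional representation of the negative braided Cherednik algebra $\underline H_{\underline c}(G)$, where $\underline c=-c$, and it is given as follows: $$L_c(\mathrm{triv})_{\mathcal F}=\underline L_{\underline c}(\mathrm{triv}),\quad L_c(\kappa)_{\mathcal F}=\underline L_{\underline c}(\det),\quad L_c(\det)_{\mathcal F}=\underline L_{\underline c}(\kappa),\quad L_c(\kappa\det)_{\mathcal F}=\underline L_{\underline c}(\kappa\det).$$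
   Context: Group. $V$ is a complex vector space with basis $x_1,\dots,x_n$, $V^*$ has the dual basis $y_1,\dots,y_n$, with $\langle g(y),x\rangle=\langle y,g^{-1}(x)\rangle$ for $g\in\mathrm{GL}(V)$. $G=G(2,1,n)\subset\mathrm{GL}(V)$ is the group of signed permutation matrices (Coxeter group of type $B_n$); the mystic group $\mu(G(2,1,n))$ coincides with $G$. For $\epsilon\in\{\pm1\}$ and $i\neq j$: $s_{ij}^{(\epsilon)}$ maps $x_i\mapsto\epsilon^{-1}x_j$, $x_j\mapsto\epsilon x_i$ and fixes other $x_k$; $\sigma_{ij}^{(\epsilon)}$ maps $x_i\mapsto\epsilon^{-1}x_j$, $x_j\mapsto-\epsilon x_i$ and fixes other $x_k$; $t_i^{(-1)}$ maps $x_i\mapsto-x_i$ and fixes other $x_k$. Put $s_i=s_{i,i+1}^{(1)}$, $\bar s_i=s_{i,i+1}^{(-1)}$, $\sigma_i=\sigma_{i,i+1}^{(1)}$. The four linear characters of $G$ are determined by their values on $(s_i,t_i^{(-1)})$: $\mathrm{triv}\colon(1,1)$; $\kappa\colon(1,-1)$; $\det\colon(-1,-1)$; $\kappa\det\colon(-1,1)$. Algebras. $H_c(G)$ is the unital $\mathbb C$-algebra generated by $x_i\in V$, $y_i\in V^*$ ($1\le i\le n$) and $\mathbb CG$ with relations $x_ix_j=x_jx_i$, $y_iy_j=y_jy_i$, $gx_i=g(x_i)g$, $gy_i=g(y_i)g$, $y_ix_j-x_jy_i=c_1\sum_{\epsilon=\pm1}\epsilon s_{ij}^{(\epsilon)}$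 ($i\ne j$), $y_ix_i-x_iy_i=1-c_1\sum_{j\neq i}\sum_{\epsilon=\pm1}s_{ij}^{(\epsilon)}-c_{-1}t_i^{(-1)}$. For $c'=(c'_1,c'_{-1})$, $\underline H_{c'}(G)=\underline H_{c'}(\mu(G(2,1,n)))$ is the unital $\mathbb C$-algebra generated by a basis $\underline x_i$ of $V$, the dual basis $\underline y_i$ of $V^*$ and $\mathbb CG$ with relations $\underline x_i\underline x_j+\underline x_j\underline x_i=0$, $\underline y_i\underline y_j+\underline y_j\underline y_i=0$, $\underline y_i\underline x_j+\underline x_j\underline y_i=c'_1\sum_{\epsilon=\pm1}\epsilon\sigma_{ij}^{(\epsilon)}$ (all for $i\neq j$), $g\underline x_i=g(\underline x_i)g$, $g\underline y_i=g(\underline y_i)g$, $\underline y_i\underline x_i-\underline x_i\underline y_i=1+c'_1\sum_{j\ne i}\sum_{\epsilon=\pm1}\sigma_{ij}^{(\epsilon)}+c'_{-1}t_i^{(-1)}$. Twist. $T=\langle\gamma_1,\dots,\gamma_n\rangle\cong(C_2)^n$ (with $C_2=\{\pm1\}$) acts on $H_c(G)$ by algebra automorphisms, $\gamma_i$ acting on elements of $G$ as conjugation by $t_i^{(-1)}$ and on $x_j,y_j$ via $t_i^{(-1)}$. Let $\mathcal F=\prod_{1\le j<i\le n}f_{ij}\in\mathbb CT\otimes\mathbb CT$, $f_{ij}=\frac12(1\otimes1+\gamma_i\otimes1+1\otimes\gamma_j-\gamma_i\otimes\gamma_j)$. For a $\mathbb CT$-module algebra $A$, the twist $A_{\mathcal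 F}$ is the vector space $A$ with product $a\star b=\mathrm{mult}(\mathcal F^{-1}\rhd(a\otimes b))$. There is a unique algebra isomorphism $\phi\colon\underline H_{\underline c}(G)\to H_c(G)_{\mathcal F}$, $\underline c=-c$, with $\phi(\sigma_i)=\bar s_i$, $\phi(t)=t$ for diagonal $t\in G$, $\phi(\underline x_j)=x_j$, $\phi(\underline y_j)=y_j$. Modules. $L_c(\tau)$ is the unique simple quotient of the standard module $M_c(\tau)=H_c(G)\otimes_{S(V)\#\mathbb CG}\tau$, where $V$ acts on $\tau$ by $0$. When the stated constraint on $c$ holds, $L_c(\tau)$ is the one-dimensional module on which all $x_i,y_i$ act by $0$ and $G$ acts via $\tau$. Let $\rho_\tau\colon H_c(G)\to\mathrm{End}(L_c(\tau))\cong\mathbb C$ be the corresponding homomorphism. $T$ acts on $\mathrm{End}(L_c(\tau))$ by conjugation by $\rho_\tau(t_i^{(-1)})$, hence trivially, so $\mathrm{End}(L_c(\tau))_{\mathcal F}=\mathrm{End}(L_c(\tau))$, and $\rho_\tau$ is also an algebra homomorphism $H_c(G)_{\mathcal F}\to\mathrm{End}(L_c(\tau))_{\mathcal F}\cong\mathbb C$. $L_c(\tau)_{\mathcal F}$ denotes the one-dimensional $\underline H_{\underline c}(G)$-module given by $\rho_\tau\circ\phi$. For a linear character $\tau'$ of $G$, $\underline L_{\underline c}(\tau')$ denotes the one-dimensional representation of $\underline H_{\underline c}(G)$ on which all $\underline x_i,\underline y_i$ act by $0$ and $G$ acts via $\tau'$. *)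

theory Defs
  imports
    "HOL-Algebra.QuotRing"
    "HOL-Algebra.Module"
    "HOL-Library.Poly_Mapping"
    "HOL-Library.Product_Plus"
    "HOL-Library.Z2"
    "Jordan_Normal_Form.Determinant"
begin

text \<open>
  Indices run over \<open>0, \<dots>, n - 1\<close> instead of \<open>1, \<dots>, n\<close>.  Algebras over the complex numbers,
  and complex vector spaces, are HOL-Algebra records of type \<open>(complex, 'a) module\<close>; for a
  vector space the multiplicative fields of the record are ignored.
\<close>

section \<open>The group of signed permutation matrices\<close>

text \<open>The matrix of the linear map sending the basis vector number \<open>k\<close> to \<open>f k\<close>.\<close>

definition lin :: "nat \<Rightarrow> (nat \<Rightarrow> complex vec) \<Rightarrow> complex mat" where
  "lin n f = mat_of_cols n (map f [0..<n])"

definition signed_perms :: "nat \<Rightarrow> complex mat set" where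
  "signed_perms n =
     {lin n (\<lambda>k. \<epsilon> k \<cdot>\<^sub>v unit_vec n (\<pi> k)) | \<pi> \<epsilon>.
        \<pi> permutes {..<n} \<and> (\<forall>k. \<epsilon> k \<in> {1, - 1})}"

definition G_group :: "nat \<Rightarrow> complex mat monoid" where
  "G_group n = \<lparr>carrier = signed_perms n, monoid.mult = (*), one = 1\<^sub>m n\<rparr>"

definition s_mat :: "nat \<Rightarrow> nat \<Rightarrow> nat \<Rightarrow> complex \<Rightarrow> complex mat" where
  "s_mat n i j \<epsilon> = lin n (\<lambda>k.
     if k = i then inverse \<epsilon> \<cdot>\<^sub>v unit_vec n j
     else if k = j then \<epsilon> \<cdot>\<^sub>v unit_vec n i
     else unit_vec n k)"

definition sigma_mat :: "nat \<Rightarrow> nat \<Rightarrow> nat \<Rightarrow> complex \<Rightarrow> complex mat" where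
  "sigma_mat n i j \<epsilon> = lin n (\<lambda>k.
     if k = i then inverse \<epsilon> \<cdot>\<^sub>v unit_vec n j
     else if k = j then (- \<epsilon>) \<cdot>\<^sub>v unit_vec n i
     else unit_vec n k)"

definition t_mat :: "nat \<Rightarrow> nat \<Rightarrow> complex mat" where
  "t_mat n i = lin n (\<lambda>k. if k = i then (- 1) \<cdot>\<^sub>v unit_vec n i else unit_vec n k)"

text \<open>
  The four linear characters.  The value of \<open>\<kappa>\<close> at a signed permutation matrix is the product
  of its nonzero entries, i.e. of the sums of its columns.
\<close>

definition triv_char :: "nat \<Rightarrow> complex mat \<Rightarrow> complex" where
  "triv_char n g = 1"

definition kappa_char :: "nat \<Rightarrow> complex mat \<Rightarrow> complex" where
  "kappa_char n g = (\<Prod>k<n. \<Sum>j<n. g $$ (j, k))"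

definition det_char :: "nat \<Rightarrow> complex mat \<Rightarrow> complex" where
  "det_char n g = det g"

definition kappa_det_char :: "nat \<Rightarrow> complex mat \<Rightarrow> complex" where
  "kappa_det_char n g = kappa_char n g * det_char n g"

lemma char_values:
  assumes "Suc i < n" and "k < n"
  shows "triv_char n (s_mat n i (Suc i) 1) = 1" "triv_char n (t_mat n k) = 1"
    "kappa_char n (s_mat n i (Suc i) 1) = 1" "kappa_char n (t_mat n k) = - 1"
    "det_char n (s_mat n i (Suc i) 1) = - 1" "det_char n (t_mat n k) = - 1"
    "kappa_det_char n (s_mat n i (Suc i) 1) = - 1" "kappa_det_char n (t_mat n k) = 1"
proof -
  have s: "s_mat n i (Suc i) 1 = swaprows_mat n i (Suc i)"
    using assms(1) by (intro eq_matI) (auto simp: s_mat_def lin_def mat_of_cols_def)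
  have t: "t_mat n k = multrow_mat n k (- 1)"
    using assms(2) by (intro eq_matI) (auto simp: t_mat_def lin_def mat_of_cols_def)
  have "(\<Sum>j<n. s_mat n i (Suc i) 1 $$ (j, m)) = 1" if "m < n" for m
  proof -
    define q where "q = (if m = i then Suc i else if m = Suc i then i else m)"
    have "(\<Sum>j<n. s_mat n i (Suc i) 1 $$ (j, m)) = (\<Sum>j<n. if j = q then 1 else 0)"
      using that assms(1)
      by (intro sum.cong) (auto simp: s_mat_def lin_def mat_of_cols_def q_def)
    also have "\<dots> = 1"
      using that assms(1) by (auto simp: q_def)
    finally show ?thesis .
  qed
  then have ks: "kappa_char n (s_mat n i (Suc i) 1) = 1"
    by (simp add: kappa_char_def)
  have "(\<Sum>j<n. t_mat n k $$ (j, m)) = (if m = k then - 1 else 1)" if "m < n" for m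
  proof -
    have "(\<Sum>j<n. t_mat n k $$ (j, m)) =
        (\<Sum>j<n. if j = m then (if m = k then - 1 else 1) else 0)"
      using that assms(2)
      by (intro sum.cong) (auto simp: t_mat_def lin_def mat_of_cols_def)
    then show ?thesis
      using that by simp
  qed
  then have kt: "kappa_char n (t_mat n k) = - 1"
    using assms(2) by (simp add: kappa_char_def)
  have ds: "det_char n (s_mat n i (Suc i) 1) = - 1"
    using assms(1) by (simp add: det_char_def s det_swaprows_mat)
  have dt: "det_char n (t_mat n k) = - 1"
    using assms(2) by (simp add: det_char_def t det_multrow_mat)
  show "triv_char n (s_mat n i (Suc i) 1) = 1" "triv_char n (t_mat n k) = 1"
    "kappa_char n (s_mat n i (Suc i) 1) = 1" "kappa_char n (t_mat n k) = - 1"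
    "det_char n (s_mat n i (Suc i) 1) = - 1" "det_char n (t_mat n k) = - 1"
    "kappa_det_char n (s_mat n i (Suc i) 1) = - 1" "kappa_det_char n (t_mat n k) = 1"
    by (simp_all add: triv_char_def kappa_det_char_def ks kt ds dt)
qed


section \<open>Algebras and representations\<close>

definition complex_ring :: "complex ring" where
  "complex_ring = \<lparr>carrier = UNIV, monoid.mult = (*), one = 1, zero = 0, add = (+)\<rparr>"

definition pscale :: "complex \<Rightarrow> ('k \<Rightarrow>\<^sub>0 complex) \<Rightarrow> ('k \<Rightarrow>\<^sub>0 complex)" where
  "pscale z p = Poly_Mapping.map ((*) z) p"

text \<open>
  The free monoid as an additively written monoid type, so that finitely supported functions on
  it carry the convolution product of \<open>Poly_Mapping\<close>, i.e. form the free algebra.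
\<close>

datatype 'g word = Word (letters: "'g list")

instantiation word :: (type) monoid_add
begin

definition zero_word :: "'a word" where
  "zero_word = Word []"

definition plus_word :: "'a word \<Rightarrow> 'a word \<Rightarrow> 'a word" where
  "plus_word u v = Word (letters u @ letters v)"

instance
  by standard (simp_all add: zero_word_def plus_word_def)

end

type_synonym 'g free = "'g word \<Rightarrow>\<^sub>0 complex"

definition free_algebra :: "'g set \<Rightarrow> (complex, 'g free) module" where
  "free_algebra S = \<lparr>carrier = {p. \<forall>w \<in> Poly_Mapping.keys p. set (letters w) \<subseteq> S},
     monoid.mult = (*), one = 1, zero = 0, add = (+), module.smult = pscale\<rparr>"

definition gen :: "'g \<Rightarrow> 'g free" where
  "gen a = Poly_Mapping.single (Word [a]) 1"

text \<open>
  The algebra homomorphism on a free algebra extending \<open>f\<close>; the target is a type with scalar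
  multiplication \<open>sc\<close>.
\<close>

definition free_lift ::
    "(complex \<Rightarrow> 'b \<Rightarrow> 'b) \<Rightarrow> ('g \<Rightarrow> 'b) \<Rightarrow> 'g free \<Rightarrow> 'b::ring_1" where
  "free_lift sc f p =
     (\<Sum>w \<in> Poly_Mapping.keys p. sc (Poly_Mapping.lookup p w) (prod_list (map f (letters w))))"

text \<open>
  The quotient of an algebra by a two-sided ideal; also used for the quotient of a vector space
  by a subspace.
\<close>

definition quot :: "(complex, 'a) module \<Rightarrow> 'a set \<Rightarrow> (complex, 'a set) module" where
  "quot A I = ring.extend (A Quot I)
     (module.fields (\<lambda>z U. \<Union>a\<in>U. I +>\<^bsub>A\<^esub> (z \<odot>\<^bsub>A\<^esub> a)))"

text \<open>The map between cosets induced by a map \<open>f\<close> preserving the subspace \<open>N\<close> of \<open>W\<close>.\<close>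

definition quot_map :: "(complex, 'w) module \<Rightarrow> 'w set \<Rightarrow> ('w \<Rightarrow> 'w) \<Rightarrow> 'w set \<Rightarrow> 'w set" where
  "quot_map W N f U = (\<Union>w\<in>U. N +>\<^bsub>W\<^esub> f w)"

definition algebra_iso ::
    "(complex, 'a) module \<Rightarrow> (complex, 'b) module \<Rightarrow> ('a \<Rightarrow> 'b) set" where
  "algebra_iso A B = {\<phi> \<in> ring_iso A B.
     \<forall>z. \<forall>a \<in> carrier A. \<phi> (z \<odot>\<^bsub>A\<^esub> a) = z \<odot>\<^bsub>B\<^esub> \<phi> a}"

text \<open>
  \<open>act :: 'a \<Rightarrow> 'w \<Rightarrow> 'w\<close> is a unital algebra homomorphism from \<open>A\<close> to the endomorphisms of the
  complex vector space \<open>W\<close>.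
\<close>

definition alg_representation ::
    "(complex, 'a) module \<Rightarrow> (complex, 'w) module \<Rightarrow> ('a \<Rightarrow> 'w \<Rightarrow> 'w) \<Rightarrow> bool" where
  "alg_representation A W act \<longleftrightarrow>
     module complex_ring W \<and>
     (\<forall>a \<in> carrier A. \<forall>w \<in> carrier W. act a w \<in> carrier W) \<and>
     (\<forall>a \<in> carrier A. \<forall>v \<in> carrier W. \<forall>w \<in> carrier W.
        act a (v \<oplus>\<^bsub>W\<^esub> w) = act a v \<oplus>\<^bsub>W\<^esub> act a w) \<and>
     (\<forall>a \<in> carrier A. \<forall>z. \<forall>w \<in> carrier W. act a (z \<odot>\<^bsub>W\<^esub> w) = z \<odot>\<^bsub>W\<^esub> act a w) \<and>
     (\<forall>a \<in> carrier A. \<forall>b \<in> carrier A. \<forall>w \<in> carrier W.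
        act (a \<oplus>\<^bsub>A\<^esub> b) w = act a w \<oplus>\<^bsub>W\<^esub> act b w) \<and>
     (\<forall>z. \<forall>a \<in> carrier A. \<forall>w \<in> carrier W. act (z \<odot>\<^bsub>A\<^esub> a) w = z \<odot>\<^bsub>W\<^esub> act a w) \<and>
     (\<forall>a \<in> carrier A. \<forall>b \<in> carrier A. \<forall>w \<in> carrier W.
        act (a \<otimes>\<^bsub>A\<^esub> b) w = act a (act b w)) \<and>
     (\<forall>w \<in> carrier W. act \<one>\<^bsub>A\<^esub> w = w)"

definition one_dimensional :: "(complex, 'w) module \<Rightarrow> bool" where
  "one_dimensional W \<longleftrightarrow> module complex_ring W \<and>
     (\<exists>v \<in> carrier W. v \<noteq> \<zero>\<^bsub>W\<^esub> \<and> (\<forall>w \<in> carrier W. \<exists>z. w = z \<odot>\<^bsub>W\<^esub> v))"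

definition subrepresentation ::
    "(complex, 'a) module \<Rightarrow> (complex, 'w) module \<Rightarrow> ('a \<Rightarrow> 'w \<Rightarrow> 'w) \<Rightarrow> 'w set \<Rightarrow> bool" where
  "subrepresentation A W act N \<longleftrightarrow>
     submodule N complex_ring W \<and> (\<forall>a \<in> carrier A. \<forall>w \<in> N. act a w \<in> N)"

definition simple_representation ::
    "(complex, 'a) module \<Rightarrow> (complex, 'w) module \<Rightarrow> ('a \<Rightarrow> 'w \<Rightarrow> 'w) \<Rightarrow> bool" where
  "simple_representation A W act \<longleftrightarrow>
     alg_representation A W act \<and> carrier W \<noteq> {\<zero>\<^bsub>W\<^esub>} \<and>
     (\<forall>N. subrepresentation A W act N \<longrightarrow> N = {\<zero>\<^bsub>W\<^esub>} \<or> N = carrier W)"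

definition free_space :: "'k set \<Rightarrow> (complex, 'k \<Rightarrow>\<^sub>0 complex) module" where
  "free_space S = \<lparr>carrier = {p. Poly_Mapping.keys p \<subseteq> S},
     monoid.mult = undefined, one = undefined, zero = 0, add = (+), module.smult = pscale\<rparr>"

definition subspace_generated :: "(complex, 'w) module \<Rightarrow> 'w set \<Rightarrow> 'w set" where
  "subspace_generated W S = \<Inter> {N. submodule N complex_ring W \<and> S \<subseteq> N}"


section \<open>The rational and the negative braided Cherednik algebra\<close>

datatype generator = GX nat | GY nat | GG "complex mat"

definition generators :: "nat \<Rightarrow> generator set" where
  "generators n = GX ` {..<n} \<union> GY ` {..<n} \<union> GG ` signed_perms n"

abbreviation gen_x :: "nat \<Rightarrow> generator free" where "gen_x i \<equiv> gen (GX i)"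
abbreviation gen_y :: "nat \<Rightarrow> generator free" where "gen_y i \<equiv> gen (GY i)"
abbreviation gen_g :: "complex mat \<Rightarrow> generator free" where "gen_g g \<equiv> gen (GG g)"

text \<open>
  \<open>g(x\<^sub>i)\<close> and \<open>g(y\<^sub>i)\<close>.  Since \<open>\<langle>g(y\<^sub>i), x\<^sub>k\<rangle> = \<langle>y\<^sub>i, g\<^sup>-\<^sup>1(x\<^sub>k)\<rangle>\<close>, the coefficient of \<open>y\<^sub>k\<close> in
  \<open>g(y\<^sub>i)\<close> is the \<open>(i, k)\<close> entry of the inverse matrix.
\<close>

definition on_x :: "nat \<Rightarrow> complex mat \<Rightarrow> nat \<Rightarrow> generator free" where
  "on_x n g i = (\<Sum>k<n. pscale (g $$ (k, i)) (gen_x k))"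

definition on_y :: "nat \<Rightarrow> complex mat \<Rightarrow> nat \<Rightarrow> generator free" where
  "on_y n g i = (\<Sum>k<n. pscale ((inv\<^bsub>G_group n\<^esub> g) $$ (i, k)) (gen_y k))"

text \<open>
  A relation \<open>p = q\<close> is encoded as \<open>p - q\<close>.  The first two families below make the
  letters \<open>GG g\<close> generate a copy of the group algebra.
\<close>

definition group_relations :: "nat \<Rightarrow> generator free set" where
  "group_relations n =
     {gen_g (1\<^sub>m n) - 1} \<union>
     {gen_g g * gen_g h - gen_g (g * h) | g h. g \<in> signed_perms n \<and> h \<in> signed_perms n} \<union>
     {gen_g g * gen_x i - on_x n g i * gen_g g | g i. g \<in> signed_perms n \<and> i < n} \<union>
     {gen_g g * gen_y i - on_y n g i * gen_g g | g i. g \<in> signed_perms n \<and> i < n}"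

definition cherednik_relations :: "nat \<Rightarrow> complex \<Rightarrow> complex \<Rightarrow> generator free set" where
  "cherednik_relations n c1 cm1 = group_relations n \<union>
     {gen_x i * gen_x j - gen_x j * gen_x i | i j. i < n \<and> j < n} \<union>
     {gen_y i * gen_y j - gen_y j * gen_y i | i j. i < n \<and> j < n} \<union>
     {gen_y i * gen_x j - gen_x j * gen_y i -
        pscale c1 (\<Sum>\<epsilon>\<in>{1, - 1}. pscale \<epsilon> (gen_g (s_mat n i j \<epsilon>)))
        | i j. i < n \<and> j < n \<and> i \<noteq> j} \<union>
     {gen_y i * gen_x i - gen_x i * gen_y i -
        (1 - pscale c1 (\<Sum>j\<in>{..<n} - {i}. \<Sum>\<epsilon>\<in>{1, - 1}. gen_g (s_mat n i j \<epsilon>))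
           - pscale cm1 (gen_g (t_mat n i)))
        | i. i < n}"

definition braided_relations :: "nat \<Rightarrow> complex \<Rightarrow> complex \<Rightarrow> generator free set" where
  "braided_relations n c1 cm1 = group_relations n \<union>
     {gen_x i * gen_x j + gen_x j * gen_x i | i j. i < n \<and> j < n \<and> i \<noteq> j} \<union>
     {gen_y i * gen_y j + gen_y j * gen_y i | i j. i < n \<and> j < n \<and> i \<noteq> j} \<union>
     {gen_y i * gen_x j + gen_x j * gen_y i -
        pscale c1 (\<Sum>\<epsilon>\<in>{1, - 1}. pscale \<epsilon> (gen_g (sigma_mat n i j \<epsilon>)))
        | i j. i < n \<and> j < n \<and> i \<noteq> j} \<union>
     {gen_y i * gen_x i - gen_x i * gen_y i -
        (1 + pscale c1 (\<Sum>j\<in>{..<n} - {i}. \<Sum>\<epsilon>\<in>{1, - 1}. gen_g (sigma_mat n i j \<epsilon>))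
           + pscale cm1 (gen_g (t_mat n i)))
        | i. i < n}"

definition cherednik_ideal :: "nat \<Rightarrow> complex \<Rightarrow> complex \<Rightarrow> generator free set" where
  "cherednik_ideal n c1 cm1 =
     genideal (free_algebra (generators n)) (cherednik_relations n c1 cm1)"

definition braided_ideal :: "nat \<Rightarrow> complex \<Rightarrow> complex \<Rightarrow> generator free set" where
  "braided_ideal n c1 cm1 =
     genideal (free_algebra (generators n)) (braided_relations n c1 cm1)"

definition cherednik :: "nat \<Rightarrow> complex \<Rightarrow> complex \<Rightarrow> (complex, generator free set) module" where
  "cherednik n c1 cm1 = quot (free_algebra (generators n)) (cherednik_ideal n c1 cm1)"

definition braided :: "nat \<Rightarrow> complex \<Rightarrow> complex \<Rightarrow> (complex, generator free set) module" where
  "braided n c1 cm1 = quot (free_algebra (generators n)) (braided_ideal n c1 cm1)"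

definition cherednik_class ::
    "nat \<Rightarrow> complex \<Rightarrow> complex \<Rightarrow> generator free \<Rightarrow> generator free set" where
  "cherednik_class n c1 cm1 p = cherednik_ideal n c1 cm1 +>\<^bsub>free_algebra (generators n)\<^esub> p"

definition braided_class ::
    "nat \<Rightarrow> complex \<Rightarrow> complex \<Rightarrow> generator free \<Rightarrow> generator free set" where
  "braided_class n c1 cm1 p = braided_ideal n c1 cm1 +>\<^bsub>free_algebra (generators n)\<^esub> p"


section \<open>The twist\<close>

text \<open>
  \<open>T = (C\<^sub>2)\<^sup>n\<close> is written additively, as the group of functions \<open>nat \<Rightarrow>\<^sub>0 bit\<close> supported in
  \<open>{..<n}\<close>; \<open>\<gamma>\<^sub>i\<close> is the \<open>i\<close>-th unit vector.  The tensor square of the group algebra of \<open>T\<close> is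
  identified with the group algebra of \<open>T \<times> T\<close>, whose product is convolution.
\<close>

type_synonym torus = "nat \<Rightarrow>\<^sub>0 bit"

definition gamma :: "nat \<Rightarrow> torus" where
  "gamma i = Poly_Mapping.single i 1"

definition tensor_T :: "torus \<Rightarrow> torus \<Rightarrow> (torus \<times> torus) \<Rightarrow>\<^sub>0 complex" where
  "tensor_T u v = Poly_Mapping.single (u, v) 1"

definition f_elem :: "nat \<Rightarrow> nat \<Rightarrow> (torus \<times> torus) \<Rightarrow>\<^sub>0 complex" where
  "f_elem i j = pscale (1 / 2)
     (tensor_T 0 0 + tensor_T (gamma i) 0 + tensor_T 0 (gamma j) - tensor_T (gamma i) (gamma j))"

definition F_elem :: "nat \<Rightarrow> (torus \<times> torus) \<Rightarrow>\<^sub>0 complex" where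
  "F_elem n = (\<Prod>(i, j) \<in> {(i, j). j < i \<and> i < n}. f_elem i j)"

definition F_inverse :: "nat \<Rightarrow> (torus \<times> torus) \<Rightarrow>\<^sub>0 complex" where
  "F_inverse n = (THE K. F_elem n * K = 1)"

text \<open>The twist of \<open>A\<close> with respect to an action \<open>act\<close> of \<open>T\<close> by algebra automorphisms.\<close>

definition twist ::
    "nat \<Rightarrow> (torus \<Rightarrow> 'a \<Rightarrow> 'a) \<Rightarrow> (complex, 'a) module \<Rightarrow> (complex, 'a) module" where
  "twist n act A = A\<lparr>monoid.mult := \<lambda>a b.
     finsum A
       (\<lambda>(u, v). Poly_Mapping.lookup (F_inverse n) (u, v) \<odot>\<^bsub>A\<^esub> (act u a \<otimes>\<^bsub>A\<^esub> act v b))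
       (Poly_Mapping.keys (F_inverse n))\<rparr>"

text \<open>
  The element \<open>u = \<gamma>\<^sub>i \<gamma>\<^sub>j \<dots>\<close> of \<open>T\<close> acts on the Cherednik algebra through the product
  \<open>torus_mat n u\<close> of the diagonal matrices \<open>t\<^sub>i, t\<^sub>j, \<dots>\<close>.
\<close>

definition torus_mat :: "nat \<Rightarrow> torus \<Rightarrow> complex mat" where
  "torus_mat n u = lin n (\<lambda>k. (if Poly_Mapping.lookup u k = 0 then 1 else - 1) \<cdot>\<^sub>v unit_vec n k)"

fun torus_on_generator :: "nat \<Rightarrow> torus \<Rightarrow> generator \<Rightarrow> generator free" where
  "torus_on_generator n u (GX i) = on_x n (torus_mat n u) i"
| "torus_on_generator n u (GY i) = on_y n (torus_mat n u) i"
| "torus_on_generator n u (GG g) =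
     gen_g (torus_mat n u * g * inv\<^bsub>G_group n\<^esub> (torus_mat n u))"

definition torus_act ::
    "nat \<Rightarrow> complex \<Rightarrow> complex \<Rightarrow> torus \<Rightarrow> generator free set \<Rightarrow> generator free set" where
  "torus_act n c1 cm1 u =
     quot_map (free_algebra (generators n)) (cherednik_ideal n c1 cm1)
       (free_lift pscale (torus_on_generator n u))"

definition cherednik_twist ::
    "nat \<Rightarrow> complex \<Rightarrow> complex \<Rightarrow> (complex, generator free set) module" where
  "cherednik_twist n c1 cm1 = twist n (torus_act n c1 cm1) (cherednik n c1 cm1)"

text \<open>
  The prescribed values determine \<open>\<phi>\<close>, because the \<open>\<sigma>\<^sub>i\<close> and the diagonal matrices generate the
  group.
\<close>

definition is_phi ::
    "nat \<Rightarrow> complex \<Rightarrow> complex \<Rightarrow> (generator free set \<Rightarrow> generator free set) \<Rightarrow> bool" where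
  "is_phi n c1 cm1 \<phi> \<longleftrightarrow>
     \<phi> \<in> algebra_iso (braided n (- c1) (- cm1)) (cherednik_twist n c1 cm1) \<and>
     (\<forall>i. Suc i < n \<longrightarrow>
        \<phi> (braided_class n (- c1) (- cm1) (gen_g (sigma_mat n i (Suc i) 1))) =
        cherednik_class n c1 cm1 (gen_g (s_mat n i (Suc i) (- 1)))) \<and>
     (\<forall>t \<in> signed_perms n. diagonal_mat t \<longrightarrow>
        \<phi> (braided_class n (- c1) (- cm1) (gen_g t)) = cherednik_class n c1 cm1 (gen_g t)) \<and>
     (\<forall>j<n. \<phi> (braided_class n (- c1) (- cm1) (gen_x j)) = cherednik_class n c1 cm1 (gen_x j)) \<and>
     (\<forall>j<n. \<phi> (braided_class n (- c1) (- cm1) (gen_y j)) = cherednik_class n c1 cm1 (gen_y j))"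


section \<open>Standard modules and their simple quotients\<close>

text \<open>
  The algebra \<open>S(V) # \<complex>G\<close> is the image of the free algebra on the letters \<open>GX i\<close>, \<open>GG g\<close>.  It acts
  on the line \<open>\<tau>\<close> by \<open>char_lift \<tau>\<close>.
\<close>

definition borel_generators :: "nat \<Rightarrow> generator set" where
  "borel_generators n = GX ` {..<n} \<union> GG ` signed_perms n"

fun char_on_generator :: "(complex mat \<Rightarrow> complex) \<Rightarrow> generator \<Rightarrow> complex" where
  "char_on_generator \<tau> (GX i) = 0"
| "char_on_generator \<tau> (GY i) = 0"
| "char_on_generator \<tau> (GG g) = \<tau> g"

definition char_lift :: "(complex mat \<Rightarrow> complex) \<Rightarrow> generator free \<Rightarrow> complex" where
  "char_lift \<tau> = free_lift (*) (char_on_generator \<tau>)"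

text \<open>
  The tensor product over \<open>S(V) # \<complex>G\<close> of the Cherednik algebra with the line \<open>\<complex>\<close> on which \<open>\<tau>\<close>
  is realised: the vector space with basis the symbols \<open>a \<otimes> z\<close>, modulo the bilinearity
  relations and \<open>a b \<otimes> z = a \<otimes> b z\<close> for \<open>b\<close> in \<open>S(V) # \<complex>G\<close>.
\<close>

type_synonym symbols = "(generator free set \<times> complex) \<Rightarrow>\<^sub>0 complex"

definition symb :: "generator free set \<Rightarrow> complex \<Rightarrow> symbols" where
  "symb a z = Poly_Mapping.single (a, z) 1"

definition symbol_space :: "nat \<Rightarrow> complex \<Rightarrow> complex \<Rightarrow> (complex, symbols) module" where
  "symbol_space n c1 cm1 = free_space (carrier (cherednik n c1 cm1) \<times> UNIV)"

definition tensor_relations ::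
    "nat \<Rightarrow> complex \<Rightarrow> complex \<Rightarrow> (complex mat \<Rightarrow> complex) \<Rightarrow> symbols set" where
  "tensor_relations n c1 cm1 \<tau> = (let H = cherednik n c1 cm1 in
     {symb (a \<oplus>\<^bsub>H\<^esub> b) z - symb a z - symb b z | a b z. a \<in> carrier H \<and> b \<in> carrier H} \<union>
     {symb a (z + w) - symb a z - symb a w | a z w. a \<in> carrier H} \<union>
     {symb (u \<odot>\<^bsub>H\<^esub> a) z - pscale u (symb a z) | u a z. a \<in> carrier H} \<union>
     {symb a (u * z) - pscale u (symb a z) | u a z. a \<in> carrier H} \<union>
     {symb (a \<otimes>\<^bsub>H\<^esub> cherednik_class n c1 cm1 b) z - symb a (char_lift \<tau> b * z) | a b z.
        a \<in> carrier H \<and> b \<in> carrier (free_algebra (borel_generators n))})"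

definition tensor_kernel ::
    "nat \<Rightarrow> complex \<Rightarrow> complex \<Rightarrow> (complex mat \<Rightarrow> complex) \<Rightarrow> symbols set" where
  "tensor_kernel n c1 cm1 \<tau> =
     subspace_generated (symbol_space n c1 cm1) (tensor_relations n c1 cm1 \<tau>)"

definition M_space ::
    "nat \<Rightarrow> complex \<Rightarrow> complex \<Rightarrow> (complex mat \<Rightarrow> complex) \<Rightarrow> (complex, symbols set) module" where
  "M_space n c1 cm1 \<tau> = quot (symbol_space n c1 cm1) (tensor_kernel n c1 cm1 \<tau>)"

definition M_act ::
    "nat \<Rightarrow> complex \<Rightarrow> complex \<Rightarrow> (complex mat \<Rightarrow> complex) \<Rightarrow>
     generator free set \<Rightarrow> symbols set \<Rightarrow> symbols set" where
  "M_act n c1 cm1 \<tau> a = quot_map (symbol_space n c1 cm1) (tensor_kernel n c1 cm1 \<tau>)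
     (\<lambda>p. \<Sum>(b, z) \<in> Poly_Mapping.keys p.
        pscale (Poly_Mapping.lookup p (b, z)) (symb (a \<otimes>\<^bsub>cherednik n c1 cm1\<^esub> b) z))"

text \<open>The unique simple quotient \<open>L\<close> of the standard module, as the quotient by \<open>L_kernel\<close>.\<close>

definition L_kernel ::
    "nat \<Rightarrow> complex \<Rightarrow> complex \<Rightarrow> (complex mat \<Rightarrow> complex) \<Rightarrow> symbols set set" where
  "L_kernel n c1 cm1 \<tau> = (THE N.
     subrepresentation (cherednik n c1 cm1) (M_space n c1 cm1 \<tau>) (M_act n c1 cm1 \<tau>) N \<and>
     simple_representation (cherednik n c1 cm1) (quot (M_space n c1 cm1 \<tau>) N)
       (\<lambda>a. quot_map (M_space n c1 cm1 \<tau>) N (M_act n c1 cm1 \<tau> a)))"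

definition L_space ::
    "nat \<Rightarrow> complex \<Rightarrow> complex \<Rightarrow> (complex mat \<Rightarrow> complex) \<Rightarrow> (complex, symbols set set) module"
  where
  "L_space n c1 cm1 \<tau> = quot (M_space n c1 cm1 \<tau>) (L_kernel n c1 cm1 \<tau>)"

definition L_act ::
    "nat \<Rightarrow> complex \<Rightarrow> complex \<Rightarrow> (complex mat \<Rightarrow> complex) \<Rightarrow>
     generator free set \<Rightarrow> symbols set set \<Rightarrow> symbols set set" where
  "L_act n c1 cm1 \<tau> a =
     quot_map (M_space n c1 cm1 \<tau>) (L_kernel n c1 cm1 \<tau>) (M_act n c1 cm1 \<tau> a)"

text \<open>
  The twisted module has underlying space \<open>L_space\<close> and action \<open>\<rho>\<^sub>\<tau> \<circ> \<phi>\<close>, where \<open>\<rho>\<^sub>\<tau> = L_act\<close>.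
\<close>

definition L_twist_act ::
    "nat \<Rightarrow> complex \<Rightarrow> complex \<Rightarrow> (complex mat \<Rightarrow> complex) \<Rightarrow>
     (generator free set \<Rightarrow> generator free set) \<Rightarrow>
     generator free set \<Rightarrow> symbols set set \<Rightarrow> symbols set set" where
  "L_twist_act n c1 cm1 \<tau> \<phi> = L_act n c1 cm1 \<tau> \<circ> \<phi>"

text \<open>
  The representation \<open>(W, act)\<close> of the braided algebra is the one-dimensional representation
  attached to the linear character \<open>\<tau>\<close>.
\<close>

definition is_braided_L ::
    "nat \<Rightarrow> complex \<Rightarrow> complex \<Rightarrow> (complex mat \<Rightarrow> complex) \<Rightarrow>
     (complex, 'w) module \<Rightarrow> (generator free set \<Rightarrow> 'w \<Rightarrow> 'w) \<Rightarrow> bool" where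
  "is_braided_L n c1 cm1 \<tau> W act \<longleftrightarrow>
     alg_representation (braided n c1 cm1) W act \<and> one_dimensional W \<and>
     (\<forall>i<n. \<forall>w \<in> carrier W. act (braided_class n c1 cm1 (gen_x i)) w = \<zero>\<^bsub>W\<^esub>) \<and>
     (\<forall>i<n. \<forall>w \<in> carrier W. act (braided_class n c1 cm1 (gen_y i)) w = \<zero>\<^bsub>W\<^esub>) \<and>
     (\<forall>g \<in> signed_perms n. \<forall>w \<in> carrier W.
        act (braided_class n c1 cm1 (gen_g g)) w = \<tau> g \<odot>\<^bsub>W\<^esub> w)"

end

theory Submission
  imports Defs
begin

text \<open>
  Let \<open>H\<close> be the Cherednik algebra, \<open>M = M(\<tau>)\<close> the standard module and \<open>v = 1 \<otimes> 1\<close> its generator.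

  \<^emph>\<open>The simple quotient.\<close>  Some element \<open>e = - (\<Sum> y\<^sub>i x\<^sub>i) - z\<close> with \<open>z\<close> in the group algebra satisfies
  \<open>[e, y\<^sub>j] = y\<^sub>j\<close> (lemma \<open>euler_y\<close>).  Hence \<open>e\<close> acts on \<open>y\<close>-monomials of degree \<open>d\<close> times \<open>v\<close> by a scalar
  plus \<open>d\<close>, and these vectors span \<open>M\<close>.  The degrees are separated by the eigenvalues of \<open>e\<close>, so a
  submodule containing a vector with a component along \<open>v\<close> contains \<open>v\<close> and is everything.
  If \<open>v \<noteq> 0\<close>, all proper submodules therefore lie in one of them, the radical, and the quotient by
  the radical is the unique simple quotient \<open>L\<close> (lemma \<open>L_kernel_eq\<close>).  If \<open>v = 0\<close> then \<open>M\<close> is zero and every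
  quotient of it has just one element (lemma \<open>one_dimensional_imp_nonzero\<close>).

  \<^emph>\<open>When it is a line.\<close>  On a one-dimensional \<open>L\<close> the \<open>x\<^sub>i\<close> kill \<open>v\<close>, the group acts by \<open>\<tau>\<close>, and \<open>y\<^sub>i\<close> acts by \<open>0\<close>
  because it anticommutes with the invertible \<open>t\<^sub>i\<close>.  The relation for \<open>y\<^sub>i x\<^sub>i - x\<^sub>i y\<^sub>i\<close> then forces
  \<open>1 - 2 (n - 1) c\<^sub>1 \<tau>(s) - c\<^sub>-\<^sub>1 \<tau>(t) = 0\<close>.  Conversely, under this equation \<open>\<tau>\<close> extends by \<open>0\<close> on the \<open>x\<^sub>i\<close>
  and \<open>y\<^sub>i\<close> to a character \<open>\<chi>\<close> of \<open>H\<close>.  It induces a functional on \<open>M\<close> which does not vanish at \<open>v\<close>, and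
  whose kernel is a submodule of codimension one, hence the radical.

  \<^emph>\<open>The twist.\<close>  The torus acts on \<open>H\<close> by conjugation with elements of the group, so \<open>\<chi>\<close> is
  invariant under it and \<open>\<chi>(p \<star> r)\<close> is \<open>\<chi>(p) \<chi>(r)\<close> times the augmentation of
  \<open>\<F>\<^sup>-\<^sup>1\<close>, which is \<open>1\<close> (lemma \<open>\<chi>_star\<close>).  Therefore \<open>\<chi> \<circ> \<phi>\<close> is a character of the braided algebra.  It kills
  the \<open>x\<^sub>i\<close> and \<open>y\<^sub>i\<close>, and its restriction to the group is determined by its values on the generators
  \<open>\<sigma>\<^sub>i\<close> and \<open>t\<^sub>i\<close>: it maps \<open>t\<^sub>i\<close> to \<open>\<tau>(t\<^sub>i)\<close>, and \<open>\<sigma>\<^sub>i = s\<^sub>i t\<^sub>i\<^sub>+\<^sub>1\<close> to \<open>\<tau>(s\<^sub>i)\<close>.  So it maps \<open>s\<^sub>i\<close> to \<open>\<tau>(s\<^sub>i) \<tau>(t\<^sub>i)\<close>, which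
  exchanges \<open>\<kappa>\<close> with \<open>det\<close> and fixes the other two characters.

  All computations take place in the free algebra, a type with ring operations: elements of the
  algebras and of the modules are represented there through the surjections of the locales
  \<open>presented_algebra\<close> and \<open>cyclic_rep\<close>.
\<close>

section \<open>Free algebras\<close>

abbreviation Fr :: "'g set \<Rightarrow> 'g free set" where
  "Fr S \<equiv> carrier (free_algebra S)"

lemma lookup_pscale [simp]:
  "Poly_Mapping.lookup (pscale z p) k = z * Poly_Mapping.lookup p k"
  unfolding pscale_def by (simp add: map.rep_eq when_def)

lemma pscale_0 [simp]: "pscale z 0 = 0" "pscale 0 p = 0"
  by (rule poly_mapping_eqI; simp)+

lemma pscale_1 [simp]: "pscale 1 p = p"
  by (rule poly_mapping_eqI) simp

lemma pscale_minus1: "pscale (- 1) p = - p"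
  by (rule poly_mapping_eqI) simp

lemma pscale_add: "pscale z (p + r) = pscale z p + pscale z r"
  by (rule poly_mapping_eqI) (simp add: lookup_add algebra_simps)

lemma pscale_diff: "pscale z (p - r) = pscale z p - pscale z r"
  by (rule poly_mapping_eqI) (simp add: lookup_minus algebra_simps)

lemma pscale_uminus: "pscale z (- p) = - pscale z p"
  by (rule poly_mapping_eqI) simp

lemma pscale_add_left: "pscale (z + w) p = pscale z p + pscale w p"
  by (rule poly_mapping_eqI) (simp add: lookup_add algebra_simps)

lemma pscale_diff_left: "pscale (z - w) p = pscale z p - pscale w p"
  by (rule poly_mapping_eqI) (simp add: lookup_minus algebra_simps)

lemma pscale_pscale [simp]: "pscale z (pscale w p) = pscale (z * w) p"
  by (rule poly_mapping_eqI) (simp add: mult.assoc)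

lemma pscale_sum: "pscale z (sum f I) = (\<Sum>i\<in>I. pscale z (f i))"
  by (induction I rule: infinite_finite_induct) (auto simp: pscale_add)

lemma pscale_single [simp]: "pscale z (Poly_Mapping.single k w) = Poly_Mapping.single k (z * w)"
  by (rule poly_mapping_eqI) (simp add: lookup_single when_def)

lemma keys_pscale: "Poly_Mapping.keys (pscale z p) \<subseteq> Poly_Mapping.keys p"
  by (auto simp: in_keys_iff)

lemma keys_uminus [simp]: "Poly_Mapping.keys (- p :: 'k \<Rightarrow>\<^sub>0 complex) = Poly_Mapping.keys p"
  by (auto simp: in_keys_iff)

lemma pscale_eq_mult: "pscale z p = Poly_Mapping.single 0 z * p"
  unfolding pscale_def by (rule mult_map_scale_conv_mult)

lemma pscale_mult_left: "pscale z p * r = pscale z (p * r)"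
  by (simp add: pscale_eq_mult mult.assoc)

lemma poly_mapping_sum_singles:
  "p = (\<Sum>k\<in>Poly_Mapping.keys p. Poly_Mapping.single k (Poly_Mapping.lookup p k))"
proof (rule poly_mapping_eqI)
  fix k
  show "Poly_Mapping.lookup p k = Poly_Mapping.lookup
      (\<Sum>k\<in>Poly_Mapping.keys p. Poly_Mapping.single k (Poly_Mapping.lookup p k)) k"
    by (cases "k \<in> Poly_Mapping.keys p")
      (auto simp: lookup_sum lookup_single when_def in_keys_iff)
qed

lemma single_0_commute:
  "Poly_Mapping.single 0 z * p = p * Poly_Mapping.single 0 (z::complex)"
proof -
  have "Poly_Mapping.single 0 z * (\<Sum>k\<in>A. Poly_Mapping.single k (Poly_Mapping.lookup p k))
      = (\<Sum>k\<in>A. Poly_Mapping.single k (Poly_Mapping.lookup p k)) * Poly_Mapping.single 0 z" for A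
    by (simp add: sum_distrib_left sum_distrib_right mult_single mult.commute)
  from this[of "Poly_Mapping.keys p"] show ?thesis
    by (simp flip: poly_mapping_sum_singles)
qed

lemma pscale_mult_right: "p * pscale z r = pscale z (p * r)"
  by (metis pscale_eq_mult single_0_commute mult.assoc)

lemmas pscale_simps = pscale_add pscale_diff pscale_uminus pscale_sum
  pscale_mult_left pscale_mult_right

lemma Fr_iff: "p \<in> Fr S \<longleftrightarrow> (\<forall>w \<in> Poly_Mapping.keys p. set (letters w) \<subseteq> S)"
  by (simp add: free_algebra_def)

lemma Fr_0 [simp]: "0 \<in> Fr S" and Fr_1 [simp]: "1 \<in> Fr S"
  by (auto simp: Fr_iff zero_word_def simp flip: single_one)

lemma Fr_add [simp, intro]: "p \<in> Fr S \<Longrightarrow> r \<in> Fr S \<Longrightarrow> p + r \<in> Fr S"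
  using keys_add[of p r] unfolding Fr_iff by blast

lemma Fr_mult [simp, intro]: "p \<in> Fr S \<Longrightarrow> r \<in> Fr S \<Longrightarrow> p * r \<in> Fr S"
  using keys_mult[of p r] unfolding Fr_iff by (fastforce simp: plus_word_def)

lemma Fr_pscale [simp, intro]: "p \<in> Fr S \<Longrightarrow> pscale z p \<in> Fr S"
  using keys_pscale[of z p] unfolding Fr_iff by blast

lemma Fr_uminus [simp, intro]: "p \<in> Fr S \<Longrightarrow> - p \<in> Fr S"
  by (simp add: Fr_iff)

lemma Fr_diff [simp, intro]: "p \<in> Fr S \<Longrightarrow> r \<in> Fr S \<Longrightarrow> p - r \<in> Fr S"
  using Fr_add[of p S "- r"] by simp

lemma Fr_sum [simp, intro]: "(\<And>i. i \<in> I \<Longrightarrow> f i \<in> Fr S) \<Longrightarrow> sum f I \<in> Fr S"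
  by (induction I rule: infinite_finite_induct) auto

lemma Fr_gen [simp]: "gen a \<in> Fr S \<longleftrightarrow> a \<in> S"
  by (simp add: Fr_iff gen_def)

lemma Fr_mono: "p \<in> Fr S \<Longrightarrow> S \<subseteq> S' \<Longrightarrow> p \<in> Fr S'"
  by (fastforce simp: Fr_iff)

lemma free_algebra_simps [simp]:
  "p \<otimes>\<^bsub>free_algebra S\<^esub> r = p * r" "p \<oplus>\<^bsub>free_algebra S\<^esub> r = p + r"
  "\<zero>\<^bsub>free_algebra S\<^esub> = 0" "\<one>\<^bsub>free_algebra S\<^esub> = 1"
  "z \<odot>\<^bsub>free_algebra S\<^esub> p = pscale z p"
  by (simp_all add: free_algebra_def)

lemma single_Word_Cons:
  "Poly_Mapping.single (Word (a # l)) (z::complex) = pscale z (gen a * Poly_Mapping.single (Word l) 1)"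
  by (simp add: gen_def mult_single plus_word_def)

lemma single_Word_Nil: "Poly_Mapping.single (Word []) (z::complex) = pscale z 1"
  by (simp flip: single_one add: zero_word_def)

text \<open>Linearity reduces a claim on a free algebra to words, which grow letter by letter on the left.\<close>

lemma Fr_induct [consumes 1, case_names one gen add pscale]:
  assumes "p \<in> Fr S"
    and one: "P 1"
    and gen: "\<And>a p. a \<in> S \<Longrightarrow> p \<in> Fr S \<Longrightarrow> P p \<Longrightarrow> P (gen a * p)"
    and add: "\<And>p r. p \<in> Fr S \<Longrightarrow> r \<in> Fr S \<Longrightarrow> P p \<Longrightarrow> P r \<Longrightarrow> P (p + r)"
    and pscale: "\<And>z p. p \<in> Fr S \<Longrightarrow> P p \<Longrightarrow> P (pscale z p)"
  shows "P p"
proof -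
  have mono: "Poly_Mapping.single (Word l) 1 \<in> Fr S \<and> P (Poly_Mapping.single (Word l) 1)"
    if "set l \<subseteq> S" for l
    using that
  proof (induction l)
    case Nil
    then show ?case using one by (simp add: single_Word_Nil)
  next
    case (Cons a l)
    then show ?case using gen by (simp add: single_Word_Cons)
  qed
  have "sum (\<lambda>k. Poly_Mapping.single k (Poly_Mapping.lookup p k)) A \<in> Fr S \<and>
      P (sum (\<lambda>k. Poly_Mapping.single k (Poly_Mapping.lookup p k)) A)"
    if "A \<subseteq> Poly_Mapping.keys p" for A
    using finite_subset[OF that finite_keys] that
  proof (induction A rule: finite_induct)
    case empty
    then show ?case using pscale[of 1 0] one by simp
  next
    case (insert w A)
    have "set (letters w) \<subseteq> S"
      using insert.prems assms(1) by (auto simp: Fr_iff)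
    from mono[OF this] pscale[of _ "Poly_Mapping.lookup p w"]
    have "Poly_Mapping.single w (Poly_Mapping.lookup p w) \<in> Fr S"
      "P (Poly_Mapping.single w (Poly_Mapping.lookup p w))"
      using pscale[of "Poly_Mapping.single w 1" "Poly_Mapping.lookup p w"]
        Fr_pscale[of "Poly_Mapping.single w 1" S "Poly_Mapping.lookup p w"] by auto
    then show ?case using insert add by simp
  qed
  from this[OF order_refl] show ?thesis
    by (simp flip: poly_mapping_sum_singles)
qed

lemma complex_ring_simps [simp]:
  "carrier complex_ring = UNIV" "x \<otimes>\<^bsub>complex_ring\<^esub> y = x * y" "x \<oplus>\<^bsub>complex_ring\<^esub> y = x + y"
  "\<zero>\<^bsub>complex_ring\<^esub> = 0" "\<one>\<^bsub>complex_ring\<^esub> = 1"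
  by (simp_all add: complex_ring_def)

lemma cring_complex_ring: "cring complex_ring"
proof (rule cringI)
  show "abelian_group complex_ring"
  proof (rule abelian_groupI)
    fix x :: complex
    show "\<exists>y\<in>carrier complex_ring. y \<oplus>\<^bsub>complex_ring\<^esub> x = \<zero>\<^bsub>complex_ring\<^esub>"
      by (intro bexI[of _ "- x"]) simp_all
  qed simp_all
  show "Group.comm_monoid complex_ring"
    by (rule comm_monoidI) simp_all
qed (simp add: algebra_simps)

lemma abelian_group_free: "abelian_group (free_algebra S)"
proof (rule abelian_groupI)
  fix x assume "x \<in> Fr S"
  then show "\<exists>y\<in>Fr S. y \<oplus>\<^bsub>free_algebra S\<^esub> x = \<zero>\<^bsub>free_algebra S\<^esub>"
    by (intro bexI[of _ "- x"]) simp_all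
qed (simp_all add: algebra_simps)

lemma ring_free: "ring (free_algebra S)"
  by (rule ringI) (auto intro: abelian_group_free monoidI simp: algebra_simps)

lemma module_free: "module complex_ring (free_algebra S)"
  by (rule moduleI)
    (auto intro: abelian_group_free cring_complex_ring simp: pscale_add pscale_add_left)

lemma a_inv_free [simp]: 
  assumes "p \<in> Fr S" shows "\<ominus>\<^bsub>free_algebra S\<^esub> p = - p"
proof -
  interpret abelian_group "free_algebra S" by (rule abelian_group_free)
  show ?thesis using assms by (intro minus_equality) auto
qed

lemma a_minus_free [simp]: "r \<in> Fr S \<Longrightarrow> p \<ominus>\<^bsub>free_algebra S\<^esub> r = p - r"
  by (simp add: a_minus_def)


section \<open>Quotients\<close>

text \<open>
  Cosets inherit the vector space axioms in this way, without any choice of representatives.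
\<close>

lemma module_image:
  fixes W :: "(complex, 'w) module" and Q :: "(complex, 'v) module"
  assumes "module complex_ring W" and "carrier Q = f ` carrier W"
    and "\<And>v w. v \<in> carrier W \<Longrightarrow> w \<in> carrier W \<Longrightarrow> f v \<oplus>\<^bsub>Q\<^esub> f w = f (v \<oplus>\<^bsub>W\<^esub> w)"
    and "\<And>z w. w \<in> carrier W \<Longrightarrow> z \<odot>\<^bsub>Q\<^esub> f w = f (z \<odot>\<^bsub>W\<^esub> w)"
    and "\<zero>\<^bsub>Q\<^esub> = f \<zero>\<^bsub>W\<^esub>"
  shows "module complex_ring Q"
proof -
  interpret W: module complex_ring W by fact
  show ?thesis
  proof (rule moduleI)
    show "abelian_group Q"
    proof (rule abelian_groupI)
      fix x assume "x \<in> carrier Q"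
      then obtain w where w: "w \<in> carrier W" "x = f w" using assms(2) by auto
      then show "\<exists>y\<in>carrier Q. y \<oplus>\<^bsub>Q\<^esub> x = \<zero>\<^bsub>Q\<^esub>"
        using assms by (intro bexI[of _ "f (\<ominus>\<^bsub>W\<^esub> w)"]) (auto simp: W.M.l_neg)
    qed (auto simp: assms W.M.a_ac)
  qed (use W.smult_l_distr W.smult_r_distr W.smult_assoc1 W.smult_one in
      \<open>auto simp: assms cring_complex_ring\<close>)
qed

context
  fixes W :: "(complex, 'w) module" and N :: "'w set"
  assumes W: "module complex_ring W" and N: "submodule N complex_ring W"
begin

interpretation module complex_ring W by (rule W)
interpretation submodule N complex_ring W by (rule N)
interpretation abelian_subgroup N W
  by (intro abelian_subgroupI3 additive_subgroup.intro) (rule subgroup_axioms, unfold_locales)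

lemma quot_carrier: "carrier (quot W N) = (\<lambda>w. N +>\<^bsub>W\<^esub> w) ` carrier W"
  by (auto simp: quot_def ring.defs module.defs FactRing_def A_RCOSETS_def')

lemma quot_zero: "\<zero>\<^bsub>quot W N\<^esub> = N"
  by (simp add: quot_def ring.defs module.defs FactRing_def)

lemma quot_add:
  "v \<in> carrier W \<Longrightarrow> w \<in> carrier W \<Longrightarrow>
    (N +>\<^bsub>W\<^esub> v) \<oplus>\<^bsub>quot W N\<^esub> (N +>\<^bsub>W\<^esub> w) = N +>\<^bsub>W\<^esub> (v \<oplus>\<^bsub>W\<^esub> w)"
  by (simp add: quot_def ring.defs module.defs FactRing_def a_rcos_sum)

lemma coset_eq_iff:
  assumes "v \<in> carrier W" "w \<in> carrier W"
  shows "N +>\<^bsub>W\<^esub> v = N +>\<^bsub>W\<^esub> w \<longleftrightarrow> v \<ominus>\<^bsub>W\<^esub> w \<in> N"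
proof -
  have "v \<ominus>\<^bsub>W\<^esub> w \<in> N \<longleftrightarrow> v \<in> N +>\<^bsub>W\<^esub> w"
    using a_rcos_module[of w v] assms by (simp add: a_minus_def)
  then show ?thesis
    using assms a_repr_independence a_subgroup a_rcos_self by metis
qed

text \<open>
  Both the scalar multiplication of a quotient and an induced map are defined as a union over a coset.
  All members of that union are the same coset.
\<close>

lemma coset_Union:
  assumes w: "w \<in> carrier W" 
    and f: "\<And>v. v \<in> carrier W \<Longrightarrow> f v \<in> carrier W"
    and f': "\<And>v w. v \<in> carrier W \<Longrightarrow> w \<in> carrier W \<Longrightarrow> f (v \<oplus>\<^bsub>W\<^esub> w) = f v \<oplus>\<^bsub>W\<^esub> f w"
    and fN: "\<And>v. v \<in> N \<Longrightarrow> f v \<in> N"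
  shows "(\<Union>v\<in>N +>\<^bsub>W\<^esub> w. N +>\<^bsub>W\<^esub> f v) = N +>\<^bsub>W\<^esub> f w"
proof -
  have "N +>\<^bsub>W\<^esub> f v = N +>\<^bsub>W\<^esub> f w" if "v \<in> N +>\<^bsub>W\<^esub> w" for v
  proof -
    from that obtain h where h: "h \<in> N" "v = h \<oplus>\<^bsub>W\<^esub> w"
      by (auto simp: a_r_coset_def')
    have c: "h \<in> carrier W" "f h \<in> carrier W" "f w \<in> carrier W"
      using h f w by auto
    have "f v \<ominus>\<^bsub>W\<^esub> f w = f h"
      using c h w f' by (simp add: a_minus_def M.add.m_assoc M.r_neg)
    then show ?thesis
      using coset_eq_iff[of "f v" "f w"] c h w f' fN by simp
  qed
  then show ?thesis using a_rcos_self[OF w] by blast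
qed

lemma quot_smult:
  "w \<in> carrier W \<Longrightarrow> z \<odot>\<^bsub>quot W N\<^esub> (N +>\<^bsub>W\<^esub> w) = N +>\<^bsub>W\<^esub> (z \<odot>\<^bsub>W\<^esub> w)"
  unfolding quot_def ring.defs module.defs
  by (simp add: coset_Union smult_r_distr)

lemma quot_map_coset:
  assumes "w \<in> carrier W" "\<And>v. v \<in> carrier W \<Longrightarrow> f v \<in> carrier W"
    "\<And>v w. v \<in> carrier W \<Longrightarrow> w \<in> carrier W \<Longrightarrow> f (v \<oplus>\<^bsub>W\<^esub> w) = f v \<oplus>\<^bsub>W\<^esub> f w"
    "\<And>v. v \<in> N \<Longrightarrow> f v \<in> N"
  shows "quot_map W N f (N +>\<^bsub>W\<^esub> w) = N +>\<^bsub>W\<^esub> f w"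
  unfolding quot_map_def using assms by (rule coset_Union)

lemma module_quot: "module complex_ring (quot W N)"
proof (rule module_image[OF W quot_carrier])
  show "\<zero>\<^bsub>quot W N\<^esub> = N +>\<^bsub>W\<^esub> \<zero>\<^bsub>W\<^esub>"
    using a_coset_add_zero[OF a_subset] by (simp add: quot_zero)
qed (simp_all add: quot_add quot_smult)

lemma coset_eq_zero_iff: "w \<in> carrier W \<Longrightarrow> N +>\<^bsub>W\<^esub> w = N \<longleftrightarrow> w \<in> N"
  using coset_eq_iff[of w "\<zero>\<^bsub>W\<^esub>"] a_coset_add_zero[OF a_subset]
    M.minus_equality[of "\<zero>\<^bsub>W\<^esub>" "\<zero>\<^bsub>W\<^esub>"]
  by (simp add: a_minus_def)

end

lemma subspace_generated_submodule:
  assumes "module complex_ring W" "S \<subseteq> carrier W"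
  shows "submodule (subspace_generated W S) complex_ring W" "S \<subseteq> subspace_generated W S"
proof -
  interpret module complex_ring W by fact
  have W: "submodule (carrier W) complex_ring W"
    by (rule submoduleI) auto
  let ?N = "{N. submodule N complex_ring W \<and> S \<subseteq> N}"
  show "submodule (subspace_generated W S) complex_ring W"
  proof (rule submoduleI)
    show "subspace_generated W S \<subseteq> carrier W"
      using W assms(2) by (auto simp: subspace_generated_def)
    show "\<zero>\<^bsub>W\<^esub> \<in> subspace_generated W S"
      using submodule.axioms(1) subgroup.one_closed by (fastforce simp: subspace_generated_def)
  qed (use submoduleE in \<open>auto simp: subspace_generated_def\<close>)
  show "S \<subseteq> subspace_generated W S"
    by (auto simp: subspace_generated_def)
qed

lemma subspace_generated_minimal:
  "submodule N complex_ring W \<Longrightarrow> S \<subseteq> N \<Longrightarrow> subspace_generated W S \<subseteq> N"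
  by (auto simp: subspace_generated_def)


section \<open>Algebras and cyclic representations presented by a free algebra\<close>

text \<open>
  Quotient algebras are sets of cosets.  The surjection \<open>q\<close> moves their arithmetic into the free
  algebra, where the simplifier can normalise.
\<close>

locale presented_algebra =
  fixes S :: "'g set" and A :: "(complex, 'a) module" and q :: "'g free \<Rightarrow> 'a"
  assumes carrier_A: "carrier A = q ` Fr S"
    and q_add: "p \<in> Fr S \<Longrightarrow> r \<in> Fr S \<Longrightarrow> q p \<oplus>\<^bsub>A\<^esub> q r = q (p + r)"
    and q_mult: "p \<in> Fr S \<Longrightarrow> r \<in> Fr S \<Longrightarrow> q p \<otimes>\<^bsub>A\<^esub> q r = q (p * r)"
    and q_one: "\<one>\<^bsub>A\<^esub> = q 1"
    and q_smult: "p \<in> Fr S \<Longrightarrow> z \<odot>\<^bsub>A\<^esub> q p = q (pscale z p)"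

lemma ideal_quotient_presented:
  assumes "ideal I (free_algebra S)"
  shows "presented_algebra S (quot (free_algebra S) I) (\<lambda>p. I +>\<^bsub>free_algebra S\<^esub> p)"
    and "submodule I complex_ring (free_algebra S)"
proof -
  interpret ideal I "free_algebra S" by fact
  interpret module complex_ring "free_algebra S" by (rule module_free)
  show sub: "submodule I complex_ring (free_algebra S)"
  proof (rule submoduleI)
    fix z p assume p: "p \<in> I"
    have "pscale z 1 * p \<in> I"
      using I_l_closed[OF p, of "pscale z 1"] by simp
    then show "z \<odot>\<^bsub>free_algebra S\<^esub> p \<in> I"
      by (simp add: pscale_mult_left)
  next
    have I: "subgroup I (add_monoid (free_algebra S))" by (rule a_subgroup)
    show "I \<subseteq> Fr S" by (rule a_subset)
    show "\<zero>\<^bsub>free_algebra S\<^esub> \<in> I" using subgroup.one_closed[OF I] by simp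
    show "\<ominus>\<^bsub>free_algebra S\<^esub> p \<in> I" if "p \<in> I" for p
      using subgroup.m_inv_closed[OF I that] by (simp add: a_inv_def)
    show "p \<oplus>\<^bsub>free_algebra S\<^esub> r \<in> I" if "p \<in> I" "r \<in> I" for p r
      using subgroup.m_closed[OF I that] by simp
  qed
  show "presented_algebra S (quot (free_algebra S) I) (\<lambda>p. I +>\<^bsub>free_algebra S\<^esub> p)"
  proof
    fix p r assume pr: "p \<in> Fr S" "r \<in> Fr S"
    show "(I +>\<^bsub>free_algebra S\<^esub> p) \<otimes>\<^bsub>quot (free_algebra S) I\<^esub> (I +>\<^bsub>free_algebra S\<^esub> r)
        = I +>\<^bsub>free_algebra S\<^esub> (p * r)"
      using rcoset_mult_add[of p r] pr by (simp add: quot_def ring.defs module.defs FactRing_def)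
  next
    show "\<one>\<^bsub>quot (free_algebra S) I\<^esub> = I +>\<^bsub>free_algebra S\<^esub> 1"
      by (simp add: quot_def ring.defs module.defs FactRing_def)
  qed (simp_all add: quot_carrier[OF module_free sub] quot_add[OF module_free sub]
      quot_smult[OF module_free sub])
qed

text \<open>
  \<open>\<Psi> p\<close> stands for \<open>p\<close> applied to the generating vector \<open>\<Psi> 1\<close>.  The locale is stable under quotients
  by subrepresentations, so it serves for standard modules and for their simple quotients alike.
\<close>

locale cyclic_rep = presented_algebra S A q
  for S :: "'g set" and A :: "(complex, 'a) module" and q :: "'g free \<Rightarrow> 'a" +
  fixes W :: "(complex, 'w) module" and act :: "'a \<Rightarrow> 'w \<Rightarrow> 'w" and \<Psi> :: "'g free \<Rightarrow> 'w"
  assumes module_W: "module complex_ring W"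
    and carrier_W: "carrier W = \<Psi> ` Fr S"
    and \<Psi>_add: "p \<in> Fr S \<Longrightarrow> r \<in> Fr S \<Longrightarrow> \<Psi> (p + r) = \<Psi> p \<oplus>\<^bsub>W\<^esub> \<Psi> r"
    and \<Psi>_pscale: "p \<in> Fr S \<Longrightarrow> \<Psi> (pscale z p) = z \<odot>\<^bsub>W\<^esub> \<Psi> p"
    and act_q: "a \<in> Fr S \<Longrightarrow> p \<in> Fr S \<Longrightarrow> act (q a) (\<Psi> p) = \<Psi> (a * p)"
begin

sublocale W: module complex_ring W by (rule module_W)

lemma \<Psi>_closed [simp, intro]: "p \<in> Fr S \<Longrightarrow> \<Psi> p \<in> carrier W"
  by (simp add: carrier_W)

lemma \<Psi>_0 [simp]: "\<Psi> 0 = \<zero>\<^bsub>W\<^esub>"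
  using \<Psi>_pscale[of 0 0] W.smult_l_null[of "\<Psi> 0"] by simp

lemma \<Psi>_uminus: "p \<in> Fr S \<Longrightarrow> \<Psi> (- p) = \<ominus>\<^bsub>W\<^esub> \<Psi> p"
  using \<Psi>_add[of "- p" p] W.M.minus_equality[of "\<Psi> (- p)" "\<Psi> p"] by auto

lemma \<Psi>_diff: "p \<in> Fr S \<Longrightarrow> r \<in> Fr S \<Longrightarrow> \<Psi> (p - r) = \<Psi> p \<ominus>\<^bsub>W\<^esub> \<Psi> r"
  using \<Psi>_add[of p "- r"] by (simp add: \<Psi>_uminus a_minus_def)

lemma \<Psi>_eq_iff: "p \<in> Fr S \<Longrightarrow> r \<in> Fr S \<Longrightarrow> \<Psi> p = \<Psi> r \<longleftrightarrow> \<Psi> (p - r) = \<zero>\<^bsub>W\<^esub>"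
  using W.M.minus_equality[of "\<Psi> p" "\<ominus>\<^bsub>W\<^esub> \<Psi> r"]
  by (auto simp: \<Psi>_diff a_minus_def W.M.r_neg)

lemma \<Psi>_cong_mult:
  "a \<in> Fr S \<Longrightarrow> p \<in> Fr S \<Longrightarrow> r \<in> Fr S \<Longrightarrow> \<Psi> p = \<Psi> r \<Longrightarrow> \<Psi> (a * p) = \<Psi> (a * r)"
  by (simp flip: act_q)

lemma rep: "alg_representation A W act"
  unfolding alg_representation_def
proof (intro conjI ballI allI)
  fix a b w z v
  assume "a \<in> carrier A" "w \<in> carrier W"
  then obtain a' p where [simp]: "a = q a'" "w = \<Psi> p" and ap [simp]: "a' \<in> Fr S" "p \<in> Fr S"
    by (auto simp: carrier_A carrier_W)
  show "act a w \<in> carrier W" by (simp add: act_q)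
  show "act a (z \<odot>\<^bsub>W\<^esub> w) = z \<odot>\<^bsub>W\<^esub> act a w"
    by (simp add: act_q pscale_mult_right flip: \<Psi>_pscale)
  show "act (z \<odot>\<^bsub>A\<^esub> a) w = z \<odot>\<^bsub>W\<^esub> act a w"
    by (simp add: act_q q_smult pscale_mult_left flip: \<Psi>_pscale)
  { assume "b \<in> carrier A"
    then obtain b' where [simp]: "b = q b'" "b' \<in> Fr S" by (auto simp: carrier_A)
    show "act (a \<oplus>\<^bsub>A\<^esub> b) w = act a w \<oplus>\<^bsub>W\<^esub> act b w"
      by (simp add: act_q q_add distrib_right flip: \<Psi>_add)
    show "act (a \<otimes>\<^bsub>A\<^esub> b) w = act a (act b w)"
      by (simp add: act_q q_mult mult.assoc)
  }
  { assume "v \<in> carrier W"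
    then obtain r where [simp]: "v = \<Psi> r" "r \<in> Fr S" by (auto simp: carrier_W)
    show "act a (w \<oplus>\<^bsub>W\<^esub> v) = act a w \<oplus>\<^bsub>W\<^esub> act a v"
      by (simp add: act_q distrib_left flip: \<Psi>_add)
  }
next
  fix w assume "w \<in> carrier W"
  then show "act \<one>\<^bsub>A\<^esub> w = w"
    by (auto simp: carrier_W q_one act_q)
qed (rule module_W)

lemma subrep_image:
  assumes "J \<subseteq> Fr S" "0 \<in> J" "\<And>p r. p \<in> J \<Longrightarrow> r \<in> J \<Longrightarrow> p + r \<in> J"
    and "\<And>a p. a \<in> Fr S \<Longrightarrow> p \<in> J \<Longrightarrow> a * p \<in> J"
  shows "subrepresentation A W act (\<Psi> ` J)"
  unfolding subrepresentation_def
proof (intro conjI ballI)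
  have sc: "pscale z p \<in> J" if "p \<in> J" for z p
    using assms(4)[of "pscale z 1" p] that by (simp add: pscale_mult_left)
  have J: "p \<in> Fr S" if "p \<in> J" for p using that assms(1) by auto
  show "submodule (\<Psi> ` J) complex_ring W"
  proof (rule W.submoduleI)
    show "\<zero>\<^bsub>W\<^esub> \<in> \<Psi> ` J" using assms(2) \<Psi>_0 by (metis image_eqI)
  next
    fix a assume "a \<in> \<Psi> ` J"
    then obtain p where p: "a = \<Psi> p" "p \<in> J" by auto
    then have "\<ominus>\<^bsub>W\<^esub> a = \<Psi> (pscale (- 1) p)" using J by (simp add: pscale_minus1 \<Psi>_uminus)
    then show "\<ominus>\<^bsub>W\<^esub> a \<in> \<Psi> ` J" using sc p by auto
  qed (use J assms(3) sc in \<open>auto simp flip: \<Psi>_add \<Psi>_pscale\<close>)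
  fix a w assume "a \<in> carrier A" "w \<in> \<Psi> ` J"
  then show "act a w \<in> \<Psi> ` J"
    using J assms(4) by (auto simp: carrier_A act_q)
qed

lemma subrep_mult:
  assumes "subrepresentation A W act N" "a \<in> Fr S" "p \<in> Fr S" "\<Psi> p \<in> N"
  shows "\<Psi> (a * p) \<in> N"
  using assms by (auto simp: subrepresentation_def carrier_A simp flip: act_q)

lemma subrep_carrier:
  assumes "subrepresentation A W act N" "w \<in> N"
  obtains p where "p \<in> Fr S" "w = \<Psi> p"
  using assms W.submoduleE(1)[of N] carrier_W by (auto simp: subrepresentation_def)

lemma subrep_full:
  assumes N: "subrepresentation A W act N" "\<Psi> 1 \<in> N"
  shows "N = carrier W"
proof
  show "N \<subseteq> carrier W"
    using N W.submoduleE(1)[of N] by (auto simp: subrepresentation_def)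
  show "carrier W \<subseteq> N"
    using subrep_mult[OF N(1) _ _ N(2)] by (auto simp: carrier_W)
qed

lemma quotient_cyclic:
  assumes "subrepresentation A W act N"
  shows "cyclic_rep S A q (quot W N) (\<lambda>a. quot_map W N (act a)) (\<lambda>p. N +>\<^bsub>W\<^esub> \<Psi> p)"
proof -
  have N: "submodule N complex_ring W" and stable: "\<And>a w. a \<in> carrier A \<Longrightarrow> w \<in> N \<Longrightarrow> act a w \<in> N"
    using assms by (auto simp: subrepresentation_def)
  note r = rep[unfolded alg_representation_def]
  show ?thesis
  proof (intro cyclic_rep.intro cyclic_rep_axioms.intro presented_algebra_axioms)
    fix a p assume ap: "a \<in> Fr S" "p \<in> Fr S"
    have "q a \<in> carrier A" using ap by (simp add: carrier_A)
    then show "quot_map W N (act (q a)) (N +>\<^bsub>W\<^esub> \<Psi> p) = N +>\<^bsub>W\<^esub> \<Psi> (a * p)"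
      using ap r stable by (subst quot_map_coset[OF module_W N]) (auto simp: act_q)
  qed (auto simp: quot_carrier[OF module_W N] quot_add[OF module_W N] quot_smult[OF module_W N]
      module_quot[OF module_W N] carrier_W \<Psi>_add \<Psi>_pscale)
qed

text \<open>
  Subrepresentations of a quotient correspond to subrepresentations above the kernel, so the
  quotient by \<open>N\<close> is simple exactly if \<open>N\<close> is maximal among the proper ones.  A greatest proper
  subrepresentation is the only maximal one.
\<close>

lemma simple_quotient_iff:
  assumes M: "subrepresentation A W act M" "M \<noteq> carrier W"
    and max: "\<And>N. subrepresentation A W act N \<Longrightarrow> N \<noteq> carrier W \<Longrightarrow> N \<subseteq> M"
    and N: "subrepresentation A W act N"
  shows "simple_representation A (quot W N) (\<lambda>a. quot_map W N (act a)) \<longleftrightarrow> N = M"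
proof -
  interpret Q: cyclic_rep S A q "quot W N" "\<lambda>a. quot_map W N (act a)" "\<lambda>p. N +>\<^bsub>W\<^esub> \<Psi> p"
    by (rule quotient_cyclic[OF N])
  have Nsub: "submodule N complex_ring W" using N by (simp add: subrepresentation_def)
  have Nsub': "N \<subseteq> carrier W" using W.submoduleE(1)[OF Nsub] .
  note z = quot_zero[OF module_W Nsub]
  note cz = coset_eq_zero_iff[OF module_W Nsub]
  have full: "carrier (quot W N) = {\<zero>\<^bsub>quot W N\<^esub>} \<longleftrightarrow> N = carrier W"
  proof -
    have "carrier (quot W N) = {\<zero>\<^bsub>quot W N\<^esub>} \<longleftrightarrow> (\<forall>w\<in>carrier W. N +>\<^bsub>W\<^esub> w = N)"
      using W.zero_closed by (auto simp: quot_carrier[OF module_W Nsub] z)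
    also have "\<dots> \<longleftrightarrow> N = carrier W"
      using cz Nsub' by auto
    finally show ?thesis .
  qed
  show ?thesis
  proof
    assume s: "simple_representation A (quot W N) (\<lambda>a. quot_map W N (act a))"
    then have "N \<noteq> carrier W" using full by (simp add: simple_representation_def)
    then have NM: "N \<subseteq> M" using max N by simp
    define J where "J = {p \<in> Fr S. \<Psi> p \<in> M}"
    have Mm: "submodule M complex_ring W" using M by (simp add: subrepresentation_def)
    have "subrepresentation A (quot W N) (\<lambda>a. quot_map W N (act a)) ((\<lambda>p. N +>\<^bsub>W\<^esub> \<Psi> p) ` J)"
    proof (rule Q.subrep_image)
      show "0 \<in> J" using submodule.axioms(1)[OF Mm] subgroup.one_closed by (fastforce simp: J_def)
    qed (use W.submoduleE(5)[OF Mm] subrep_mult[OF M(1)] in \<open>auto simp: J_def \<Psi>_add\<close>)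
    with s have "(\<lambda>p. N +>\<^bsub>W\<^esub> \<Psi> p) ` J = {N} \<or> (\<lambda>p. N +>\<^bsub>W\<^esub> \<Psi> p) ` J = carrier (quot W N)"
      by (auto simp: simple_representation_def z)
    then show "N = M"
    proof
      assume a: "(\<lambda>p. N +>\<^bsub>W\<^esub> \<Psi> p) ` J = {N}"
      have "w \<in> N" if w: "w \<in> M" for w
      proof -
        obtain p where p: "p \<in> Fr S" "w = \<Psi> p" using subrep_carrier[OF M(1) w] .
        then have "N +>\<^bsub>W\<^esub> \<Psi> p = N" using a that by (auto simp: J_def)
        then show ?thesis using cz p by simp
      qed
      then show ?thesis using NM by auto
    next
      assume "(\<lambda>p. N +>\<^bsub>W\<^esub> \<Psi> p) ` J = carrier (quot W N)"
      then have "N +>\<^bsub>W\<^esub> \<Psi> 1 \<in> (\<lambda>p. N +>\<^bsub>W\<^esub> \<Psi> p) ` J" by simp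
      then obtain p where p: "p \<in> J" "N +>\<^bsub>W\<^esub> \<Psi> 1 = N +>\<^bsub>W\<^esub> \<Psi> p" by auto
      then have "\<Psi> 1 \<ominus>\<^bsub>W\<^esub> \<Psi> p \<in> M"
        using coset_eq_iff[OF module_W Nsub, of "\<Psi> 1" "\<Psi> p"] NM by (auto simp: J_def)
      moreover have "\<Psi> p \<in> M" "p \<in> Fr S" using p by (auto simp: J_def)
      ultimately have "(\<Psi> 1 \<ominus>\<^bsub>W\<^esub> \<Psi> p) \<oplus>\<^bsub>W\<^esub> \<Psi> p \<in> M"
        using W.submoduleE(5)[OF Mm] by simp
      moreover have "(\<Psi> 1 \<ominus>\<^bsub>W\<^esub> \<Psi> p) \<oplus>\<^bsub>W\<^esub> \<Psi> p = \<Psi> 1"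
        using \<open>p \<in> Fr S\<close> by (simp add: \<Psi>_diff[symmetric] \<Psi>_add[symmetric])
      ultimately have "\<Psi> 1 \<in> M" by simp
      then show ?thesis using subrep_full[OF M(1)] M(2) by simp
    qed
  next
    assume NM: "N = M"
    show "simple_representation A (quot W N) (\<lambda>a. quot_map W N (act a))"
      unfolding simple_representation_def
    proof (intro conjI allI impI)
      show "alg_representation A (quot W N) (\<lambda>a. quot_map W N (act a))" by (rule Q.rep)
      show "carrier (quot W N) \<noteq> {\<zero>\<^bsub>quot W N\<^esub>}" using full NM M by simp
      fix N' assume N': "subrepresentation A (quot W N) (\<lambda>a. quot_map W N (act a)) N'"
      define J where "J = {p \<in> Fr S. N +>\<^bsub>W\<^esub> \<Psi> p \<in> N'}"
      have N'm: "submodule N' complex_ring (quot W N)"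
        using N' by (simp add: subrepresentation_def)
      have z': "\<zero>\<^bsub>quot W N\<^esub> \<in> N'"
        using submodule.axioms(1)[OF N'm] subgroup.one_closed by fastforce
      have J: "subrepresentation A W act (\<Psi> ` J)"
      proof (rule subrep_image)
        show "0 \<in> J" using z' Q.\<Psi>_0 by (simp add: J_def)
      qed (use Q.W.submoduleE(5)[OF N'm] Q.subrep_mult[OF N'] in \<open>auto simp: J_def Q.\<Psi>_add\<close>)
      show "N' = {\<zero>\<^bsub>quot W N\<^esub>} \<or> N' = carrier (quot W N)"
      proof (cases "\<Psi> ` J = carrier W")
        case True
        then obtain p where p: "p \<in> J" "\<Psi> 1 = \<Psi> p" by (metis Fr_1 \<Psi>_closed imageE)
        then have "N +>\<^bsub>W\<^esub> \<Psi> 1 \<in> N'" by (simp add: J_def)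
        then show ?thesis using Q.subrep_full[OF N'] by simp
      next
        case False
        then have "\<Psi> ` J \<subseteq> N" using max[OF J] NM by simp
        have "w = \<zero>\<^bsub>quot W N\<^esub>" if w: "w \<in> N'" for w
        proof -
          obtain p where p: "p \<in> Fr S" "w = N +>\<^bsub>W\<^esub> \<Psi> p" using Q.subrep_carrier[OF N' w] .
          then have "\<Psi> p \<in> N" using w \<open>\<Psi> ` J \<subseteq> N\<close> by (auto simp: J_def)
          then show ?thesis using p cz z by simp
        qed
        then show ?thesis using z' by blast
      qed
    qed
  qed
qed

end


section \<open>Extending maps of generators to the free algebra\<close>

text \<open>
  Scalars act through a homomorphism \<open>h\<close> into the centre of the target ring.  Two targets occur: the
  complex numbers, for characters, and a free algebra, for substitutions.
\<close>

locale scalar_action =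
  fixes h :: "complex \<Rightarrow> 'b::ring_1" and sc :: "complex \<Rightarrow> 'b \<Rightarrow> 'b"
  assumes sc_eq: "sc z b = h z * b"
    and h_add: "h (z + w) = h z + h w" and h_mult: "h (z * w) = h z * h w"
    and h_one: "h 1 = 1" and h_comm: "h z * b = b * h z"
begin

lemma h_0: "h 0 = 0"
  using h_add[of 0 0] by simp

lemma lift_superset:
  assumes "finite B" "Poly_Mapping.keys p \<subseteq> B"
  shows "free_lift sc f p =
    (\<Sum>w\<in>B. h (Poly_Mapping.lookup p w) * prod_list (map f (letters w)))"
  unfolding free_lift_def sc_eq using assms
  by (intro sum.mono_neutral_left) (auto simp: in_keys_iff h_0)

lemma lift_add: "free_lift sc f (p + r) = free_lift sc f p + free_lift sc f r"
proof -
  let ?B = "Poly_Mapping.keys p \<union> Poly_Mapping.keys r"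
  have "Poly_Mapping.keys (p + r) \<subseteq> ?B" by (rule keys_add)
  then show ?thesis
    by (simp add: lift_superset[of ?B] lookup_add h_add distrib_right sum.distrib)
qed

lemma lift_0 [simp]: "free_lift sc f 0 = 0"
  by (simp add: free_lift_def)

lemma lift_sum: "free_lift sc f (sum g I) = (\<Sum>i\<in>I. free_lift sc f (g i))"
  by (induction I rule: infinite_finite_induct) (auto simp: lift_add)

lemma lift_pscale: "free_lift sc f (pscale z p) = h z * free_lift sc f p"
  using keys_pscale[of z p]
  by (simp add: lift_superset[of "Poly_Mapping.keys p"] h_mult sum_distrib_left mult.assoc)

lemma lift_uminus: "free_lift sc f (- p) = - free_lift sc f p"
  using lift_add[of f p "- p"] by (simp add: eq_neg_iff_add_eq_0 add.commute)

lemma lift_diff: "free_lift sc f (p - r) = free_lift sc f p - free_lift sc f r"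
  using lift_add[of f p "- r"] by (simp add: lift_uminus)

lemma lift_single:
  "free_lift sc f (Poly_Mapping.single w z) = h z * prod_list (map f (letters w))"
  by (subst lift_superset[of "{w}"]) auto

lemma lift_1 [simp]: "free_lift sc f 1 = 1"
  using lift_single[of f 0 1] unfolding single_one by (simp add: h_one zero_word_def)

lemma lift_gen [simp]: "free_lift sc f (gen a) = f a"
  by (simp add: gen_def lift_single h_one)

lemma lift_gen_mult: "free_lift sc f (gen a * p) = f a * free_lift sc f p"
proof -
  have "free_lift sc f (gen a * Poly_Mapping.single w z) = f a * free_lift sc f (Poly_Mapping.single w z)"
    for w z
    by (simp add: gen_def mult_single lift_single plus_word_def h_comm mult.assoc)
  then have "free_lift sc f (gen a * (\<Sum>w\<in>B. Poly_Mapping.single w (Poly_Mapping.lookup p w)))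
     = f a * free_lift sc f (\<Sum>w\<in>B. Poly_Mapping.single w (Poly_Mapping.lookup p w))" for B
    by (simp add: sum_distrib_left lift_sum)
  from this[of "Poly_Mapping.keys p"] show ?thesis
    by (simp flip: poly_mapping_sum_singles)
qed

lemma lift_mult: "free_lift sc f (p * r) = free_lift sc f p * free_lift sc f r"
proof -
  have "p \<in> Fr UNIV" by (simp add: Fr_iff)
  then show ?thesis
    by (induction p rule: Fr_induct)
      (simp_all add: mult.assoc lift_gen_mult distrib_right lift_add pscale_mult_left lift_pscale)
qed

lemmas lift_simps = lift_add lift_diff lift_mult lift_pscale lift_uminus lift_sum

end

interpretation char: scalar_action "\<lambda>z. z" "(*)"
  by standard (auto simp: algebra_simps)

interpretation subst: scalar_action "\<lambda>z. Poly_Mapping.single 0 z" 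
    "pscale :: complex \<Rightarrow> 'g free \<Rightarrow> _"
  by standard (auto simp: pscale_eq_mult single_add mult_single single_0_commute)

lemma subst_Fr:
  assumes "\<And>a. a \<in> S \<Longrightarrow> f a \<in> Fr S'" "p \<in> Fr S"
  shows "free_lift pscale f p \<in> Fr S'"
  using assms(2)
  by (induction p rule: Fr_induct)
    (simp_all add: subst.lift_simps assms(1) flip: pscale_eq_mult)


section \<open>Signed permutation matrices\<close>

definition signed_mat :: "nat \<Rightarrow> (nat \<Rightarrow> nat) \<Rightarrow> (nat \<Rightarrow> complex) \<Rightarrow> complex mat" where
  "signed_mat n \<pi> \<epsilon> = lin n (\<lambda>k. \<epsilon> k \<cdot>\<^sub>v unit_vec n (\<pi> k))"

lemma dim_lin [simp]: "dim_row (lin n f) = n" "dim_col (lin n f) = n"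
  by (simp_all add: lin_def)

lemma dim_signed_mat [simp]: "dim_row (signed_mat n \<pi> \<epsilon>) = n" "dim_col (signed_mat n \<pi> \<epsilon>) = n"
  by (simp_all add: signed_mat_def)

lemma lin_entry [simp]: "j < n \<Longrightarrow> k < n \<Longrightarrow> lin n f $$ (j, k) = f k $ j"
  by (simp add: lin_def mat_of_cols_def)

lemma signed_mat_entry [simp]:
  "j < n \<Longrightarrow> k < n \<Longrightarrow> \<pi> k < n \<Longrightarrow> signed_mat n \<pi> \<epsilon> $$ (j, k) = (if j = \<pi> k then \<epsilon> k else 0)"
  by (simp add: signed_mat_def)

lemma permutes_less [simp]: "\<pi> permutes {..<n} \<Longrightarrow> \<pi> k < n \<longleftrightarrow> k < n"
  using permutes_in_image[of \<pi> "{..<n}" k] by simp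

lemma signed_mat_cong:
  assumes "\<pi> permutes {..<n}" "\<And>k. k < n \<Longrightarrow> \<pi> k = \<pi>' k" "\<And>k. k < n \<Longrightarrow> \<epsilon> k = \<epsilon>' k"
  shows "signed_mat n \<pi> \<epsilon> = signed_mat n \<pi>' \<epsilon>'"
  by (rule eq_matI) (use assms in \<open>auto simp: signed_mat_def\<close>)

lemma signed_mat_mult:
  assumes "\<pi> permutes {..<n}" "\<pi>' permutes {..<n}"
  shows "signed_mat n \<pi> \<epsilon> * signed_mat n \<pi>' \<epsilon>' = signed_mat n (\<pi> \<circ> \<pi>') (\<lambda>k. \<epsilon>' k * \<epsilon> (\<pi>' k))"
proof (rule eq_matI)
  fix j k assume "j < dim_row (signed_mat n (\<pi> \<circ> \<pi>') (\<lambda>k. \<epsilon>' k * \<epsilon> (\<pi>' k)))"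
    "k < dim_col (signed_mat n (\<pi> \<circ> \<pi>') (\<lambda>k. \<epsilon>' k * \<epsilon> (\<pi>' k)))"
  then have jk: "j < n" "k < n" by simp_all
  have "(signed_mat n \<pi> \<epsilon> * signed_mat n \<pi>' \<epsilon>') $$ (j, k) =
      (\<Sum>l = 0..<n. signed_mat n \<pi> \<epsilon> $$ (j, l) * signed_mat n \<pi>' \<epsilon>' $$ (l, k))"
    using jk by (simp add: scalar_prod_def)
  also have "\<dots> = (\<Sum>l = 0..<n. if l = \<pi>' k then (if j = \<pi> l then \<epsilon> l * \<epsilon>' k else 0) else 0)"
    using jk assms by (intro sum.cong) auto
  also have "\<dots> = signed_mat n (\<pi> \<circ> \<pi>') (\<lambda>k. \<epsilon>' k * \<epsilon> (\<pi>' k)) $$ (j, k)"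
    using jk assms by simp
  finally show "(signed_mat n \<pi> \<epsilon> * signed_mat n \<pi>' \<epsilon>') $$ (j, k) = \<dots>" .
qed simp_all

lemma signed_mat_one: "signed_mat n id (\<lambda>_. 1) = 1\<^sub>m n"
  by (rule eq_matI) simp_all

lemma signed_permsE:
  assumes "g \<in> signed_perms n"
  obtains \<pi> \<epsilon> where "\<pi> permutes {..<n}" "\<And>k. \<epsilon> k \<in> {1, - 1}" "g = signed_mat n \<pi> \<epsilon>"
  using assms by (auto simp: signed_perms_def signed_mat_def)

lemma signed_mat_in:
  assumes "\<pi> permutes {..<n}" "\<And>k. k < n \<Longrightarrow> \<epsilon> k \<in> {1, - 1}"
  shows "signed_mat n \<pi> \<epsilon> \<in> signed_perms n"
proof -
  have "signed_mat n \<pi> \<epsilon> = signed_mat n \<pi> (\<lambda>k. if k < n then \<epsilon> k else 1)"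
    using assms(1) by (rule signed_mat_cong) auto
  moreover have "signed_mat n \<pi> (\<lambda>k. if k < n then \<epsilon> k else 1) \<in> signed_perms n"
    unfolding signed_perms_def mem_Collect_eq
    by (intro exI conjI allI, rule signed_mat_def) (use assms in auto)
  ultimately show ?thesis by simp
qed

lemma signed_perms_mult [simp, intro]:
  "g \<in> signed_perms n \<Longrightarrow> h \<in> signed_perms n \<Longrightarrow> g * h \<in> signed_perms n"
proof (elim signed_permsE)
  fix \<pi> \<epsilon> \<pi>' \<epsilon>'
  assume "\<pi> permutes {..<n}" "\<And>k. \<epsilon> k \<in> {1, - 1}" "g = signed_mat n \<pi> \<epsilon>"
    "\<pi>' permutes {..<n}" "\<And>k. \<epsilon>' k \<in> {1, - 1}" "h = signed_mat n \<pi>' \<epsilon>'"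
  moreover have "\<epsilon>' k * \<epsilon> (\<pi>' k) \<in> {1, - 1}" for k
    using calculation(2)[of "\<pi>' k"] calculation(5)[of k] by auto
  ultimately show "g * h \<in> signed_perms n"
    by (simp only: signed_mat_mult signed_mat_in permutes_compose)
qed

lemma one_signed_perms [simp]: "1\<^sub>m n \<in> signed_perms n"
  unfolding signed_mat_one[symmetric] by (rule signed_mat_in) (auto simp: permutes_id)

lemma signed_perms_carrier_mat: "g \<in> signed_perms n \<Longrightarrow> g \<in> carrier_mat n n"
  by (elim signed_permsE) auto

lemma signed_mat_left_inverse:
  assumes "\<pi> permutes {..<n}" "\<And>k. \<epsilon> k \<in> {1, - 1}"
  shows "signed_mat n (inv_into UNIV \<pi>) (\<lambda>k. \<epsilon> (inv_into UNIV \<pi> k)) * signed_mat n \<pi> \<epsilon> = 1\<^sub>m n"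
proof -
  have "\<epsilon> k * \<epsilon> k = 1" for k using assms(2)[of k] by auto
  moreover have "inv_into UNIV \<pi> (\<pi> k) = k" for k
    using assms(1) by (simp add: permutes_inverses)
  ultimately show ?thesis
    using assms(1) unfolding signed_mat_one[symmetric]
    by (simp add: signed_mat_mult permutes_inv permutes_inv_o)
qed

lemma G_group_simps [simp]:
  "carrier (G_group n) = signed_perms n" "\<one>\<^bsub>G_group n\<^esub> = 1\<^sub>m n" "g \<otimes>\<^bsub>G_group n\<^esub> h = g * h"
  by (simp_all add: G_group_def)

lemma group_G_group: "group (G_group n)"
proof (rule groupI)
  fix g h l assume "g \<in> carrier (G_group n)" "h \<in> carrier (G_group n)" "l \<in> carrier (G_group n)"
  then show "g \<otimes>\<^bsub>G_group n\<^esub> h \<otimes>\<^bsub>G_group n\<^esub> l = g \<otimes>\<^bsub>G_group n\<^esub> (h \<otimes>\<^bsub>G_group n\<^esub> l)"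
    using signed_perms_carrier_mat by (force intro!: assoc_mult_mat)
next
  fix g assume g: "g \<in> carrier (G_group n)"
  then show "\<one>\<^bsub>G_group n\<^esub> \<otimes>\<^bsub>G_group n\<^esub> g = g"
    using signed_perms_carrier_mat[of g n] by simp
  obtain \<pi> \<epsilon> where p: "\<pi> permutes {..<n}" "\<And>k. \<epsilon> k \<in> {1, - 1}" "g = signed_mat n \<pi> \<epsilon>"
    using signed_permsE[of g n] g by (metis G_group_simps(1))
  show "\<exists>h\<in>carrier (G_group n). h \<otimes>\<^bsub>G_group n\<^esub> g = \<one>\<^bsub>G_group n\<^esub>"
    using signed_mat_left_inverse[OF p(1,2)] p
    by (intro bexI[of _ "signed_mat n (inv_into UNIV \<pi>) (\<lambda>k. \<epsilon> (inv_into UNIV \<pi> k))"])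
      (auto intro!: signed_mat_in permutes_inv)
qed auto

lemma inv_signed_mat:
  assumes "\<pi> permutes {..<n}" "\<And>k. \<epsilon> k \<in> {1, - 1}"
  shows "inv\<^bsub>G_group n\<^esub> signed_mat n \<pi> \<epsilon> =
    signed_mat n (inv_into UNIV \<pi>) (\<lambda>k. \<epsilon> (inv_into UNIV \<pi> k))"
  using signed_mat_left_inverse[OF assms] assms
  by (intro group.inv_equality[OF group_G_group])
    (auto intro!: signed_mat_in permutes_inv)

text \<open>
  Signed permutation matrices are orthogonal, so \<open>V\<close> and its dual transform by the same formula.
\<close>

lemma on_x_signed:
  assumes "\<pi> permutes {..<n}" "i < n"
  shows "on_x n (signed_mat n \<pi> \<epsilon>) i = pscale (\<epsilon> i) (gen_x (\<pi> i))"
proof -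
  have "on_x n (signed_mat n \<pi> \<epsilon>) i = (\<Sum>k<n. if k = \<pi> i then pscale (\<epsilon> i) (gen_x k) else 0)"
    unfolding on_x_def using assms by (intro sum.cong) auto
  then show ?thesis using assms by simp
qed

lemma on_y_signed:
  assumes "\<pi> permutes {..<n}" "\<And>k. \<epsilon> k \<in> {1, - 1}" "i < n"
  shows "on_y n (signed_mat n \<pi> \<epsilon>) i = pscale (\<epsilon> i) (gen_y (\<pi> i))"
proof -
  have inv: "inv_into UNIV \<pi> permutes {..<n}" using assms(1) by (rule permutes_inv)
  have eq: "i = inv_into UNIV \<pi> k \<longleftrightarrow> k = \<pi> i" for k
    using permutes_inverses[OF assms(1)] by metis
  have "on_y n (signed_mat n \<pi> \<epsilon>) i = (\<Sum>k<n. if k = \<pi> i then pscale (\<epsilon> i) (gen_y k) else 0)"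
    unfolding on_y_def inv_signed_mat[OF assms(1,2)]
    using assms(3) inv eq permutes_inverses[OF assms(1)]
    by (intro sum.cong) (auto)
  then show ?thesis using assms by simp
qed

lemma permutes_transpose: "i < n \<Longrightarrow> j < n \<Longrightarrow> transpose i j permutes {..<n}"
  by (rule permutes_swap_id) auto

lemma s_mat_signed:
  assumes "i < n" "j < n" "i \<noteq> j" "\<epsilon> \<in> {1, - 1}"
  shows "s_mat n i j \<epsilon> = signed_mat n (transpose i j) (\<lambda>k. if k = i \<or> k = j then \<epsilon> else 1)"
  by (rule eq_matI)
    (use assms in \<open>auto simp: s_mat_def signed_mat_def transpose_def\<close>)

lemma sigma_mat_signed:
  assumes "i < n" "j < n" "i \<noteq> j" "\<epsilon> \<in> {1, - 1}"
  shows "sigma_mat n i j \<epsilon> =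
    signed_mat n (transpose i j) (\<lambda>k. if k = i then \<epsilon> else if k = j then - \<epsilon> else 1)"
  by (rule eq_matI)
    (use assms in \<open>auto simp: sigma_mat_def signed_mat_def transpose_def\<close>)

lemma t_mat_signed: "t_mat n i = signed_mat n id (\<lambda>k. if k = i then - 1 else 1)"
  by (rule eq_matI) (auto simp: t_mat_def signed_mat_def)

definition torus_sign :: "torus \<Rightarrow> nat \<Rightarrow> complex" where
  "torus_sign u k = (if Poly_Mapping.lookup u k = 0 then 1 else - 1)"

lemma torus_mat_signed: "torus_mat n u = signed_mat n id (torus_sign u)"
  by (simp add: torus_mat_def signed_mat_def torus_sign_def)

lemma torus_sign_cases: "torus_sign u k \<in> {1, - 1}" and torus_sign_square: "torus_sign u k * torus_sign u k = 1"
  by (auto simp: torus_sign_def)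

lemma special_in [simp]:
  "i < n \<Longrightarrow> j < n \<Longrightarrow> i \<noteq> j \<Longrightarrow> \<epsilon> \<in> {1, - 1} \<Longrightarrow> s_mat n i j \<epsilon> \<in> signed_perms n"
  "i < n \<Longrightarrow> j < n \<Longrightarrow> i \<noteq> j \<Longrightarrow> \<epsilon> \<in> {1, - 1} \<Longrightarrow> sigma_mat n i j \<epsilon> \<in> signed_perms n"
  "t_mat n i \<in> signed_perms n" "torus_mat n u \<in> signed_perms n"
  using torus_sign_cases[of u]
  by (auto simp: s_mat_signed sigma_mat_signed t_mat_signed torus_mat_signed
      intro!: signed_mat_in permutes_transpose permutes_id split: if_splits)

text \<open>
  The generators \<open>\<sigma>\<^sub>i\<close> and \<open>t\<^sub>i\<close> are among the elements on which the isomorphism \<open>\<phi>\<close> is prescribed.  They suffice, since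
  \<open>\<sigma>\<^sub>i t\<^sub>i\<^sub>+\<^sub>1\<close> is the permutation matrix of an adjacent transposition.
\<close>

lemma signed_perms_induct [consumes 1, case_names one mult sigma t]:
  assumes g: "g \<in> signed_perms n"
    and one: "P (1\<^sub>m n)"
    and mult: "\<And>g h. g \<in> signed_perms n \<Longrightarrow> h \<in> signed_perms n \<Longrightarrow> P g \<Longrightarrow> P h \<Longrightarrow> P (g * h)"
    and sigma: "\<And>i. Suc i < n \<Longrightarrow> P (sigma_mat n i (Suc i) 1)"
    and t: "\<And>i. i < n \<Longrightarrow> P (t_mat n i)"
  shows "P g"
proof -
  obtain \<pi> \<epsilon> where p: "\<pi> permutes {..<n}" "\<And>k. \<epsilon> k \<in> {1, - 1}" "g = signed_mat n \<pi> \<epsilon>"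
    using signed_permsE[OF g] by metis
  have diag: "P (signed_mat n id (\<lambda>k. if k \<in> B then - 1 else 1))" if "finite B" "B \<subseteq> {..<n}" for B
    using that
  proof (induction B rule: finite_induct)
    case empty
    then show ?case using one[folded signed_mat_one] by (simp add: id_def)
  next
    case (insert b B)
    have "signed_mat n id (\<lambda>k. if k \<in> insert b B then - 1 else 1)
        = t_mat n b * signed_mat n id (\<lambda>k. if k \<in> B then - 1 else 1)"
      unfolding t_mat_signed using insert.hyps
      by (subst signed_mat_mult) (auto simp: permutes_id intro!: signed_mat_cong)
    moreover have "signed_mat n id (\<lambda>k. if k \<in> B then - 1 else 1) \<in> signed_perms n"
      by (rule signed_mat_in) (auto simp: permutes_id)
    ultimately show ?case
      using insert mult[of "t_mat n b"] t[of b] by (simp add: id_def)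
  qed
  have adj: "P (signed_mat n (transpose i (Suc i)) (\<lambda>_. 1))" if "Suc i < n" for i
  proof -
    have "signed_mat n (transpose i (Suc i)) (\<lambda>_. 1) = sigma_mat n i (Suc i) 1 * t_mat n (Suc i)"
      using that unfolding t_mat_signed
      by (subst sigma_mat_signed, simp_all, subst signed_mat_mult)
        (auto intro!: permutes_transpose signed_mat_cong simp: permutes_id)
    then show ?thesis using mult sigma[OF that] t that by simp
  qed
  have unsigned: "signed_mat n \<pi> (\<lambda>_. 1) \<in> signed_perms n" if "\<pi> permutes {..<n}" for \<pi>
    using that by (rule signed_mat_in) auto
  \<comment> \<open>Conjugating by an adjacent transposition lengthens a transposition by one.\<close>
  have tr': "P (signed_mat n (transpose a (Suc (a + d))) (\<lambda>_. 1))" if "Suc (a + d) < n" for a d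
    using that
  proof (induction d)
    case 0
    then show ?case using adj[of a] by simp
  next
    case (Suc d)
    define b where "b = Suc (a + d)"
    have ab: "a < n" "b < n" "Suc b < n" "a \<noteq> b" "a \<noteq> Suc b" using Suc.prems by (auto simp: b_def)
    have eq: "transpose a (Suc b) = transpose b (Suc b) \<circ> transpose a b \<circ> transpose b (Suc b)"
      using ab by (auto simp: fun_eq_iff transpose_def)
    have "signed_mat n (transpose a (Suc b)) (\<lambda>_. 1) =
        signed_mat n (transpose b (Suc b)) (\<lambda>_. 1) * signed_mat n (transpose a b) (\<lambda>_. 1)
          * signed_mat n (transpose b (Suc b)) (\<lambda>_. 1)"
      unfolding eq using ab by (simp add: signed_mat_mult permutes_transpose permutes_compose)
    then show ?case
      using Suc ab adj[of b]
      by (auto intro!: mult unsigned permutes_transpose simp flip: b_def)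
  qed
  have tr: "P (signed_mat n (transpose a b) (\<lambda>_. 1))" if "a < n" "b < n" for a b
  proof (cases a b rule: linorder_cases)
    case less
    then show ?thesis using tr'[of a "b - Suc a"] that by simp
  next
    case equal
    then show ?thesis using one[folded signed_mat_one] by simp
  next
    case greater
    then show ?thesis using tr'[of b "a - Suc b"] that by (simp add: transpose_commute)
  qed
  have perm: "P (signed_mat n \<pi> (\<lambda>_. 1))" if "\<pi> permutes {..<n}" for \<pi>
    using that finite_lessThan[of n]
  proof (induction rule: permutes_induct)
    case id
    then show ?case using one[folded signed_mat_one] by (simp add: id_def)
  next
    case (swap a b p)
    have "signed_mat n (transpose a b \<circ> p) (\<lambda>_. 1)
        = signed_mat n (transpose a b) (\<lambda>_. 1) * signed_mat n p (\<lambda>_. 1)"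
      using swap by (simp add: signed_mat_mult permutes_transpose)
    then show ?case
      using swap tr[of a b] mult[OF unsigned unsigned, of "transpose a b" p]
      by (simp add: permutes_transpose comp_def)
  qed
  let ?B = "{k. k < n \<and> \<epsilon> k = - 1}"
  have "g = signed_mat n \<pi> (\<lambda>_. 1) * signed_mat n id (\<lambda>k. if k \<in> ?B then - 1 else 1)"
    using p(2) unfolding p(3) signed_mat_mult[OF p(1) permutes_id]
    by (intro signed_mat_cong) (auto simp: p(1))
  moreover have "P (signed_mat n \<pi> (\<lambda>_. 1) * signed_mat n id (\<lambda>k. if k \<in> ?B then - 1 else 1))"
  proof (rule mult[OF unsigned[OF p(1)] _ perm[OF p(1)]])
    show "signed_mat n id (\<lambda>k. if k \<in> ?B then - 1 else 1) \<in> signed_perms n"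
      by (rule signed_mat_in) (auto simp: permutes_id)
    show "P (signed_mat n id (\<lambda>k. if k \<in> ?B then - 1 else 1))"
      by (rule diag) auto
  qed
  ultimately show ?thesis by simp
qed


section \<open>Linear characters\<close>

text \<open>
  All \<open>s\<^sub>i\<^sub>j\<close> are conjugate and so are all \<open>t\<^sub>k\<close>; hence a linear character is recorded by its
  values \<open>a\<close> and \<open>b\<close> on the two classes of reflections.
\<close>

definition linear_character :: "nat \<Rightarrow> (complex mat \<Rightarrow> complex) \<Rightarrow> complex \<Rightarrow> complex \<Rightarrow> bool" where
  "linear_character n \<tau> a b \<longleftrightarrow> \<tau> (1\<^sub>m n) = 1 \<and>
     (\<forall>g \<in> signed_perms n. \<forall>h \<in> signed_perms n. \<tau> (g * h) = \<tau> g * \<tau> h) \<and>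
     (\<forall>i<n. \<forall>j<n. \<forall>\<epsilon>\<in>{1, - 1}. i \<noteq> j \<longrightarrow> \<tau> (s_mat n i j \<epsilon>) = a) \<and>
     (\<forall>i<n. \<tau> (t_mat n i) = b)"

lemma kappa_signed:
  assumes "\<pi> permutes {..<n}"
  shows "kappa_char n (signed_mat n \<pi> \<epsilon>) = (\<Prod>k<n. \<epsilon> k)"
  unfolding kappa_char_def using assms by (intro prod.cong) auto

lemma linear_character_triv: "linear_character n (triv_char n) 1 1"
  by (simp add: linear_character_def triv_char_def)

lemma linear_character_kappa: "linear_character n (kappa_char n) 1 (- 1)"
  unfolding linear_character_def
proof (intro conjI ballI allI impI)
  show "kappa_char n (1\<^sub>m n) = 1"
    unfolding signed_mat_one[symmetric] by (simp add: kappa_signed permutes_id)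
  fix g h assume "g \<in> signed_perms n" "h \<in> signed_perms n"
  then obtain \<pi> \<epsilon> \<pi>' \<epsilon>' where p: "\<pi> permutes {..<n}" "\<pi>' permutes {..<n}"
    and gh: "g = signed_mat n \<pi> \<epsilon>" "h = signed_mat n \<pi>' \<epsilon>'"
    by (metis signed_permsE)
  have "(\<Prod>k<n. \<epsilon> (\<pi>' k)) = (\<Prod>k<n. \<epsilon> k)"
    using prod.permute[OF p(2), of \<epsilon>] by (simp add: comp_def)
  then show "kappa_char n (g * h) = kappa_char n g * kappa_char n h"
    using p by (simp add: gh signed_mat_mult kappa_signed permutes_compose prod.distrib)
next
  fix i j \<epsilon> assume ij: "i < n" "j < n" "\<epsilon> \<in> {1, - 1 :: complex}" "i \<noteq> j"
  have "(\<Prod>k<n. if k = i \<or> k = j then \<epsilon> else 1) = (\<Prod>k\<in>{i, j}. \<epsilon>)"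
    using ij by (intro prod.mono_neutral_cong_right) auto
  also have "\<dots> = 1" using ij by auto
  finally show "kappa_char n (s_mat n i j \<epsilon>) = 1"
    using ij by (simp add: s_mat_signed kappa_signed permutes_transpose)
next
  fix i assume "i < n"
  then show "kappa_char n (t_mat n i) = - 1"
    by (simp add: t_mat_signed kappa_signed permutes_id)
qed

lemma linear_character_det: "linear_character n (det_char n) (- 1) (- 1)"
  unfolding linear_character_def det_char_def
proof (intro conjI ballI allI impI)
  fix g h assume "g \<in> signed_perms n" "h \<in> signed_perms n"
  then show "det (g * h) = det g * det h"
    using signed_perms_carrier_mat by (intro det_mult) auto
next
  have t: "det (t_mat n i) = - 1" if "i < n" for i
  proof -
    have "t_mat n i = multrow_mat n i (- 1)"
      using that by (intro eq_matI) (auto simp: t_mat_def)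
    then show ?thesis using that by (simp add: det_multrow_mat)
  qed
  then show "det (t_mat n i) = - 1" if "i < n" for i using that .
  fix i j \<epsilon> assume ij: "i < n" "j < n" "\<epsilon> \<in> {1, - 1 :: complex}" "i \<noteq> j"
  have "s_mat n i j 1 = swaprows_mat n i j"
    using ij by (intro eq_matI) (auto simp: s_mat_def)
  then have s: "det (s_mat n i j 1) = - 1"
    using ij by (simp add: det_swaprows_mat)
  have "s_mat n i j (- 1) = s_mat n i j 1 * (t_mat n i * t_mat n j)"
    using ij unfolding t_mat_signed
    by (simp add: s_mat_signed signed_mat_mult permutes_transpose permutes_id)
      (auto intro!: signed_mat_cong permutes_transpose)
  also have "det \<dots> = det (s_mat n i j 1) * (det (t_mat n i) * det (t_mat n j))"
    using ij det_mult[of "t_mat n i" n "t_mat n j"]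
      det_mult[of "s_mat n i j 1" n "t_mat n i * t_mat n j"]
    by (simp add: signed_perms_carrier_mat)
  finally have "det (s_mat n i j (- 1)) = - 1"
    using s t ij by simp
  then show "det (s_mat n i j \<epsilon>) = - 1" using s ij by auto
qed simp

lemma linear_character_kappa_det: "linear_character n (kappa_det_char n) (- 1) 1"
  using linear_character_kappa[of n] linear_character_det[of n]
  unfolding linear_character_def kappa_det_char_def by simp

text \<open>
  This holds because \<open>\<sigma>\<^sub>i\<^sub>j = s\<^sub>i\<^sub>j t\<^sub>j\<close>.
\<close>

lemma linear_character_sigma:
  assumes "linear_character n \<tau> a b" "i < n" "j < n" "i \<noteq> j"
  shows "\<tau> (sigma_mat n i j 1) = a * b"
proof -
  have "sigma_mat n i j 1 = s_mat n i j 1 * t_mat n j"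
    using assms unfolding t_mat_signed
    by (simp add: s_mat_signed sigma_mat_signed signed_mat_mult permutes_transpose permutes_id)
      (auto intro!: signed_mat_cong permutes_transpose)
  then show ?thesis using assms by (simp add: linear_character_def)
qed


section \<open>The two algebras as quotients of the free algebra\<close>

lemma generators_iff [simp]:
  "GX i \<in> generators n \<longleftrightarrow> i < n" "GY i \<in> generators n \<longleftrightarrow> i < n"
  "GG g \<in> generators n \<longleftrightarrow> g \<in> signed_perms n"
  by (auto simp: generators_def)

lemma borel_generators_iff [simp]:
  "GX i \<in> borel_generators n \<longleftrightarrow> i < n" "GY i \<notin> borel_generators n"
  "GG g \<in> borel_generators n \<longleftrightarrow> g \<in> signed_perms n"
  by (auto simp: borel_generators_def)

lemma on_xy_Fr [simp]: "on_x n g i \<in> Fr (generators n)" "on_y n g i \<in> Fr (generators n)"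
  by (auto simp: on_x_def on_y_def)

lemma group_relations_Fr: "group_relations n \<subseteq> Fr (generators n)"
  by (auto simp: group_relations_def)

lemma cherednik_relations_Fr: "cherednik_relations n c1 cm1 \<subseteq> Fr (generators n)"
  using group_relations_Fr[of n] unfolding cherednik_relations_def
  by (auto intro!: Fr_diff Fr_mult Fr_pscale Fr_sum Fr_add)

lemma braided_relations_Fr: "braided_relations n c1 cm1 \<subseteq> Fr (generators n)"
  using group_relations_Fr[of n] unfolding braided_relations_def
  by (auto intro!: Fr_diff Fr_mult Fr_pscale Fr_sum Fr_add)

lemma ideal_genideal_free: "R \<subseteq> Fr S \<Longrightarrow> ideal (genideal (free_algebra S) R) (free_algebra S)"
  by (rule ring.genideal_ideal[OF ring_free])

lemma genideal_free_self: "R \<subseteq> Fr S \<Longrightarrow> R \<subseteq> genideal (free_algebra S) R"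
  by (rule ring.genideal_self[OF ring_free])

lemma genideal_free_least:
  assumes "R \<subseteq> J" "J \<subseteq> Fr S" "0 \<in> J"
    and add: "\<And>p r. p \<in> J \<Longrightarrow> r \<in> J \<Longrightarrow> p + r \<in> J"
    and l: "\<And>a p. a \<in> Fr S \<Longrightarrow> p \<in> J \<Longrightarrow> a * p \<in> J"
    and r: "\<And>a p. a \<in> Fr S \<Longrightarrow> p \<in> J \<Longrightarrow> p * a \<in> J"
  shows "genideal (free_algebra S) R \<subseteq> J"
proof (rule ring.genideal_minimal[OF ring_free _ assms(1)])
  have neg: "- p \<in> J" if "p \<in> J" for p using l[of "- 1" p] that by simp
  show "ideal J (free_algebra S)"
  proof (rule idealI[OF ring_free])
    show "subgroup J (add_monoid (free_algebra S))"
    proof (rule group.subgroupI[OF abelian_group.a_group[OF abelian_group_free]])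
      fix p assume p: "p \<in> J"
      then have "inv\<^bsub>add_monoid (free_algebra S)\<^esub> p = - p"
        using a_inv_free[of p S] assms(2) by (auto simp: a_inv_def)
      then show "inv\<^bsub>add_monoid (free_algebra S)\<^esub> p \<in> J" using neg p by simp
    qed (use assms in auto)
  qed (use l r in auto)
qed

locale cherednik_params =
  fixes n :: nat and c1 cm1 :: complex
begin

abbreviation "F \<equiv> Fr (generators n)"
abbreviation "H \<equiv> cherednik n c1 cm1"
abbreviation "I \<equiv> cherednik_ideal n c1 cm1"
abbreviation "q \<equiv> cherednik_class n c1 cm1"

lemma ideal_I: "ideal I (free_algebra (generators n))"
  unfolding cherednik_ideal_def by (rule ideal_genideal_free[OF cherednik_relations_Fr])

lemma relation_in_I: "r \<in> cherednik_relations n c1 cm1 \<Longrightarrow> r \<in> I"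
  unfolding cherednik_ideal_def using genideal_free_self[OF cherednik_relations_Fr] by blast

lemma q_coset: "q = (\<lambda>p. I +>\<^bsub>free_algebra (generators n)\<^esub> p)"
  by (simp add: fun_eq_iff cherednik_class_def)

sublocale H: presented_algebra "generators n" H q
  unfolding cherednik_def q_coset by (rule ideal_quotient_presented[OF ideal_I])

lemma submodule_I: "submodule I complex_ring (free_algebra (generators n))"
  by (rule ideal_quotient_presented[OF ideal_I])

lemma q_eq_iff: "p \<in> F \<Longrightarrow> r \<in> F \<Longrightarrow> q p = q r \<longleftrightarrow> p - r \<in> I"
  using coset_eq_iff[OF module_free submodule_I, of p r] by (simp add: cherednik_class_def)

lemma I_F: "p \<in> I \<Longrightarrow> p \<in> F"
  using submodule.axioms(1)[OF submodule_I] subgroup.subset by fastforce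

lemma I_0: "0 \<in> I"
  using submodule.axioms(1)[OF submodule_I] subgroup.one_closed by fastforce

lemma I_add: "p \<in> I \<Longrightarrow> r \<in> I \<Longrightarrow> p + r \<in> I"
  using submodule.axioms(1)[OF submodule_I] subgroup.m_closed by fastforce

lemma I_pscale: "p \<in> I \<Longrightarrow> pscale z p \<in> I"
  using submodule.smult_closed[OF submodule_I, of z p] by simp

lemma I_uminus: "p \<in> I \<Longrightarrow> - p \<in> I"
  using I_pscale[of p "- 1"] by (simp add: pscale_minus1)

lemma I_diff: "p \<in> I \<Longrightarrow> r \<in> I \<Longrightarrow> p - r \<in> I"
  using I_add[of p "- r"] I_uminus by simp

lemma I_mult: "a \<in> F \<Longrightarrow> p \<in> I \<Longrightarrow> a * p \<in> I" "a \<in> F \<Longrightarrow> p \<in> I \<Longrightarrow> p * a \<in> I"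
  using ideal.I_l_closed[OF ideal_I] ideal.I_r_closed[OF ideal_I] by auto

lemma I_least:
  assumes "cherednik_relations n c1 cm1 \<subseteq> J" "J \<subseteq> F" "0 \<in> J"
    and "\<And>p r. p \<in> J \<Longrightarrow> r \<in> J \<Longrightarrow> p + r \<in> J"
    and "\<And>a p. a \<in> F \<Longrightarrow> p \<in> J \<Longrightarrow> a * p \<in> J"
    and "\<And>a p. a \<in> F \<Longrightarrow> p \<in> J \<Longrightarrow> p * a \<in> J"
  shows "I \<subseteq> J"
  unfolding cherednik_ideal_def using assms by (rule genideal_free_least)

end


section \<open>The standard module\<close>

locale linear_action =
  fixes sc :: "complex \<Rightarrow> 'v::ab_group_add \<Rightarrow> 'v"
  assumes add_l: "sc (z + w) v = sc z v + sc w v" and add_r: "sc z (u + v) = sc z u + sc z v"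
    and assoc: "sc (z * w) v = sc z (sc w v)" and one: "sc 1 v = v"
begin

definition lin_ext :: "('k \<Rightarrow> 'v) \<Rightarrow> ('k \<Rightarrow>\<^sub>0 complex) \<Rightarrow> 'v" where
  "lin_ext f p = (\<Sum>k\<in>Poly_Mapping.keys p. sc (Poly_Mapping.lookup p k) (f k))"

lemma sc_0: "sc 0 v = 0" "sc z 0 = 0"
  using add_l[of 0 0 v] add_r[of z 0 0] by simp_all

lemma sc_sum: "sc z (sum f B) = (\<Sum>i\<in>B. sc z (f i))"
  by (induction B rule: infinite_finite_induct) (auto simp: sc_0 add_r)

lemma lin_ext_superset:
  assumes "finite B" "Poly_Mapping.keys p \<subseteq> B"
  shows "lin_ext f p = (\<Sum>k\<in>B. sc (Poly_Mapping.lookup p k) (f k))"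
  unfolding lin_ext_def using assms
  by (intro sum.mono_neutral_left) (auto simp: in_keys_iff sc_0)

lemma lin_ext_add: "lin_ext f (p + r) = lin_ext f p + lin_ext f r"
proof -
  let ?B = "Poly_Mapping.keys p \<union> Poly_Mapping.keys r"
  have "Poly_Mapping.keys (p + r) \<subseteq> ?B" by (rule keys_add)
  then show ?thesis
    by (simp add: lin_ext_superset[of ?B] lookup_add add_l sum.distrib)
qed

lemma lin_ext_pscale: "lin_ext f (pscale z p) = sc z (lin_ext f p)"
  using keys_pscale[of z p]
  by (simp add: lin_ext_superset[of "Poly_Mapping.keys p"] assoc sc_sum)

lemma lin_ext_0 [simp]: "lin_ext f 0 = 0"
  by (simp add: lin_ext_def)

lemma lin_ext_diff: "lin_ext f (p - r) = lin_ext f p - lin_ext f r"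
  using lin_ext_add[of f "p - r" r] by simp

lemma lin_ext_single [simp]: "lin_ext f (Poly_Mapping.single k z) = sc z (f k)"
  by (subst lin_ext_superset[of "{k}"]) auto

lemmas lin_ext_simps = lin_ext_add lin_ext_diff lin_ext_pscale

end

interpretation vec: linear_action "pscale :: complex \<Rightarrow> ('k \<Rightarrow>\<^sub>0 complex) \<Rightarrow> _"
  by standard (auto simp: pscale_add pscale_add_left)

interpretation num: linear_action "(*) :: complex \<Rightarrow> _"
  by standard (auto simp: algebra_simps)

lemma free_space_iff: "p \<in> carrier (free_space B) \<longleftrightarrow> Poly_Mapping.keys p \<subseteq> B"
  by (simp add: free_space_def)

lemma free_space_simps [simp]:
  "p \<oplus>\<^bsub>free_space B\<^esub> r = p + r" "\<zero>\<^bsub>free_space B\<^esub> = 0" "z \<odot>\<^bsub>free_space B\<^esub> p = pscale z p"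
  by (simp_all add: free_space_def)

lemma free_space_closed:
  "0 \<in> carrier (free_space B)"
  "p \<in> carrier (free_space B) \<Longrightarrow> r \<in> carrier (free_space B) \<Longrightarrow> p + r \<in> carrier (free_space B)"
  "p \<in> carrier (free_space B) \<Longrightarrow> - p \<in> carrier (free_space B)"
  "p \<in> carrier (free_space B) \<Longrightarrow> r \<in> carrier (free_space B) \<Longrightarrow> p - r \<in> carrier (free_space B)"
  "p \<in> carrier (free_space B) \<Longrightarrow> pscale z p \<in> carrier (free_space B)"
  using keys_add[of p r] keys_add[of p "- r"] keys_pscale[of z p]
  by (auto simp: free_space_iff)

lemma abelian_group_free_space: "abelian_group (free_space B)"
proof (rule abelian_groupI)
  fix x assume "x \<in> carrier (free_space B)"
  then show "\<exists>y\<in>carrier (free_space B). y \<oplus>\<^bsub>free_space B\<^esub> x = \<zero>\<^bsub>free_space B\<^esub>"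
    by (intro bexI[of _ "- x"]) (simp_all add: free_space_closed)
qed (simp_all add: algebra_simps free_space_closed)

lemma module_free_space: "module complex_ring (free_space B)"
  by (rule moduleI)
    (auto intro: abelian_group_free_space cring_complex_ring
      simp: pscale_add pscale_add_left free_space_closed)

lemma a_inv_free_space [simp]:
  assumes "p \<in> carrier (free_space B)" shows "\<ominus>\<^bsub>free_space B\<^esub> p = - p"
proof -
  interpret abelian_group "free_space B" by (rule abelian_group_free_space)
  show ?thesis using assms by (intro minus_equality) (auto simp: free_space_closed)
qed

lemma submodule_free_spaceI:
  assumes "N \<subseteq> carrier (free_space B)" "0 \<in> N"
    and "\<And>p r. p \<in> N \<Longrightarrow> r \<in> N \<Longrightarrow> p + r \<in> N" "\<And>z p. p \<in> N \<Longrightarrow> pscale z p \<in> N"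
  shows "submodule N complex_ring (free_space B)"
proof (rule module.submoduleI[OF module_free_space])
  fix p assume p: "p \<in> N"
  then show "\<ominus>\<^bsub>free_space B\<^esub> p \<in> N"
    using assms(1,4) by (auto simp flip: pscale_minus1)
qed (use assms in auto)

lemma free_space_induct [consumes 1, case_names zero single add]:
  assumes "p \<in> carrier (free_space B)" and "P 0"
    and "\<And>k z. k \<in> B \<Longrightarrow> P (Poly_Mapping.single k z)"
    and "\<And>p r. P p \<Longrightarrow> P r \<Longrightarrow> P (p + r)"
  shows "P p"
proof -
  have "P (sum (\<lambda>k. Poly_Mapping.single k (Poly_Mapping.lookup p k)) C)"
    if "finite C" "C \<subseteq> B" for C
    using that by (induction C rule: finite_induct) (auto simp: assms(2-4))
  from this[of "Poly_Mapping.keys p"] show ?thesis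
    using assms(1) by (simp add: free_space_iff flip: poly_mapping_sum_singles)
qed

locale standard_module = cherednik_params +
  fixes \<tau> :: "complex mat \<Rightarrow> complex"
begin

abbreviation "V \<equiv> symbol_space n c1 cm1"
abbreviation "K \<equiv> tensor_kernel n c1 cm1 \<tau>"
abbreviation "R \<equiv> tensor_relations n c1 cm1 \<tau>"
abbreviation "M \<equiv> M_space n c1 cm1 \<tau>"
abbreviation "\<chi> \<equiv> char_lift \<tau>"

definition \<Psi> :: "generator free \<Rightarrow> symbols set" where
  "\<Psi> p = K +>\<^bsub>V\<^esub> symb (q p) 1"

lemma V_eq: "V = free_space (carrier H \<times> UNIV)"
  by (simp add: symbol_space_def)

lemma symb_V: "a \<in> carrier H \<Longrightarrow> symb a z \<in> carrier V"
  by (simp add: V_eq free_space_iff symb_def)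

lemma q_closed: "p \<in> F \<Longrightarrow> q p \<in> carrier H"
  by (simp add: H.carrier_A)

lemma H_closed:
  assumes "a \<in> carrier H" "b \<in> carrier H"
  shows "a \<oplus>\<^bsub>H\<^esub> b \<in> carrier H" "a \<otimes>\<^bsub>H\<^esub> b \<in> carrier H" "z \<odot>\<^bsub>H\<^esub> a \<in> carrier H"
  using assms by (auto simp: H.carrier_A H.q_add H.q_mult H.q_smult)

lemma H_mult_linear:
  assumes "a \<in> carrier H" "b \<in> carrier H" "c \<in> carrier H"
  shows "a \<otimes>\<^bsub>H\<^esub> (b \<oplus>\<^bsub>H\<^esub> c) = a \<otimes>\<^bsub>H\<^esub> b \<oplus>\<^bsub>H\<^esub> a \<otimes>\<^bsub>H\<^esub> c"
    "a \<otimes>\<^bsub>H\<^esub> (z \<odot>\<^bsub>H\<^esub> b) = z \<odot>\<^bsub>H\<^esub> (a \<otimes>\<^bsub>H\<^esub> b)"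
    "a \<otimes>\<^bsub>H\<^esub> (b \<otimes>\<^bsub>H\<^esub> c) = (a \<otimes>\<^bsub>H\<^esub> b) \<otimes>\<^bsub>H\<^esub> c"
  using assms
  by (auto simp: H.carrier_A H.q_add H.q_mult H.q_smult distrib_left pscale_mult_right mult.assoc)

lemma borel_F: "b \<in> Fr (borel_generators n) \<Longrightarrow> b \<in> F"
  by (rule Fr_mono) (auto simp: borel_generators_def generators_def)

lemma R_V: "R \<subseteq> carrier V"
  unfolding tensor_relations_def Let_def V_eq
  by (auto intro!: free_space_closed symb_V[unfolded V_eq] H_closed q_closed borel_F)

lemma module_V: "module complex_ring V"
  by (simp add: V_eq module_free_space)

lemma submodule_K: "submodule K complex_ring V" and R_K: "R \<subseteq> K"
  unfolding tensor_kernel_def using subspace_generated_submodule[OF module_V R_V] by blast+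

lemma K_least: "submodule N complex_ring V \<Longrightarrow> R \<subseteq> N \<Longrightarrow> K \<subseteq> N"
  unfolding tensor_kernel_def by (rule subspace_generated_minimal)

lemma K_closed:
  "K \<subseteq> carrier V" "0 \<in> K" "p \<in> K \<Longrightarrow> r \<in> K \<Longrightarrow> p + r \<in> K" "p \<in> K \<Longrightarrow> pscale z p \<in> K"
proof -
  note m = module.submoduleE[OF module_V submodule_K]
  show "K \<subseteq> carrier V" by (rule m)
  show "0 \<in> K" using submodule.axioms(1)[OF submodule_K] subgroup.one_closed[of K "add_monoid V"]
    by (simp add: V_eq)
  show "p \<in> K \<Longrightarrow> r \<in> K \<Longrightarrow> p + r \<in> K" using m(5)[of p r] by (simp add: V_eq)
  show "p \<in> K \<Longrightarrow> pscale z p \<in> K" using m(4)[of z p] by (simp add: V_eq)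
qed

lemma K_diff: "p \<in> K \<Longrightarrow> r \<in> K \<Longrightarrow> p - r \<in> K"
  using K_closed(3)[of p "pscale (- 1) r"] K_closed(4)[of r "- 1"] by (simp add: pscale_minus1)

lemma coset_eqI:
  assumes "v \<in> carrier V" "w \<in> carrier V" "v - w \<in> K"
  shows "K +>\<^bsub>V\<^esub> v = K +>\<^bsub>V\<^esub> w"
  using coset_eq_iff[OF module_V submodule_K, of v w] assms
  by (simp add: V_eq a_minus_def)

lemma R_memberI:
  "a \<in> carrier H \<Longrightarrow> b \<in> carrier H \<Longrightarrow> symb (a \<oplus>\<^bsub>H\<^esub> b) z - symb a z - symb b z \<in> R"
  "a \<in> carrier H \<Longrightarrow> symb a (z + w) - symb a z - symb a w \<in> R"
  "a \<in> carrier H \<Longrightarrow> symb (u \<odot>\<^bsub>H\<^esub> a) z - pscale u (symb a z) \<in> R"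
  "a \<in> carrier H \<Longrightarrow> symb a (u * z) - pscale u (symb a z) \<in> R"
  "a \<in> carrier H \<Longrightarrow> c \<in> Fr (borel_generators n) \<Longrightarrow>
     symb (a \<otimes>\<^bsub>H\<^esub> q c) z - symb a (\<chi> c * z) \<in> R"
  unfolding tensor_relations_def Let_def by blast+

lemma R_cases [consumes 1]:
  assumes "r \<in> R"
    and "\<And>a b z. a \<in> carrier H \<Longrightarrow> b \<in> carrier H \<Longrightarrow> P (symb (a \<oplus>\<^bsub>H\<^esub> b) z - symb a z - symb b z)"
    and "\<And>a z w. a \<in> carrier H \<Longrightarrow> P (symb a (z + w) - symb a z - symb a w)"
    and "\<And>a u z. a \<in> carrier H \<Longrightarrow> P (symb (u \<odot>\<^bsub>H\<^esub> a) z - pscale u (symb a z))"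
    and "\<And>a u z. a \<in> carrier H \<Longrightarrow> P (symb a (u * z) - pscale u (symb a z))"
    and "\<And>a b z. a \<in> carrier H \<Longrightarrow> b \<in> Fr (borel_generators n) \<Longrightarrow>
       P (symb (a \<otimes>\<^bsub>H\<^esub> q b) z - symb a (\<chi> b * z))"
  shows "P r"
  using assms unfolding tensor_relations_def Let_def by blast

definition left_mult :: "generator free set \<Rightarrow> symbols \<Rightarrow> symbols" where
  "left_mult a = vec.lin_ext (\<lambda>(b, z). symb (a \<otimes>\<^bsub>H\<^esub> b) z)"

lemma left_mult_symb [simp]: "left_mult a (symb b z) = symb (a \<otimes>\<^bsub>H\<^esub> b) z"
  by (simp add: left_mult_def symb_def)

lemma left_mult_linear:
  "left_mult a (v + w) = left_mult a v + left_mult a w"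
  "left_mult a (v - w) = left_mult a v - left_mult a w"
  "left_mult a (pscale z v) = pscale z (left_mult a v)"
  "left_mult a 0 = 0"
  by (simp_all add: left_mult_def vec.lin_ext_simps)

lemma left_mult_V:
  assumes a: "a \<in> carrier H" and v: "v \<in> carrier V"
  shows "left_mult a v \<in> carrier V"
  using v unfolding V_eq
proof (induction v rule: free_space_induct)
  case (single k z)
  then show ?case
    using symb_V[OF H_closed(2)[OF a, of "fst k"], of "snd k"]
    by (auto simp: left_mult_def V_eq simp del: pscale_single intro!: free_space_closed)
qed (auto simp: left_mult_def vec.lin_ext_simps free_space_closed)

text \<open>
  Left multiplication maps each defining relation of the tensor product to a relation of the same
  kind, so the action descends to the standard module.
\<close>

lemma left_mult_K:
  assumes a: "a \<in> carrier H" and v: "v \<in> K"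
  shows "left_mult a v \<in> K"
proof -
  let ?N = "{v \<in> carrier V. left_mult a v \<in> K}"
  have "submodule ?N complex_ring V"
    unfolding V_eq
    by (rule submodule_free_spaceI)
      (auto simp: free_space_closed left_mult_linear K_closed)
  moreover have "r \<in> ?N" if r: "r \<in> R" for r
  proof -
    have "left_mult a r \<in> R"
      using r
      by (cases rule: R_cases)
        (auto simp: left_mult_linear H_mult_linear a q_closed borel_F H_closed R_memberI)
    then show ?thesis using r R_V R_K by auto
  qed
  ultimately have "K \<subseteq> ?N" by (intro K_least) auto
  then show ?thesis using v by auto
qed

lemma M_act_coset:
  assumes "a \<in> carrier H" "v \<in> carrier V"
  shows "M_act n c1 cm1 \<tau> a (K +>\<^bsub>V\<^esub> v) = K +>\<^bsub>V\<^esub> left_mult a v"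
proof -
  have "(\<lambda>p. \<Sum>(b, z) \<in> Poly_Mapping.keys p.
        pscale (Poly_Mapping.lookup p (b, z)) (symb (a \<otimes>\<^bsub>H\<^esub> b) z)) = left_mult a"
    by (auto simp: fun_eq_iff left_mult_def vec.lin_ext_def intro!: sum.cong)
  then show ?thesis
    unfolding M_act_def using assms
    by (simp only:) (rule quot_map_coset[OF module_V submodule_K],
        auto simp: left_mult_V left_mult_K, simp add: V_eq left_mult_def vec.lin_ext_add)
qed

text \<open>
  The scalar in \<open>a \<otimes> z\<close> can be moved to the left, and then symbols add in their left entry.
\<close>

lemma symbols_reduce:
  assumes "v \<in> carrier V"
  shows "\<exists>p\<in>F. v - symb (q p) 1 \<in> K"
  using assms unfolding V_eq
proof (induction v rule: free_space_induct)
  case zero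
  have "symb (0 \<odot>\<^bsub>H\<^esub> q 0) 1 - pscale 0 (symb (q 0) 1) \<in> K"
    using R_memberI(3)[OF q_closed[of 0], of 0 1] R_K by auto
  then have "0 - symb (q 0) 1 \<in> K"
    using K_diff[OF K_closed(2)] by (simp add: H.q_smult)
  then show ?case by (intro bexI[of _ 0]) auto
next
  case (single k z)
  then obtain p w where k: "k = (q p, w)" and p: "p \<in> F" by (auto simp: H.carrier_A)
  have a: "symb (q p) (w * 1) - pscale w (symb (q p) 1) \<in> K"
    using R_memberI(4)[OF q_closed[OF p], of w 1] R_K by auto
  have b: "symb ((z * w) \<odot>\<^bsub>H\<^esub> q p) 1 - pscale (z * w) (symb (q p) 1) \<in> K"
    using R_memberI(3)[OF q_closed[OF p]] R_K by auto
  have "Poly_Mapping.single k z - symb (q (pscale (z * w) p)) 1 \<in> K"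
    using K_diff[OF K_closed(4)[OF a, of z] b] p
    by (simp add: H.q_smult pscale_diff k symb_def)
  then show ?case using p by (intro bexI[of _ "pscale (z * w) p"]) auto
next
  case (add v w)
  then obtain p r where pr: "p \<in> F" "v - symb (q p) 1 \<in> K" "r \<in> F" "w - symb (q r) 1 \<in> K" by auto
  have "symb (q p \<oplus>\<^bsub>H\<^esub> q r) 1 - symb (q p) 1 - symb (q r) 1 \<in> K"
    using R_memberI(1) R_K pr q_closed by auto
  from K_diff[OF K_closed(3)[OF pr(2,4)] this]
  have "v + w - symb (q (p + r)) 1 \<in> K"
    using pr by (simp add: H.q_add algebra_simps)
  then show ?case using pr by (intro bexI[of _ "p + r"]) auto
qed

text \<open>
  Since \<open>\<tau>\<close> is a line, the standard module is spanned by the symbols \<open>a \<otimes> 1\<close>: it is cyclic, and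
  everything about it can be computed in the free algebra.
\<close>

sublocale M: cyclic_rep "generators n" H q M "M_act n c1 cm1 \<tau>" \<Psi>
proof (intro cyclic_rep.intro cyclic_rep_axioms.intro H.presented_algebra_axioms)
  show "module complex_ring M"
    unfolding M_space_def by (rule module_quot[OF module_V submodule_K])
  have "K +>\<^bsub>V\<^esub> v \<in> \<Psi> ` F" if v: "v \<in> carrier V" for v
  proof -
    obtain p where "p \<in> F" "v - symb (q p) 1 \<in> K" using symbols_reduce[OF v] by auto
    then have "K +>\<^bsub>V\<^esub> v = \<Psi> p"
      unfolding \<Psi>_def using v by (intro coset_eqI) (auto intro!: symb_V q_closed)
    then show ?thesis using \<open>p \<in> F\<close> by auto
  qed
  then show "carrier M = \<Psi> ` F"
    unfolding M_space_def quot_carrier[OF module_V submodule_K]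
    by (auto simp: \<Psi>_def intro!: symb_V q_closed)
  fix p r z assume p: "p \<in> F"
  have "symb (z \<odot>\<^bsub>H\<^esub> q p) 1 - pscale z (symb (q p) 1) \<in> K"
    using R_memberI(3)[OF q_closed[OF p]] R_K by auto
  then have "\<Psi> (pscale z p) = K +>\<^bsub>V\<^esub> pscale z (symb (q p) 1)"
    unfolding \<Psi>_def using p
    by (intro coset_eqI) (auto simp: H.q_smult V_eq intro!: free_space_closed symb_V[unfolded V_eq] q_closed)
  then show "\<Psi> (pscale z p) = z \<odot>\<^bsub>M\<^esub> \<Psi> p"
    unfolding \<Psi>_def M_space_def using quot_smult[OF module_V submodule_K, of "symb (q p) 1" z] p
    by (simp add: V_eq symb_V[unfolded V_eq] q_closed)
  assume r: "r \<in> F"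
  have "symb (q p \<oplus>\<^bsub>H\<^esub> q r) 1 - symb (q p) 1 - symb (q r) 1 \<in> K"
    using R_memberI(1) R_K p r q_closed by auto
  then have "\<Psi> (p + r) = K +>\<^bsub>V\<^esub> (symb (q p) 1 + symb (q r) 1)"
    unfolding \<Psi>_def using p r
    by (intro coset_eqI)
      (auto simp: H.q_add V_eq algebra_simps intro!: free_space_closed symb_V[unfolded V_eq] q_closed)
  then show "\<Psi> (p + r) = \<Psi> p \<oplus>\<^bsub>M\<^esub> \<Psi> r"
    unfolding \<Psi>_def M_space_def
    using quot_add[OF module_V submodule_K, of "symb (q p) 1" "symb (q r) 1"] p r
    by (simp add: V_eq symb_V[unfolded V_eq] q_closed)
  show "M_act n c1 cm1 \<tau> (q p) (\<Psi> r) = \<Psi> (p * r)"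
    unfolding \<Psi>_def using p r by (simp add: M_act_coset q_closed symb_V H.q_mult)
qed

lemma \<Psi>_borel:
  assumes "p \<in> F" "b \<in> Fr (borel_generators n)"
  shows "\<Psi> (p * b) = \<Psi> (pscale (\<chi> b) p)"
proof -
  have a: "symb (q p \<otimes>\<^bsub>H\<^esub> q b) 1 - symb (q p) (\<chi> b * 1) \<in> K"
    and b: "symb (q p) (\<chi> b * 1) - pscale (\<chi> b) (symb (q p) 1) \<in> K"
    and c: "symb (\<chi> b \<odot>\<^bsub>H\<^esub> q p) 1 - pscale (\<chi> b) (symb (q p) 1) \<in> K"
    using R_memberI(5)[OF q_closed[OF assms(1)] assms(2), of 1] R_memberI(3,4)[OF q_closed[OF assms(1)]]
      R_K by blast+
  have "symb (q (p * b)) 1 - symb (q (pscale (\<chi> b) p)) 1 \<in> K"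
    using K_diff[OF K_closed(3)[OF a b] c] assms borel_F by (simp add: H.q_mult H.q_smult)
  then show ?thesis
    unfolding \<Psi>_def using assms borel_F by (intro coset_eqI) (auto intro!: symb_V q_closed)
qed

text \<open>\<open>a \<otimes> z \<mapsto> \<chi>(a) z\<close> is a linear functional on the standard module as soon as \<open>\<chi>\<close> is a
  character of the algebra; it detects that the generating vector is nonzero.\<close>

lemma \<Psi>_zero_imp:
  assumes \<chi>I: "\<And>p. p \<in> I \<Longrightarrow> \<chi> p = 0" and p: "p \<in> F" "\<Psi> p = \<zero>\<^bsub>M\<^esub>"
  shows "\<chi> p = 0"
proof -
  define X where "X U = \<chi> (SOME p. p \<in> F \<and> q p = U)" for U
  have X: "X (q p) = \<chi> p" if "p \<in> F" for p
  proof -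
    define p' where "p' = (SOME p'. p' \<in> F \<and> q p' = q p)"
    have "p' \<in> F \<and> q p' = q p"
      unfolding p'_def using that someI[of "\<lambda>p'. p' \<in> F \<and> q p' = q p" p] by simp
    then have "\<chi> (p' - p) = 0" using q_eq_iff[of p' p] that \<chi>I[of "p' - p"] by simp
    then show ?thesis by (simp add: X_def p'_def char_lift_def char.lift_simps)
  qed
  have X_hom: "a \<in> carrier H \<Longrightarrow> b \<in> carrier H \<Longrightarrow> X (a \<oplus>\<^bsub>H\<^esub> b) = X a + X b"
    "a \<in> carrier H \<Longrightarrow> X (z \<odot>\<^bsub>H\<^esub> a) = z * X a"
    "a \<in> carrier H \<Longrightarrow> c \<in> Fr (borel_generators n) \<Longrightarrow> X (a \<otimes>\<^bsub>H\<^esub> q c) = X a * \<chi> c"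
    for a b c z
    using borel_F
    by (auto simp: H.carrier_A H.q_add H.q_smult H.q_mult X char_lift_def char.lift_simps)
  define \<pi> where "\<pi> = num.lin_ext (\<lambda>(U, z). X U * z)"
  \<comment> \<open>the functional on symbols; it vanishes on every relation of the tensor product\<close>
  have \<pi>_symb: "\<pi> (symb a z) = X a * z" for a z by (simp add: \<pi>_def symb_def)
  have \<pi>_lin: "\<pi> (v - w) = \<pi> v - \<pi> w" "\<pi> (v + w) = \<pi> v + \<pi> w" "\<pi> (pscale z v) = z * \<pi> v" "\<pi> 0 = 0" for v w z
    by (simp_all add: \<pi>_def num.lin_ext_simps)
  have "submodule {v \<in> carrier V. \<pi> v = 0} complex_ring V"
    unfolding V_eq by (rule submodule_free_spaceI) (auto simp: free_space_closed \<pi>_lin)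
  moreover have "\<pi> r = 0" if "r \<in> R" for r
    using that
    by (cases rule: R_cases)
      (simp_all only: \<pi>_lin \<pi>_symb X_hom, simp_all add: algebra_simps)
  ultimately have "K \<subseteq> {v \<in> carrier V. \<pi> v = 0}"
    using R_V by (intro K_least) auto
  moreover have "symb (q p) 1 \<in> K"
    using p coset_eq_zero_iff[OF module_V submodule_K, of "symb (q p) 1"]
    by (simp add: \<Psi>_def M_space_def quot_zero[OF module_V submodule_K] symb_V q_closed)
  ultimately have "\<pi> (symb (q p) 1) = 0" by auto
  then show ?thesis using p by (simp add: \<pi>_symb X)
qed

end


section \<open>The Euler element\<close>

context cherednik_params
begin

definition cong_I :: "generator free \<Rightarrow> generator free \<Rightarrow> bool" (infix \<open>\<approx>\<close> 50) where
  "p \<approx> r \<longleftrightarrow> p - r \<in> I"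

lemma cong_refl [simp, intro]: "p \<approx> p"
  by (simp add: cong_I_def I_0)

lemma cong_trans [trans]: "p \<approx> r \<Longrightarrow> r \<approx> s \<Longrightarrow> p \<approx> s"
  using I_add[of "p - r" "r - s"] by (simp add: cong_I_def)

lemma cong_add: "p \<approx> r \<Longrightarrow> p' \<approx> r' \<Longrightarrow> p + p' \<approx> r + r'"
  using I_add[of "p - r" "p' - r'"] by (simp add: cong_I_def algebra_simps)

lemma cong_diff: "p \<approx> r \<Longrightarrow> p' \<approx> r' \<Longrightarrow> p - p' \<approx> r - r'"
  using I_diff[of "p - r" "p' - r'"] by (simp add: cong_I_def algebra_simps)

lemma cong_pscale: "p \<approx> r \<Longrightarrow> pscale z p \<approx> pscale z r"
  using I_pscale[of "p - r"] by (simp add: cong_I_def pscale_diff)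

lemma cong_sum: "(\<And>i. i \<in> B \<Longrightarrow> f i \<approx> g i) \<Longrightarrow> sum f B \<approx> sum g B"
  by (induction B rule: infinite_finite_induct) (auto simp: cong_add)

lemma cong_mult_left: "a \<in> F \<Longrightarrow> p \<approx> r \<Longrightarrow> a * p \<approx> a * r"
  using I_mult(1)[of a "p - r"] by (simp add: cong_I_def algebra_simps)

lemma cong_mult_right: "a \<in> F \<Longrightarrow> p \<approx> r \<Longrightarrow> p * a \<approx> r * a"
  using I_mult(2)[of a "p - r"] by (simp add: cong_I_def algebra_simps)

text \<open>
  The right hand side of the relation for \<open>y\<^sub>i x\<^sub>j - x\<^sub>j y\<^sub>i\<close>, with the two cases joined.
\<close>

definition bracket :: "nat \<Rightarrow> nat \<Rightarrow> generator free" where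
  "bracket i j = (if i = j
     then 1 - pscale c1 (\<Sum>k\<in>{..<n} - {i}. \<Sum>\<epsilon>\<in>{1, - 1}. gen_g (s_mat n i k \<epsilon>)) - pscale cm1 (gen_g (t_mat n i))
     else pscale c1 (\<Sum>\<epsilon>\<in>{1, - 1}. pscale \<epsilon> (gen_g (s_mat n i j \<epsilon>))))"

lemma y_x_relation:
  assumes "i < n" "j < n"
  shows "gen_y i * gen_x j - gen_x j * gen_y i - bracket i j \<in> I"
proof (cases "i = j")
  case True
  have "gen_y i * gen_x i - gen_x i * gen_y i -
        (1 - pscale c1 (\<Sum>k\<in>{..<n} - {i}. \<Sum>\<epsilon>\<in>{1, - 1}. gen_g (s_mat n i k \<epsilon>))
           - pscale cm1 (gen_g (t_mat n i))) \<in> cherednik_relations n c1 cm1"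
    using assms unfolding cherednik_relations_def by blast
  then show ?thesis
    using True relation_in_I unfolding bracket_def by simp
next
  case False
  then have "gen_y i * gen_x j - gen_x j * gen_y i -
        pscale c1 (\<Sum>\<epsilon>\<in>{1, - 1}. pscale \<epsilon> (gen_g (s_mat n i j \<epsilon>))) \<in> cherednik_relations n c1 cm1"
    using assms unfolding cherednik_relations_def by blast
  then show ?thesis
    using False relation_in_I unfolding bracket_def by simp
qed

lemma y_commute: "i < n \<Longrightarrow> j < n \<Longrightarrow> gen_y i * gen_y j \<approx> gen_y j * gen_y i"
  unfolding cong_I_def cherednik_relations_def
  by (rule relation_in_I[unfolded cherednik_relations_def]) blast

lemma g_y:
  assumes "\<pi> permutes {..<n}" "\<And>k. \<epsilon> k \<in> {1, - 1}" "j < n"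
  shows "gen_g (signed_mat n \<pi> \<epsilon>) * gen_y j
    \<approx> pscale (\<epsilon> j) (gen_y (\<pi> j) * gen_g (signed_mat n \<pi> \<epsilon>))"
proof -
  have "signed_mat n \<pi> \<epsilon> \<in> signed_perms n" using assms by (intro signed_mat_in) auto
  then have "gen_g (signed_mat n \<pi> \<epsilon>) * gen_y j - on_y n (signed_mat n \<pi> \<epsilon>) j * gen_g (signed_mat n \<pi> \<epsilon>) \<in> I"
    using assms(3)
    by (intro relation_in_I, unfold cherednik_relations_def group_relations_def) blast
  then show ?thesis
    using on_y_signed[OF assms] by (simp add: cong_I_def pscale_mult_left)
qed

text \<open>The reflections act on \<open>y\<^sub>j\<close> by signed transpositions of the indices.\<close>

lemma s_y:
  assumes "k < n" "l < n" "k \<noteq> l" "\<epsilon> \<in> {1, - 1}" "j < n"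
  shows "gen_g (s_mat n k l \<epsilon>) * gen_y j \<approx>
    (if j = k then pscale \<epsilon> (gen_y l * gen_g (s_mat n k l \<epsilon>))
     else if j = l then pscale \<epsilon> (gen_y k * gen_g (s_mat n k l \<epsilon>))
     else gen_y j * gen_g (s_mat n k l \<epsilon>))"
  using g_y[of "transpose k l" "\<lambda>i. if i = k \<or> i = l then \<epsilon> else 1" j] assms
  by (auto simp: s_mat_signed permutes_transpose transpose_def split: if_splits)

lemma t_y:
  assumes "j < n"
  shows "gen_g (t_mat n k) * gen_y j \<approx> pscale (if j = k then - 1 else 1) (gen_y j * gen_g (t_mat n k))"
  using g_y[of id "\<lambda>i. if i = k then - 1 else 1" j] assms
  by (auto simp: t_mat_signed permutes_id split: if_splits)

definition S_pair :: "nat \<Rightarrow> nat \<Rightarrow> generator free" where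
  "S_pair k l = (\<Sum>\<epsilon>\<in>{1, - 1}. gen_g (s_mat n k l \<epsilon>))"

definition D_pair :: "nat \<Rightarrow> nat \<Rightarrow> generator free" where
  "D_pair k l = (\<Sum>\<epsilon>\<in>{1, - 1}. pscale \<epsilon> (gen_g (s_mat n k l \<epsilon>)))"

definition central_part :: "generator free" where
  "central_part = pscale (c1 / 2) (\<Sum>k<n. \<Sum>l\<in>{..<n} - {k}. S_pair k l)
     + pscale (cm1 / 2) (\<Sum>k<n. gen_g (t_mat n k))"

text \<open>
  The sum of \<open>y\<^sub>i x\<^sub>i\<close> is corrected by a central element of the group algebra so that the
  commutator with \<open>y\<^sub>j\<close> becomes \<open>y\<^sub>j\<close> itself.
\<close>

definition euler :: "generator free" where
  "euler = - (\<Sum>i<n. gen_y i * gen_x i) - central_part"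

lemma S_pair_commute:
  assumes "k < n" "l < n" "k \<noteq> l" shows "S_pair k l = S_pair l k"
proof -
  have "s_mat n k l \<epsilon> = s_mat n l k \<epsilon>" if "\<epsilon> \<in> {1, - 1}" for \<epsilon>
    using assms that by (simp add: s_mat_signed transpose_commute disj_commute)
  then show ?thesis by (simp add: S_pair_def)
qed

lemma central_part_borel: "central_part \<in> Fr (borel_generators n)"
  unfolding central_part_def S_pair_def by (auto intro!: Fr_add Fr_pscale Fr_sum)

lemma central_part_F: "central_part \<in> F"
  by (rule Fr_mono[OF central_part_borel]) (auto simp: borel_generators_def generators_def)

lemma euler_F: "euler \<in> F"
  unfolding euler_def using central_part_F by (auto intro!: Fr_diff Fr_uminus Fr_sum)

text \<open>
  Moving \<open>y\<^sub>j\<close> to the left through \<open>s\<^sub>j\<^sub>l\<close> with sign \<open>\<epsilon>\<close> turns it into \<open>\<epsilon> y\<^sub>l\<close>, which converts the plain sum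
  \<open>S_pair\<close> into the alternating sum \<open>D_pair\<close> of the bracket of \<open>y\<^sub>j\<close> with \<open>x\<^sub>l\<close>.
\<close>

lemma S_pair_y:
  assumes "k < n" "l < n" "k \<noteq> l" "j < n"
  shows "S_pair k l * gen_y j - gen_y j * S_pair k l \<approx>
    (if j = k then gen_y l * D_pair j l - gen_y j * S_pair j l
     else if j = l then gen_y k * D_pair j k - gen_y j * S_pair j k else 0)"
proof -
  have *: "S_pair k' l' * gen_y j \<approx>
      (if j = k' then gen_y l' * D_pair k' l' else gen_y j * S_pair k' l')"
    if "k' < n" "l' < n" "k' \<noteq> l'" "j \<noteq> l'" for k' l'
  proof -
    have "(\<Sum>\<epsilon>\<in>{1, - 1}. gen_g (s_mat n k' l' \<epsilon>) * gen_y j) \<approx>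
      (\<Sum>\<epsilon>\<in>{1, - 1}. if j = k' then pscale \<epsilon> (gen_y l' * gen_g (s_mat n k' l' \<epsilon>))
        else gen_y j * gen_g (s_mat n k' l' \<epsilon>))"
    proof (rule cong_sum)
      fix \<epsilon> :: complex assume e: "\<epsilon> \<in> {1, - 1}"
      show "gen_g (s_mat n k' l' \<epsilon>) * gen_y j \<approx>
          (if j = k' then pscale \<epsilon> (gen_y l' * gen_g (s_mat n k' l' \<epsilon>))
           else gen_y j * gen_g (s_mat n k' l' \<epsilon>))"
        using s_y[OF that(1-3) e assms(4)] that(4) by (simp split: if_splits)
    qed
    then show ?thesis
      by (simp add: S_pair_def D_pair_def algebra_simps pscale_simps split: if_splits)
  qed
  show ?thesis
  proof (cases "j = l")
    case True
    then have "S_pair l k * gen_y j - gen_y j * S_pair l k \<approx> gen_y k * D_pair j k - gen_y j * S_pair j k"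
      using *[of l k] assms by (auto intro!: cong_diff)
    then show ?thesis
      using True assms S_pair_commute[of k l] by simp
  next
    case False
    then have "S_pair k l * gen_y j - gen_y j * S_pair k l \<approx>
       (if j = k then gen_y l * D_pair k l else gen_y j * S_pair k l) - gen_y j * S_pair k l"
      using *[of k l] assms by (intro cong_diff) auto
    then show ?thesis using False by (auto split: if_splits)
  qed
qed

text \<open>
  In the double sum only the pairs containing \<open>j\<close> contribute, and each of them occurs in both orders;
  \<open>t\<^sub>j\<close> anticommutes with \<open>y\<^sub>j\<close>.  These two doublings explain the factors one half in \<open>central_part\<close>.
\<close>

lemma central_part_y:
  assumes j: "j < n"
  shows "central_part * gen_y j - gen_y j * central_part \<approx>
    pscale c1 (\<Sum>l\<in>{..<n} - {j}. gen_y l * D_pair j l - gen_y j * S_pair j l)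
      - pscale cm1 (gen_y j * gen_g (t_mat n j))"
proof -
  define g where "g l = gen_y l * D_pair j l - gen_y j * S_pair j l" for l
  define f where "f k l = S_pair k l * gen_y j - gen_y j * S_pair k l" for k l
  have f: "f k l \<approx> (if j = k then g l else if j = l then g k else 0)"
    if "k < n" "l < n" "k \<noteq> l" for k l
    using S_pair_y[OF that j] unfolding f_def g_def by simp
  have inner: "(\<Sum>l\<in>{..<n} - {k}. f k l) \<approx> (if k = j then \<Sum>l\<in>{..<n} - {j}. g l else g k)"
    if "k < n" for k
  proof (cases "k = j")
    case True
    then show ?thesis using f[of j] j by (auto intro!: cong_sum)
  next
    case False
    have "(\<Sum>l\<in>{..<n} - {k}. f k l) \<approx> (\<Sum>l\<in>{..<n} - {k}. if j = l then g k else 0)"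
      by (rule cong_sum) (use f[of k] that False in auto)
    also have "(\<Sum>l\<in>{..<n} - {k}. if j = l then g k else 0) = g k"
      using j False by simp
    finally show ?thesis using False by simp
  qed
  have "(\<Sum>k<n. \<Sum>l\<in>{..<n} - {k}. f k l)
      \<approx> (\<Sum>k<n. if k = j then \<Sum>l\<in>{..<n} - {j}. g l else g k)"
    by (rule cong_sum) (use inner in auto)
  also have "\<dots> = (\<Sum>l\<in>{..<n} - {j}. g l) + (\<Sum>k\<in>{..<n} - {j}. g k)"
    using j by (subst sum.remove[of _ j]) auto
  finally have s: "pscale (c1 / 2) (\<Sum>k<n. \<Sum>l\<in>{..<n} - {k}. f k l)
      \<approx> pscale c1 (\<Sum>l\<in>{..<n} - {j}. g l)"
    using cong_pscale[of _ _ "c1 / 2"] by (fastforce simp: pscale_add simp flip: pscale_add_left)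
  have "(\<Sum>k<n. gen_g (t_mat n k) * gen_y j - gen_y j * gen_g (t_mat n k))
      \<approx> (\<Sum>k<n. pscale (if j = k then - 1 else 1) (gen_y j * gen_g (t_mat n k)) - gen_y j * gen_g (t_mat n k))"
    by (intro cong_sum cong_diff cong_refl t_y j)
  also have "\<dots> = (\<Sum>k<n. if j = k then pscale (- 2) (gen_y j * gen_g (t_mat n j)) else 0)"
    by (rule sum.cong) (auto simp flip: pscale_minus1 pscale_add_left diff_conv_add_uminus
      intro!: poly_mapping_eqI simp: lookup_minus)
  also have "\<dots> = pscale (- 2) (gen_y j * gen_g (t_mat n j))"
    using j by simp
  finally have t: "pscale (cm1 / 2) (\<Sum>k<n. gen_g (t_mat n k) * gen_y j - gen_y j * gen_g (t_mat n k))
      \<approx> pscale (- cm1) (gen_y j * gen_g (t_mat n j))"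
    using cong_pscale[of _ _ "cm1 / 2"] by fastforce
  have "central_part * gen_y j - gen_y j * central_part =
      pscale (c1 / 2) (\<Sum>k<n. \<Sum>l\<in>{..<n} - {k}. f k l) +
      pscale (cm1 / 2) (\<Sum>k<n. gen_g (t_mat n k) * gen_y j - gen_y j * gen_g (t_mat n k))"
    unfolding central_part_def f_def
    by (simp add: algebra_simps pscale_mult_left pscale_mult_right pscale_diff pscale_add
        sum_distrib_left sum_distrib_right sum_subtractf)
  also have "\<dots> \<approx> pscale c1 (\<Sum>l\<in>{..<n} - {j}. g l) + pscale (- cm1) (gen_y j * gen_g (t_mat n j))"
    by (intro cong_add s t)
  also have "pscale (- cm1) (gen_y j * gen_g (t_mat n j)) = - pscale cm1 (gen_y j * gen_g (t_mat n j))"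
    by (rule poly_mapping_eqI) simp
  finally show ?thesis by (simp add: g_def)
qed

text \<open>
  Moving \<open>y\<^sub>j\<close> through the sum of \<open>y\<^sub>i x\<^sub>i\<close> produces the sum of \<open>y\<^sub>i\<close> times the bracket of \<open>y\<^sub>j\<close> with \<open>x\<^sub>i\<close>.  This
  is \<open>y\<^sub>j\<close> plus group terms, and the group terms are exactly the commutator with \<open>central_part\<close>.
\<close>

theorem euler_y:
  assumes j: "j < n"
  shows "euler * gen_y j - gen_y j * euler \<approx> gen_y j"
proof -
  have term1: "gen_y i * gen_x i * gen_y j - gen_y j * (gen_y i * gen_x i) \<approx> - (gen_y i * bracket j i)"
    if i: "i < n" for i
  proof -
    have "(gen_y i * gen_y j - gen_y j * gen_y i) * gen_x i
        - gen_y i * (gen_y j * gen_x i - gen_x i * gen_y j - bracket j i) \<in> I"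
      by (rule I_diff[OF I_mult(2) I_mult(1)])
        (use i j y_commute[OF i j] y_x_relation[OF j i] in \<open>auto simp: cong_I_def\<close>)
    then show ?thesis
      by (simp add: cong_I_def algebra_simps)
  qed
  have "euler * gen_y j - gen_y j * euler =
      - (\<Sum>i<n. gen_y i * gen_x i * gen_y j - gen_y j * (gen_y i * gen_x i))
      - (central_part * gen_y j - gen_y j * central_part)"
    by (simp add: euler_def algebra_simps sum_distrib_left sum_distrib_right sum_subtractf)
  also have "\<dots> \<approx> - (\<Sum>i<n. - (gen_y i * bracket j i))
     - (pscale c1 (\<Sum>l\<in>{..<n} - {j}. gen_y l * D_pair j l - gen_y j * S_pair j l)
      - pscale cm1 (gen_y j * gen_g (t_mat n j)))"
  proof (rule cong_diff[OF _ central_part_y[OF j]])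
    have "(\<Sum>i<n. gen_y i * gen_x i * gen_y j - gen_y j * (gen_y i * gen_x i))
      \<approx> (\<Sum>i<n. - (gen_y i * bracket j i))"
      by (rule cong_sum) (use term1 in auto)
    from cong_pscale[OF this, of "- 1"]
    show "- (\<Sum>i<n. gen_y i * gen_x i * gen_y j - gen_y j * (gen_y i * gen_x i))
      \<approx> - (\<Sum>i<n. - (gen_y i * bracket j i))"
      by (simp add: pscale_minus1)
  qed
  also have "- (\<Sum>i<n. - (gen_y i * bracket j i)) =
      gen_y j * bracket j j + (\<Sum>i\<in>{..<n} - {j}. gen_y i * bracket j i)"
    using j by (simp add: sum_negf sum.remove[of _ j])
  also have "(\<Sum>i\<in>{..<n} - {j}. gen_y i * bracket j i)
      = pscale c1 (\<Sum>i\<in>{..<n} - {j}. gen_y i * D_pair j i)"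
  proof -
    have "bracket j i = pscale c1 (D_pair j i)" if "i \<noteq> j" for i
      using that by (simp add: bracket_def D_pair_def)
    then show ?thesis
      unfolding pscale_sum by (intro sum.cong) (auto simp: pscale_mult_right)
  qed
  also have "gen_y j * bracket j j = gen_y j - pscale c1 (\<Sum>k\<in>{..<n} - {j}. gen_y j * S_pair j k)
      - pscale cm1 (gen_y j * gen_g (t_mat n j))"
    by (simp add: bracket_def S_pair_def[symmetric] right_diff_distrib pscale_mult_right sum_distrib_left)
  finally show ?thesis
    by (simp add: sum_subtractf pscale_diff)
qed

end


section \<open>The unique maximal submodule of a standard module\<close>

locale character_module = standard_module +
  fixes a b :: complex
  assumes linear_character: "linear_character n \<tau> a b"
begin

lemma \<Psi>_I: "p \<in> I \<Longrightarrow> \<Psi> p = \<zero>\<^bsub>M\<^esub>"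
  using M.act_q[of p 1] M.act_q[of 0 1] q_eq_iff[of p 0] I_F[of p] by simp

lemma \<Psi>_cong: "p \<in> F \<Longrightarrow> r \<in> F \<Longrightarrow> p \<approx> r \<Longrightarrow> \<Psi> p = \<Psi> r"
  using \<Psi>_I[of "p - r"] M.\<Psi>_eq_iff by (simp add: cong_I_def)

text \<open>
  Elements of \<open>S(V) # \<complex>G\<close> on the right can be moved across the tensor sign.
\<close>

lemma \<Psi>_vacuum:
  "i < n \<Longrightarrow> p \<in> F \<Longrightarrow> \<Psi> (p * gen_x i) = \<zero>\<^bsub>M\<^esub>"
  "g \<in> signed_perms n \<Longrightarrow> p \<in> F \<Longrightarrow> \<Psi> (p * gen_g g) = \<Psi> (pscale (\<tau> g) p)"
  using \<Psi>_borel[of p "gen_x i"] \<Psi>_borel[of p "gen_g g"]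
  by (simp_all add: char_lift_def)

definition weight :: complex where
  "weight = - \<chi> central_part"

lemma \<Psi>_euler: "\<Psi> euler = \<Psi> (pscale weight 1)"
proof -
  have "\<Psi> (euler - pscale weight 1) = \<zero>\<^bsub>M\<^esub>"
  proof -
    have *: "\<Psi> (\<Sum>i\<in>B. gen_y i * gen_x i) = \<zero>\<^bsub>M\<^esub>" if "B \<subseteq> {..<n}" for B
      using that
    proof (induction B rule: infinite_finite_induct)
      case (insert i B)
      then have "(\<Sum>i\<in>B. gen_y i * gen_x i) \<in> F" by (intro Fr_sum) auto
      then show ?case using insert by (simp add: M.\<Psi>_add \<Psi>_vacuum)
    qed auto
    have S: "(\<Sum>i<n. gen_y i * gen_x i) \<in> F" by (intro Fr_sum) auto
    have "\<Psi> (1 * central_part) = \<Psi> (pscale (\<chi> central_part) 1)"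
      by (rule \<Psi>_borel[OF Fr_1 central_part_borel])
    then have "\<Psi> (central_part - pscale (\<chi> central_part) 1) = \<zero>\<^bsub>M\<^esub>"
      using M.\<Psi>_eq_iff central_part_F by simp
    moreover have "euler - pscale weight 1 =
        - ((\<Sum>i<n. gen_y i * gen_x i) + (central_part - pscale (\<chi> central_part) 1))"
      by (rule poly_mapping_eqI) (simp add: euler_def weight_def lookup_add lookup_minus)
    ultimately show ?thesis
      using *[of "{..<n}"] S central_part_F by (simp add: M.\<Psi>_uminus M.\<Psi>_add del: minus_add_distrib minus_diff_eq)
  qed
  then show ?thesis using M.\<Psi>_eq_iff euler_F by simp
qed

text \<open>
  \<open>euler\<close> acts on \<open>y\<close>-monomials of degree \<open>d\<close> by the scalar \<open>weight + d\<close>, so \<open>lower d\<close> kills the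
  degrees \<open>1, \<dots>, d\<close> and rescales degree \<open>0\<close> by a nonzero number.
\<close>

abbreviation shifted :: "complex \<Rightarrow> generator free" where
  "shifted z \<equiv> euler - pscale z 1"

fun lower :: "nat \<Rightarrow> generator free" where
  "lower 0 = 1"
| "lower (Suc d) = shifted (weight + of_nat (Suc d)) * lower d"

lemma shifted_F: "shifted z \<in> F"
  using euler_F by auto

lemma lower_F: "lower d \<in> F"
  by (induction d) (auto intro!: Fr_mult shifted_F simp del: of_nat_Suc)

lemma shifted_commute: "shifted z * shifted w = shifted w * shifted z"
  by (simp add: algebra_simps pscale_mult_left pscale_mult_right pscale_diff)

lemma shifted_y: "j < n \<Longrightarrow> shifted (z + 1) * gen_y j \<approx> gen_y j * shifted z"
  using euler_y[of j]
  by (simp add: cong_I_def algebra_simps pscale_mult_left pscale_mult_right pscale_add_left)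

text \<open>
  Passing \<open>y\<^sub>j\<close> shifts every eigenvalue by one: the factors for the degrees \<open>1, \<dots>, d + 1\<close> become those
  for \<open>0, \<dots>, d\<close>.
\<close>

lemma lower_y:
  assumes "j < n"
  shows "lower (Suc d) * gen_y j \<approx> gen_y j * (shifted weight * lower d)"
proof (induction d)
  case 0
  then show ?case using shifted_y[OF assms, of weight] by simp
next
  case (Suc d)
  have "lower (Suc (Suc d)) * gen_y j = shifted (weight + of_nat (Suc (Suc d))) * (lower (Suc d) * gen_y j)"
    by (simp only: lower.simps mult.assoc)
  also have "\<dots> \<approx> shifted (weight + of_nat (Suc (Suc d))) * (gen_y j * (shifted weight * lower d))"
    by (intro cong_mult_left shifted_F Suc)
  also have "\<dots> = (shifted ((weight + of_nat (Suc d)) + 1) * gen_y j) * (shifted weight * lower d)"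
    by (simp only: mult.assoc of_nat_Suc add.assoc add.commute add.left_commute)
  also have "\<dots> \<approx> (gen_y j * shifted (weight + of_nat (Suc d))) * (shifted weight * lower d)"
    by (intro cong_mult_right shifted_y assms Fr_mult shifted_F lower_F)
  also have "\<dots> = gen_y j * ((shifted (weight + of_nat (Suc d)) * shifted weight) * lower d)"
    by (simp only: mult.assoc)
  also have "\<dots> = gen_y j * (shifted weight * lower (Suc d))"
    by (simp only: shifted_commute[of _ weight] lower.simps mult.assoc)
  finally show ?case .
qed

lemma shifted_vacuum: "\<Psi> (shifted z * pscale w 1) = \<Psi> (pscale ((weight - z) * w) 1)"
proof -
  have "\<Psi> (shifted z) = \<Psi> (pscale weight 1) \<ominus>\<^bsub>M\<^esub> \<Psi> (pscale z 1)"
    using euler_F by (simp add: M.\<Psi>_diff \<Psi>_euler)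
  also have "\<dots> = \<Psi> (pscale weight 1 - pscale z 1)"
    by (simp add: M.\<Psi>_diff)
  finally have "\<Psi> (shifted z) = \<Psi> (pscale (weight - z) 1)"
    by (metis diff_add_cancel eq_diff_eq pscale_add_left)
  then show ?thesis
    using shifted_F[of z] M.\<Psi>_pscale[of "shifted z" w] M.\<Psi>_pscale[of "pscale (weight - z) 1" w]
    by (simp add: pscale_mult_right mult.commute)
qed

text \<open>
  Once a vector has been moved into degree \<open>0\<close>, the further factors only rescale it.  The result is
  stated with a multiple of \<open>z\<close> so that a vanishing image stays zero.
\<close>

lemma lower_mono:
  assumes "\<Psi> (lower d * p) = \<Psi> (pscale z 1)" "p \<in> F" "d \<le> e"
  shows "\<exists>w. \<Psi> (lower e * p) = \<Psi> (pscale (w * z) 1)"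
  using assms(3)
proof (induction e rule: dec_induct)
  case base
  then show ?case using assms(1) by (intro exI[of _ 1]) simp
next
  case (step e)
  then obtain w where w: "\<Psi> (lower e * p) = \<Psi> (pscale (w * z) 1)" by auto
  have "\<Psi> (lower (Suc e) * p) = \<Psi> (shifted (weight + of_nat (Suc e)) * (lower e * p))"
    by (simp only: lower.simps mult.assoc)
  also have "\<dots> = \<Psi> (shifted (weight + of_nat (Suc e)) * pscale (w * z) 1)"
    using w assms(2) lower_F shifted_F by (intro M.\<Psi>_cong_mult) auto
  also have "\<dots> = \<Psi> (pscale (- of_nat (Suc e) * w * z) 1)"
    by (simp only: shifted_vacuum) (simp add: algebra_simps)
  finally show ?case by metis
qed

lemma lower_vacuum: "\<exists>w. w \<noteq> 0 \<and> \<Psi> (lower d) = \<Psi> (pscale w 1)"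
proof (induction d)
  case 0
  then show ?case by (intro exI[of _ 1]) simp
next
  case (Suc d)
  then obtain w where w: "w \<noteq> 0" "\<Psi> (lower d) = \<Psi> (pscale w 1)" by auto
  have "\<Psi> (lower (Suc d)) = \<Psi> (shifted (weight + of_nat (Suc d)) * pscale w 1)"
    unfolding lower.simps using w(2) lower_F shifted_F by (intro M.\<Psi>_cong_mult) auto
  also have "\<dots> = \<Psi> (pscale (- of_nat (Suc d) * w) 1)"
    by (simp only: shifted_vacuum) (simp add: algebra_simps)
  finally show ?case using w(1) by (intro exI conjI) (auto simp del: of_nat_Suc)
qed

abbreviation "Y \<equiv> Fr (GY ` {..<n})"

lemma Y_F: "p \<in> Y \<Longrightarrow> p \<in> F"
  by (rule Fr_mono) (auto simp: generators_def)

text \<open>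
  The next lemmas show that the subalgebra \<open>Y\<close> generated by the \<open>y\<^sub>j\<close> already produces the whole module:
  its image is stable under the group, which permutes the \<open>y\<^sub>j\<close> up to sign, and under the \<open>x\<^sub>i\<close>, which can
  be moved to the right at the cost of group elements.
\<close>

definition spanned :: "generator free \<Rightarrow> bool" where
  "spanned p \<longleftrightarrow> p \<in> F \<and> (\<exists>r\<in>Y. \<Psi> p = \<Psi> r)"

lemma spanned_Y: "p \<in> Y \<Longrightarrow> spanned p"
  using Y_F by (auto simp: spanned_def)

lemma spanned_add: "spanned p \<Longrightarrow> spanned r \<Longrightarrow> spanned (p + r)"
  unfolding spanned_def by (metis Fr_add M.\<Psi>_add Y_F)

lemma spanned_pscale: "spanned p \<Longrightarrow> spanned (pscale z p)"
  unfolding spanned_def by (metis Fr_pscale M.\<Psi>_pscale Y_F)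

lemma spanned_diff: "spanned p \<Longrightarrow> spanned r \<Longrightarrow> spanned (p - r)"
  using spanned_add[of p "- r"] spanned_pscale[of r "- 1"] by (simp add: pscale_minus1)

lemma spanned_sum: "(\<And>i. i \<in> B \<Longrightarrow> spanned (f i)) \<Longrightarrow> spanned (sum f B)"
  by (induction B rule: infinite_finite_induct) (auto simp: spanned_add spanned_Y)

lemma spanned_cong: "spanned p \<Longrightarrow> r \<in> F \<Longrightarrow> r \<approx> p \<Longrightarrow> spanned r"
  unfolding spanned_def by (metis \<Psi>_cong)

lemma spanned_y: "spanned p \<Longrightarrow> j < n \<Longrightarrow> spanned (gen_y j * p)"
  unfolding spanned_def
  by (metis Fr_gen Fr_mult M.\<Psi>_cong_mult Y_F generators_iff(2) imageI lessThan_iff)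

lemma spanned_g:
  assumes g: "g \<in> signed_perms n" and r: "r \<in> Y"
  shows "spanned (gen_g g * r)"
  using r
proof (induction r rule: Fr_induct)
  case one
  have "\<Psi> (gen_g g * 1) = \<Psi> (pscale (\<tau> g) 1)" using \<Psi>_vacuum(2)[OF g, of 1] by simp
  then show ?case using g unfolding spanned_def by (intro conjI bexI[of _ "pscale (\<tau> g) 1"]) simp_all
next
  case (gen c r)
  then obtain j where j: "c = GY j" "j < n" by auto
  obtain \<pi> \<epsilon> where p: "\<pi> permutes {..<n}" "\<And>k. \<epsilon> k \<in> {1, - 1}" "g = signed_mat n \<pi> \<epsilon>"
    using signed_permsE[OF g] by metis
  have "spanned (pscale (\<epsilon> j) (gen_y (\<pi> j) * (gen_g g * r)))"
    using gen j p by (intro spanned_pscale spanned_y) auto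
  moreover have "gen_g g * gen_y j * r \<approx> pscale (\<epsilon> j) (gen_y (\<pi> j) * gen_g g) * r"
    using gen Y_F by (intro cong_mult_right) (auto simp: p(3) intro!: g_y p j)
  ultimately show ?case
    using g gen j Y_F by (auto simp: pscale_mult_left mult.assoc elim!: spanned_cong)
next
  case (add p r)
  then show ?case by (simp add: distrib_left spanned_add)
next
  case (pscale z p)
  then show ?case by (simp add: pscale_mult_right spanned_pscale)
qed

lemma spanned_bracket:
  assumes "i < n" "j < n" "r \<in> Y"
  shows "spanned (bracket i j * r)"
proof -
  note g = spanned_g[OF _ assms(3)]
  show ?thesis
  proof (cases "i = j")
    case True
    have "spanned (1 * r - pscale c1 (\<Sum>k\<in>{..<n} - {i}. \<Sum>\<epsilon>\<in>{1, - 1}. gen_g (s_mat n i k \<epsilon>) * r)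
        - pscale cm1 (gen_g (t_mat n i) * r))"
      using assms by (intro spanned_diff spanned_pscale spanned_sum g) (auto intro: spanned_Y)
    then show ?thesis
      using True by (simp add: bracket_def left_diff_distrib pscale_mult_left sum_distrib_right distrib_right)
  next
    case False
    have "spanned (pscale c1 (\<Sum>\<epsilon>\<in>{1, - 1}. pscale \<epsilon> (gen_g (s_mat n i j \<epsilon>) * r)))"
      using assms False by (intro spanned_pscale spanned_sum g) auto
    then show ?thesis
      using False by (simp add: bracket_def pscale_mult_left sum_distrib_right distrib_right)
  qed
qed

lemma spanned_x:
  assumes i: "i < n" and r: "r \<in> Y"
  shows "spanned (gen_x i * r)"
  using r
proof (induction r rule: Fr_induct)
  case one
  have "\<Psi> (gen_x i * 1) = \<Psi> 0" using \<Psi>_vacuum(1)[OF i, of 1] by simp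
  then show ?case using i unfolding spanned_def by (intro conjI bexI[of _ 0]) simp_all
next
  case (gen c r)
  then obtain j where j: "c = GY j" "j < n" by auto
  have "spanned (gen_y j * (gen_x i * r) - bracket j i * r)"
    using gen i j by (intro spanned_diff spanned_y spanned_bracket) auto
  moreover have "- ((gen_y j * gen_x i - gen_x i * gen_y j - bracket j i) * r) \<in> I"
    using Y_F gen y_x_relation[OF j(2) i] by (intro I_uminus I_mult) auto
  then have "gen_x i * (gen_y j * r) \<approx> gen_y j * (gen_x i * r) - bracket j i * r"
    by (simp add: cong_I_def algebra_simps)
  ultimately show ?case
    using i j gen Y_F by (auto elim!: spanned_cong)
next
  case (add p r)
  then show ?case by (simp add: distrib_left spanned_add)
next
  case (pscale z p)
  then show ?case by (simp add: pscale_mult_right spanned_pscale)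
qed

lemma all_spanned: "p \<in> F \<Longrightarrow> spanned p"
proof (induction p rule: Fr_induct)
  case (gen c p)
  then obtain r where r: "r \<in> Y" "\<Psi> p = \<Psi> r" by (auto simp: spanned_def)
  have "spanned (gen c * r)"
  proof (cases c)
    case (GY j)
    then show ?thesis using gen r by (intro spanned_Y) auto
  qed (use gen r spanned_x spanned_g in auto)
  moreover have "\<Psi> (gen c * p) = \<Psi> (gen c * r)"
    using gen r Y_F by (intro M.\<Psi>_cong_mult) auto
  ultimately show ?case using gen by (auto simp: spanned_def)
qed (auto simp: spanned_Y spanned_add spanned_pscale)

text \<open>
  This makes precise that every vector has finitely many homogeneous components, and that the one of
  degree \<open>0\<close> is a multiple of the generator.
\<close>

lemma lower_exists:
  assumes "p \<in> F"
  shows "\<exists>d z. \<Psi> (lower d * p) = \<Psi> (pscale z 1)"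
proof -
  have "\<exists>d z. \<Psi> (lower d * r) = \<Psi> (pscale z 1)" if "r \<in> Y" for r
    using that
  proof (induction r rule: Fr_induct)
    case one
    show ?case by (intro exI[of _ 0] exI[of _ 1]) simp
  next
    case (gen c r)
    then obtain j d z where j: "c = GY j" "j < n" and d: "\<Psi> (lower d * r) = \<Psi> (pscale z 1)" by auto
    have r: "r \<in> F" using gen Y_F by auto
    have "\<Psi> (lower (Suc d) * gen_y j * r) = \<Psi> (gen_y j * (shifted weight * lower d) * r)"
      using j r lower_F shifted_F by (intro \<Psi>_cong cong_mult_right lower_y Fr_mult) auto
    also have "\<dots> = \<Psi> (gen_y j * shifted weight * (lower d * r))"
      by (simp only: mult.assoc)
    also have "\<dots> = \<Psi> (gen_y j * shifted weight * pscale z 1)"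
      using d j r lower_F shifted_F by (intro M.\<Psi>_cong_mult Fr_mult) auto
    also have "\<dots> = \<Psi> (gen_y j * pscale ((weight - weight) * z) 1)"
      unfolding mult.assoc using j shifted_vacuum shifted_F
      by (intro M.\<Psi>_cong_mult Fr_mult) (auto simp del: pscale_0)
    finally have "\<Psi> (lower (Suc d) * (gen c * r)) = \<Psi> (pscale 0 1)"
      by (simp only: j mult.assoc) simp
    then show ?case by blast
  next
    case (add p r)
    then obtain d z e w where d: "\<Psi> (lower d * p) = \<Psi> (pscale z 1)"
      and e: "\<Psi> (lower e * r) = \<Psi> (pscale w 1)" by auto
    have pr: "p \<in> F" "r \<in> F" using add Y_F by auto
    obtain z' w' where "\<Psi> (lower (max d e) * p) = \<Psi> (pscale z' 1)"
      "\<Psi> (lower (max d e) * r) = \<Psi> (pscale w' 1)"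
      using lower_mono[OF d pr(1), of "max d e"] lower_mono[OF e pr(2), of "max d e"] by auto
    then have "\<Psi> (lower (max d e) * (p + r)) = \<Psi> (pscale (z' + w') 1)"
      using pr lower_F by (simp add: distrib_left M.\<Psi>_add pscale_add_left)
    then show ?case by blast
  next
    case (pscale z p)
    then obtain d w where "\<Psi> (lower d * p) = \<Psi> (pscale w 1)" by auto
    then have "\<Psi> (lower d * pscale z p) = \<Psi> (pscale z (pscale w 1))"
      using pscale Y_F lower_F M.\<Psi>_pscale[of "lower d * p" z] M.\<Psi>_pscale[of "pscale w 1" z]
      by (simp add: pscale_mult_right del: pscale_pscale)
    then show ?case unfolding pscale_pscale by blast
  qed
  moreover obtain r where "r \<in> Y" "\<Psi> p = \<Psi> r"
    using all_spanned[OF assms] by (auto simp: spanned_def)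
  ultimately show ?thesis
    using M.\<Psi>_cong_mult[OF lower_F assms Y_F] by metis
qed

text \<open>
  A vector killed by some \<open>lower d\<close> has no component of degree \<open>0\<close>.  Those vectors need not form a
  submodule, but the vectors all of whose multiples are of this kind do.
\<close>

definition radical :: "symbols set set" where
  "radical = \<Psi> ` {p \<in> F. \<forall>a\<in>F. \<exists>d. \<Psi> (lower d * (a * p)) = \<zero>\<^bsub>M\<^esub>}"

lemma radical_subrep: "subrepresentation H M (M_act n c1 cm1 \<tau>) radical"
  unfolding radical_def
proof (rule M.subrep_image)
  fix p r
  assume p: "p \<in> {p \<in> F. \<forall>a\<in>F. \<exists>d. \<Psi> (lower d * (a * p)) = \<zero>\<^bsub>M\<^esub>}"
    and r: "r \<in> {p \<in> F. \<forall>a\<in>F. \<exists>d. \<Psi> (lower d * (a * p)) = \<zero>\<^bsub>M\<^esub>}"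
  have "\<exists>d. \<Psi> (lower d * (a * (p + r))) = \<zero>\<^bsub>M\<^esub>" if a: "a \<in> F" for a
  proof -
    obtain d e where d: "\<Psi> (lower d * (a * p)) = \<Psi> (pscale 0 1)"
      and e: "\<Psi> (lower e * (a * r)) = \<Psi> (pscale 0 1)"
      using p r a unfolding pscale_0 M.\<Psi>_0 by blast
    have "\<Psi> (lower (max d e) * (a * p)) = \<zero>\<^bsub>M\<^esub>" "\<Psi> (lower (max d e) * (a * r)) = \<zero>\<^bsub>M\<^esub>"
      using lower_mono[OF d, of "max d e"] lower_mono[OF e, of "max d e"] p r a by auto
    then have "\<Psi> (lower (max d e) * (a * (p + r))) = \<zero>\<^bsub>M\<^esub>"
      using p r a lower_F by (simp add: distrib_left M.\<Psi>_add)
    then show ?thesis by blast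
  qed
  then show "p + r \<in> {p \<in> F. \<forall>a\<in>F. \<exists>d. \<Psi> (lower d * (a * p)) = \<zero>\<^bsub>M\<^esub>}"
    using p r by auto
next
  fix c p assume "c \<in> F" "p \<in> {p \<in> F. \<forall>a\<in>F. \<exists>d. \<Psi> (lower d * (a * p)) = \<zero>\<^bsub>M\<^esub>}"
  then show "c * p \<in> {p \<in> F. \<forall>a\<in>F. \<exists>d. \<Psi> (lower d * (a * p)) = \<zero>\<^bsub>M\<^esub>}"
    by (auto simp flip: mult.assoc[of _ c p])
qed auto

lemma radical_proper:
  assumes "\<Psi> 1 \<noteq> \<zero>\<^bsub>M\<^esub>"
  shows "\<Psi> 1 \<notin> radical"
proof
  assume "\<Psi> 1 \<in> radical"
  then obtain p where p: "p \<in> F" "\<Psi> 1 = \<Psi> p" "\<forall>a\<in>F. \<exists>d. \<Psi> (lower d * (a * p)) = \<zero>\<^bsub>M\<^esub>"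
    by (auto simp: radical_def)
  then obtain d where "\<Psi> (lower d * p) = \<zero>\<^bsub>M\<^esub>" by (metis Fr_1 mult_1)
  then have "\<Psi> (lower d) = \<zero>\<^bsub>M\<^esub>"
    using M.\<Psi>_cong_mult[OF lower_F Fr_1 p(1,2)] by simp
  moreover obtain w where w: "w \<noteq> 0" "\<Psi> (lower d) = \<Psi> (pscale w 1)" using lower_vacuum by auto
  ultimately have "\<Psi> (pscale (1 / w) (pscale w 1)) = \<zero>\<^bsub>M\<^esub>"
    by (subst M.\<Psi>_pscale) auto
  then show False using w assms by simp
qed

text \<open>
  If \<open>lower d\<close> moves some vector of \<open>N\<close> to a nonzero multiple of the generator, then \<open>N\<close> contains the
  generator.
\<close>

lemma radical_maximal:
  assumes N: "subrepresentation H M (M_act n c1 cm1 \<tau>) N" "N \<noteq> carrier M"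
  shows "N \<subseteq> radical"
proof
  fix w assume w: "w \<in> N"
  then obtain p where p: "p \<in> F" "w = \<Psi> p" using M.subrep_carrier[OF N(1)] by metis
  have "\<exists>d. \<Psi> (lower d * (a * p)) = \<zero>\<^bsub>M\<^esub>" if a: "a \<in> F" for a
  proof -
    obtain d z where d: "\<Psi> (lower d * (a * p)) = \<Psi> (pscale z 1)"
      using lower_exists[of "a * p"] a p by auto
    have "\<Psi> (lower d * (a * p)) \<in> N"
      using M.subrep_mult[OF N(1)] a p w lower_F by auto
    then have "\<Psi> (pscale (1 / z) 1 * pscale z 1) \<in> N"
      using d by (intro M.subrep_mult[OF N(1)]) auto
    moreover have "\<Psi> 1 \<notin> N" using M.subrep_full[OF N(1)] N(2) by auto
    ultimately have "z = 0"
      by (cases "z = 0") (auto simp: pscale_mult_left)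
    then show ?thesis using d by auto
  qed
  then show "w \<in> radical" using p by (auto simp: radical_def)
qed

lemma L_kernel_eq:
  assumes "\<Psi> 1 \<noteq> \<zero>\<^bsub>M\<^esub>"
  shows "L_kernel n c1 cm1 \<tau> = radical"
proof -
  have "radical \<noteq> carrier M"
  proof
    assume "radical = carrier M"
    then show False using radical_proper[OF assms] by simp
  qed
  note iff = M.simple_quotient_iff[OF radical_subrep this radical_maximal]
  show ?thesis
    unfolding L_kernel_def
    by (rule the_equality) (use iff radical_subrep in auto)
qed

end


section \<open>One-dimensional simple quotients\<close>

context character_module
begin

text \<open>
  The value that \<open>\<tau>\<close> assigns to the right hand side of the relation for \<open>y\<^sub>i x\<^sub>i - x\<^sub>i y\<^sub>i\<close>.
\<close>

definition obstruction :: complex where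
  "obstruction = 1 - 2 * (of_nat n - 1) * c1 * a - cm1 * b"

lemma \<chi>_simps:
  "\<chi> (p + r) = \<chi> p + \<chi> r" "\<chi> (p - r) = \<chi> p - \<chi> r" "\<chi> (p * r) = \<chi> p * \<chi> r"
  "\<chi> (pscale z p) = z * \<chi> p" "\<chi> (- p) = - \<chi> p" "\<chi> (sum f B) = (\<Sum>i\<in>B. \<chi> (f i))"
  "\<chi> 1 = 1" "\<chi> 0 = 0" "\<chi> (gen c) = char_on_generator \<tau> c"
  by (simp_all add: char_lift_def char.lift_simps)

lemma \<tau>_values:
  "\<tau> (1\<^sub>m n) = 1"
  "g \<in> signed_perms n \<Longrightarrow> h \<in> signed_perms n \<Longrightarrow> \<tau> (g * h) = \<tau> g * \<tau> h"
  "i < n \<Longrightarrow> j < n \<Longrightarrow> i \<noteq> j \<Longrightarrow> \<epsilon> \<in> {1, - 1} \<Longrightarrow> \<tau> (s_mat n i j \<epsilon>) = a"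
  "i < n \<Longrightarrow> \<tau> (t_mat n i) = b"
  using linear_character unfolding linear_character_def by blast+

lemma \<chi>_bracket:
  assumes "i < n" "j < n"
  shows "\<chi> (bracket i j) = (if i = j then obstruction else 0)"
proof (cases "i = j")
  case True
  have "(\<Sum>k\<in>{..<n} - {i}. \<Sum>\<epsilon>\<in>{1, - 1}. \<tau> (s_mat n i k \<epsilon>)) = (\<Sum>k\<in>{..<n} - {i}. 2 * a)"
    using assms by (intro sum.cong) (auto simp: \<tau>_values(3))
  also have "\<dots> = (of_nat n - 1) * (2 * a)"
    using assms by (simp add: of_nat_diff)
  finally show ?thesis
    using True assms by (simp add: bracket_def \<chi>_simps \<tau>_values(4) obstruction_def del: sum.insert)
next
  case False
  then show ?thesis
    using assms by (simp add: bracket_def \<chi>_simps \<tau>_values(3))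
qed

text \<open>
  Multiplicativity of \<open>\<tau>\<close> and its equal values on the two reflections \<open>s\<^sub>i\<^sub>j\<close> take care of all relations
  but the one for \<open>y\<^sub>i x\<^sub>i - x\<^sub>i y\<^sub>i\<close>, where the left hand side goes to \<open>0\<close> and the right hand side to
  the obstruction.
\<close>

lemma \<chi>_I:
  assumes "obstruction = 0" "p \<in> I"
  shows "\<chi> p = 0"
proof -
  have group: "\<chi> r = 0" if "r \<in> group_relations n" for r
    using that
    by (auto simp: group_relations_def \<chi>_simps \<tau>_values(1,2) on_x_def on_y_def)
  have "\<chi> r = 0" if r: "r \<in> cherednik_relations n c1 cm1" for r
  proof -
    have 1: "\<chi> (gen_y i * gen_x j - gen_x j * gen_y i -
        pscale c1 (\<Sum>\<epsilon>\<in>{1, - 1}. pscale \<epsilon> (gen_g (s_mat n i j \<epsilon>)))) = 0"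
      if "i < n" "j < n" "i \<noteq> j" for i j
      using \<chi>_bracket[OF that(1,2)] that(3) by (simp add: bracket_def \<chi>_simps del: sum.insert)
    have 2: "\<chi> (gen_y i * gen_x i - gen_x i * gen_y i -
        (1 - pscale c1 (\<Sum>j\<in>{..<n} - {i}. \<Sum>\<epsilon>\<in>{1, - 1}. gen_g (s_mat n i j \<epsilon>))
           - pscale cm1 (gen_g (t_mat n i)))) = 0" if "i < n" for i
      using \<chi>_bracket[OF that that] assms(1) by (simp add: bracket_def \<chi>_simps del: sum.insert)
    show ?thesis
      using r group 1 2 unfolding cherednik_relations_def
      by (elim UnE) (auto simp: \<chi>_simps simp del: sum.insert)
  qed
  then have "I \<subseteq> {p \<in> F. \<chi> p = 0}"
    using cherednik_relations_Fr[of n c1 cm1] by (intro I_least) (auto simp: \<chi>_simps)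
  then show ?thesis using assms(2) by auto
qed

abbreviation "L \<equiv> L_space n c1 cm1 \<tau>"
abbreviation "actL \<equiv> L_act n c1 cm1 \<tau>"

definition \<Psi>L :: "generator free \<Rightarrow> symbols set set" where
  "\<Psi>L p = radical +>\<^bsub>M\<^esub> \<Psi> p"

lemma L_cyclic:
  assumes "\<Psi> 1 \<noteq> \<zero>\<^bsub>M\<^esub>"
  shows "cyclic_rep (generators n) H q L actL \<Psi>L"
  using M.quotient_cyclic[OF radical_subrep]
  unfolding L_space_def L_act_def[abs_def] L_kernel_eq[OF assms] \<Psi>L_def[abs_def] .

lemma \<Psi>L_zero_iff:
  assumes "\<Psi> 1 \<noteq> \<zero>\<^bsub>M\<^esub>" "p \<in> F"
  shows "\<Psi>L p = \<zero>\<^bsub>L\<^esub> \<longleftrightarrow> \<Psi> p \<in> radical"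
proof -
  have s: "submodule radical complex_ring M"
    using radical_subrep by (simp add: subrepresentation_def)
  show ?thesis
    using coset_eq_zero_iff[OF M.module_W s, of "\<Psi> p"] assms
    by (simp add: \<Psi>L_def L_space_def L_kernel_eq quot_zero[OF M.module_W s])
qed

text \<open>
  A zero module has no simple quotient, so for a vanishing standard module \<open>L_kernel\<close> denotes an
  arbitrary set.  Whatever it is, the quotient has a single coset, and this cannot be a line.
\<close>

lemma one_dimensional_imp_nonzero:
  assumes "one_dimensional L"
  shows "\<Psi> 1 \<noteq> \<zero>\<^bsub>M\<^esub>"
proof
  assume 0: "\<Psi> 1 = \<zero>\<^bsub>M\<^esub>"
  have "\<Psi> p = \<zero>\<^bsub>M\<^esub>" if "p \<in> F" for p
    using M.\<Psi>_cong_mult[OF that Fr_1 Fr_0] 0 by simp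
  then have M: "carrier M = {\<zero>\<^bsub>M\<^esub>}"
    using M.carrier_W by auto
  define N where "N = L_kernel n c1 cm1 \<tau>"
  have c: "carrier L = {N +>\<^bsub>M\<^esub> \<zero>\<^bsub>M\<^esub>}"
    by (simp add: L_space_def quot_def ring.defs module.defs FactRing_def A_RCOSETS_def' M N_def)
  interpret module complex_ring L
    using assms by (simp add: one_dimensional_def)
  have "\<zero>\<^bsub>L\<^esub> \<in> carrier L" by simp
  then show False
    using assms c by (auto simp: one_dimensional_def)
qed

context
  assumes L1: "one_dimensional L"
begin

interpretation L: cyclic_rep "generators n" H q L actL \<Psi>L
  by (rule L_cyclic[OF one_dimensional_imp_nonzero[OF L1]])

lemma \<Psi>L_1: "\<Psi>L 1 \<noteq> \<zero>\<^bsub>L\<^esub>"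
  using one_dimensional_imp_nonzero[OF L1] radical_proper \<Psi>L_zero_iff[of 1] by simp

lemma L_multiple:
  assumes "w \<in> carrier L"
  obtains z where "w = \<Psi>L (pscale z 1)"
proof -
  obtain v where v: "v \<in> carrier L" "\<And>w. w \<in> carrier L \<Longrightarrow> \<exists>z. w = z \<odot>\<^bsub>L\<^esub> v"
    using L1 by (auto simp: one_dimensional_def)
  obtain z y where z: "\<Psi>L 1 = z \<odot>\<^bsub>L\<^esub> v" and y: "w = y \<odot>\<^bsub>L\<^esub> v"
    using v(2)[of "\<Psi>L 1"] v(2)[OF assms] by auto
  have "z \<noteq> 0"
    using z v(1) \<Psi>L_1 L.W.smult_l_null[of v] by auto
  then have "w = (y / z) \<odot>\<^bsub>L\<^esub> \<Psi>L 1"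
    unfolding z using y v(1) L.W.smult_assoc1[of "y / z" z v] by simp
  then show ?thesis using that[of "y / z"] L.\<Psi>_pscale[of 1 "y / z"] by simp
qed

lemma \<Psi>L_cong: "p \<in> F \<Longrightarrow> r \<in> F \<Longrightarrow> \<Psi> p = \<Psi> r \<Longrightarrow> \<Psi>L p = \<Psi>L r"
  by (simp add: \<Psi>L_def)

lemma \<Psi>L_scalar_eq: "\<Psi>L (pscale z 1) = \<Psi>L (pscale w 1) \<longleftrightarrow> z = w"
proof
  assume "\<Psi>L (pscale z 1) = \<Psi>L (pscale w 1)"
  then have 0: "\<Psi>L (pscale (z - w) 1) = \<zero>\<^bsub>L\<^esub>"
    by (simp add: L.\<Psi>_eq_iff flip: pscale_diff_left)
  show "z = w"
  proof (rule ccontr)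
    assume "z \<noteq> w"
    have "\<Psi>L (pscale (1 / (z - w)) (pscale (z - w) 1)) = \<zero>\<^bsub>L\<^esub>"
      using 0 by (subst L.\<Psi>_pscale) auto
    then show False using \<Psi>L_1 \<open>z \<noteq> w\<close> by simp
  qed
qed simp

text \<open>
  The element \<open>t\<^sub>i\<close> anticommutes with \<open>y\<^sub>i\<close> and acts on the line by the nonzero scalar \<open>b\<close>, so \<open>y\<^sub>i\<close>
  must act by \<open>0\<close>.
\<close>

lemma \<Psi>L_y:
  assumes i: "i < n"
  shows "\<Psi>L (gen_y i) = \<zero>\<^bsub>L\<^esub>"
proof -
  have "t_mat n i * t_mat n i = 1\<^sub>m n"
    unfolding t_mat_signed signed_mat_mult[OF permutes_id permutes_id] signed_mat_one[symmetric]
    by (intro signed_mat_cong) (auto simp: permutes_id)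
  then have b: "b * b = 1"
    using \<tau>_values(1) \<tau>_values(2)[of "t_mat n i" "t_mat n i"] \<tau>_values(4)[OF i] by simp
  obtain z where z: "\<Psi>L (gen_y i) = \<Psi>L (pscale z 1)"
    using L_multiple[of "\<Psi>L (gen_y i)"] i by auto
  have t: "\<Psi>L (p * gen_g (t_mat n i)) = \<Psi>L (pscale b p)" if "p \<in> F" for p
    using \<Psi>_vacuum(2)[of "t_mat n i" p] that \<tau>_values(4)[OF i] by (intro \<Psi>L_cong) auto
  have "\<Psi>L (gen_g (t_mat n i) * gen_y i) = \<Psi>L (pscale (- 1) (gen_y i * gen_g (t_mat n i)))"
    using t_y[OF i, of i] i by (intro \<Psi>L_cong \<Psi>_cong) auto
  also have "\<dots> = (- 1) \<odot>\<^bsub>L\<^esub> \<Psi>L (pscale b (gen_y i))"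
    using i t[of "gen_y i"] by (subst L.\<Psi>_pscale) auto
  also have "\<dots> = (- b) \<odot>\<^bsub>L\<^esub> \<Psi>L (gen_y i)"
    using i L.\<Psi>_pscale[of "gen_y i" "- b"] by (subst L.\<Psi>_pscale[symmetric]) auto
  also have "\<dots> = \<Psi>L (pscale (- (b * z)) 1)"
    using L.\<Psi>_pscale[of "pscale z 1" "- b"] z by simp
  finally have "\<Psi>L (gen_g (t_mat n i) * gen_y i) = \<Psi>L (pscale (- (b * z)) 1)" .
  moreover have "\<Psi>L (gen_g (t_mat n i) * gen_y i) = \<Psi>L (gen_g (t_mat n i) * pscale z 1)"
    using z i by (intro L.\<Psi>_cong_mult) auto
  moreover have "\<dots> = \<Psi>L (pscale (z * b) 1)"
    using t[of "pscale z 1"] by (simp add: pscale_mult_right pscale_mult_left mult.commute)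
  ultimately have "z * b = - (b * z)"
    using \<Psi>L_scalar_eq by metis
  then have "z = 0" using b by auto
  then show ?thesis using z by simp
qed

lemma \<Psi>L_char: "p \<in> F \<Longrightarrow> \<Psi>L p = \<Psi>L (pscale (\<chi> p) 1)"
proof (induction p rule: Fr_induct)
  case one
  then show ?case by (simp add: \<chi>_simps)
next
  case (gen c p)
  have c: "\<Psi>L (gen c) = \<Psi>L (pscale (\<chi> (gen c)) 1)"
  proof (cases c)
    case (GX i)
    then show ?thesis
      using \<Psi>L_cong[of "gen_x i" 0] \<Psi>_vacuum(1)[of i 1] gen by (simp add: \<chi>_simps)
  next
    case (GY i)
    then show ?thesis using \<Psi>L_y gen by (simp add: \<chi>_simps)
  next
    case (GG g)
    then show ?thesis
      using \<Psi>L_cong[of "gen_g g" "pscale (\<tau> g) 1"] \<Psi>_vacuum(2)[of g 1] gen by (simp add: \<chi>_simps)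
  qed
  have "\<Psi>L (gen c * p) = \<Psi>L (gen c * pscale (\<chi> p) 1)"
    using gen by (intro L.\<Psi>_cong_mult) auto
  also have "\<dots> = \<chi> p \<odot>\<^bsub>L\<^esub> \<Psi>L (gen c)"
    using gen by (simp add: pscale_mult_right L.\<Psi>_pscale)
  also have "\<dots> = \<Psi>L (pscale (\<chi> p) (pscale (\<chi> (gen c)) 1))"
    unfolding c by (rule L.\<Psi>_pscale[symmetric]) simp
  finally show ?case by (simp add: \<chi>_simps(3) mult.commute)
next
  case (add p r)
  then show ?case by (simp add: \<chi>_simps L.\<Psi>_add pscale_add_left)
next
  case (pscale z p)
  then have "\<Psi>L (pscale z p) = \<Psi>L (pscale z (pscale (\<chi> p) 1))"
    using L.\<Psi>_pscale[of p z] L.\<Psi>_pscale[of "pscale (\<chi> p) 1" z] by (simp del: pscale_pscale)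
  then show ?case by (simp add: \<chi>_simps)
qed

lemma one_dimensional_action:
  assumes "p \<in> F" "w \<in> carrier L"
  shows "actL (q p) w = \<chi> p \<odot>\<^bsub>L\<^esub> w"
proof -
  obtain z where z: "w = \<Psi>L (pscale z 1)" using L_multiple[OF assms(2)] .
  have "actL (q p) w = \<Psi>L (pscale (z * \<chi> p) 1)"
    using assms(1) \<Psi>L_char[of "p * pscale z 1"] unfolding z
    by (simp add: L.act_q \<chi>_simps mult.commute)
  also have "\<dots> = \<chi> p \<odot>\<^bsub>L\<^esub> w"
    unfolding z using L.\<Psi>_pscale[of "pscale z 1" "\<chi> p"] by (simp add: mult.commute)
  finally show ?thesis .
qed

lemma one_dimensional_obstruction:
  assumes "0 < n"
  shows "obstruction = 0"
proof -
  let ?r = "gen_y 0 * gen_x 0 - gen_x 0 * gen_y 0 - bracket 0 0"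
  have "?r \<in> I" using y_x_relation[OF assms assms] .
  then have "\<Psi> ?r = \<Psi> 0" "?r \<in> F" using \<Psi>_I I_F by auto
  then have "\<Psi>L (pscale (\<chi> ?r) 1) = \<Psi>L (pscale 0 1)"
    using \<Psi>L_char[of ?r] \<Psi>L_cong[of ?r 0] by simp
  then have "\<chi> ?r = 0" using \<Psi>L_scalar_eq by blast
  then show ?thesis using \<chi>_bracket[OF assms assms] by (simp add: \<chi>_simps)
qed

end

text \<open>
  The kernel of \<open>\<chi>\<close> gives a proper submodule, hence lies in the radical.  Together with the
  generator it spans the module.
\<close>

lemma obstruction_one_dimensional:
  assumes "obstruction = 0"
  shows "one_dimensional L"
proof -
  have \<chi>0: "\<chi> p = 0" if "p \<in> F" "\<Psi> p = \<zero>\<^bsub>M\<^esub>" for p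
    using \<Psi>_zero_imp[OF \<chi>_I[OF assms]] that by blast
  have nz: "\<Psi> 1 \<noteq> \<zero>\<^bsub>M\<^esub>"
    using \<chi>0[of 1] by (auto simp: \<chi>_simps)
  interpret L: cyclic_rep "generators n" H q L actL \<Psi>L
    by (rule L_cyclic[OF nz])
  let ?J = "{p \<in> F. \<chi> p = 0}"
  have sub: "subrepresentation H M (M_act n c1 cm1 \<tau>) (\<Psi> ` ?J)"
    by (rule M.subrep_image) (auto simp: \<chi>_simps)
  have "\<Psi> 1 \<notin> \<Psi> ` ?J"
  proof
    assume "\<Psi> 1 \<in> \<Psi> ` ?J"
    then obtain p where "p \<in> F" "\<chi> p = 0" "\<Psi> 1 = \<Psi> p" by auto
    then show False
      using \<chi>0[of "1 - p"] M.\<Psi>_eq_iff[of 1 p] by (simp add: \<chi>_simps)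
  qed
  then have "\<Psi> ` ?J \<noteq> carrier M" using M.\<Psi>_closed[OF Fr_1] by metis
  then have J: "\<Psi> ` ?J \<subseteq> radical" by (rule radical_maximal[OF sub])
  have "w = \<chi> p \<odot>\<^bsub>L\<^esub> \<Psi>L 1" if "w = \<Psi>L p" "p \<in> F" for w p
  proof -
    have "\<Psi> (p - pscale (\<chi> p) 1) \<in> radical"
      using J that(2) by (auto simp: \<chi>_simps)
    then have "\<Psi>L (p - pscale (\<chi> p) 1) = \<zero>\<^bsub>L\<^esub>"
      using \<Psi>L_zero_iff[OF nz] that(2) by simp
    then show ?thesis
      using L.\<Psi>_eq_iff[of p "pscale (\<chi> p) 1"] that L.\<Psi>_pscale[of 1 "\<chi> p"] by simp
  qed
  then have "\<forall>w\<in>carrier L. \<exists>z. w = z \<odot>\<^bsub>L\<^esub> \<Psi>L 1"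
    unfolding L.carrier_W by blast
  moreover have "\<Psi>L 1 \<noteq> \<zero>\<^bsub>L\<^esub>"
    using \<Psi>L_zero_iff[OF nz, of 1] radical_proper[OF nz] by simp
  ultimately show ?thesis
    unfolding one_dimensional_def using L.module_W L.\<Psi>_closed[OF Fr_1] by blast
qed

end


section \<open>The twist\<close>

lemma tensor_T_mult: "tensor_T u v * tensor_T u' v' = tensor_T (u + u') (v + v')"
  by (simp add: tensor_T_def mult_single)

lemma tensor_T_0: "tensor_T 0 0 = 1"
  by (simp add: tensor_T_def single_one flip: zero_prod_def)

lemma gamma_double: "gamma i + gamma i = 0"
  by (simp add: gamma_def flip: single_add)

text \<open>
  On a pair of characters taking the values \<open>x\<close> and \<open>y\<close> in \<open>{1, -1}\<close>, the element \<open>f\<^sub>i\<^sub>j\<close> takes the value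
  \<open>(1 + x + y - x y) / 2\<close>, which is again \<open>1\<close> or \<open>-1\<close>.
\<close>

lemma f_elem_square: "f_elem i j * f_elem i j = 1"
proof -
  define X where "X = tensor_T (gamma i) 0"
  define Y where "Y = tensor_T 0 (gamma j)"
  have sq: "X * X = 1" "Y * Y = 1" and XY: "tensor_T (gamma i) (gamma j) = X * Y"
    by (simp_all add: X_def Y_def tensor_T_mult gamma_double tensor_T_0)
  have "(1 + X + Y - X * Y) * (1 + X + Y - X * Y) =
      1 + X * X + Y * Y + (X * X) * (Y * Y) + 2 * X + 2 * Y - 2 * (X * X) * Y - 2 * X * (Y * Y)"
    by (simp add: algebra_simps)
  also have "\<dots> = pscale 4 1"
    unfolding sq by (simp add: poly_mapping_eq_iff fun_eq_iff lookup_add lookup_one when_def lookup_numeral)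
  finally show ?thesis
    unfolding f_elem_def tensor_T_0 X_def[symmetric] Y_def[symmetric] XY
    by (simp add: pscale_mult_left pscale_mult_right)
qed

text \<open>Each factor of \<open>\<F>\<close> is an involution, and the factors commute.\<close>

lemma F_inverse_eq: "F_inverse n = F_elem n"
proof -
  have FF: "F_elem n * F_elem n = 1"
    unfolding F_elem_def by (simp add: case_prod_unfold f_elem_square flip: prod.distrib)
  show ?thesis
    unfolding F_inverse_def
  proof (rule the_equality[of "\<lambda>K. F_elem n * K = 1", OF FF])
    fix K assume "F_elem n * K = 1"
    then have "F_elem n * F_elem n * K = F_elem n" by (simp add: mult.assoc)
    then show "K = F_elem n" by (simp add: FF)
  qed
qed

definition augmentation :: "('k \<Rightarrow>\<^sub>0 complex) \<Rightarrow> complex" where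
  "augmentation p = (\<Sum>k\<in>Poly_Mapping.keys p. Poly_Mapping.lookup p k)"

lemma augmentation_lin_ext: "augmentation = num.lin_ext (\<lambda>_. 1)"
  by (simp add: fun_eq_iff augmentation_def num.lin_ext_def)

text \<open>
  The coefficients of \<open>f\<^sub>i\<^sub>j\<close> add up to \<open>(1 + 1 + 1 - 1) / 2 = 1\<close>, and multiplication by a group element
  only permutes the coefficients of \<open>p\<close>.
\<close>

lemma augmentation_f: "augmentation (f_elem i j * p) = augmentation p"
proof -
  have T: "augmentation (tensor_T u v * p) = augmentation p" for u v
  proof -
    have "augmentation (tensor_T u v * (\<Sum>k\<in>B. Poly_Mapping.single k (Poly_Mapping.lookup p k))) =
        augmentation (\<Sum>k\<in>B. Poly_Mapping.single k (Poly_Mapping.lookup p k))" if "finite B" for B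
      using that
      by (induction B rule: finite_induct)
        (simp_all add: augmentation_lin_ext num.lin_ext_simps distrib_left tensor_T_def mult_single)
    from this[of "Poly_Mapping.keys p"] show ?thesis
      by (simp flip: poly_mapping_sum_singles)
  qed
  have "augmentation (f_elem i j * p) = 1 / 2 * (augmentation (tensor_T 0 0 * p)
      + augmentation (tensor_T (gamma i) 0 * p) + augmentation (tensor_T 0 (gamma j) * p)
      - augmentation (tensor_T (gamma i) (gamma j) * p))"
    by (simp add: augmentation_lin_ext f_elem_def pscale_mult_left num.lin_ext_simps
        left_diff_distrib distrib_right)
  then show ?thesis by (simp add: T)
qed

lemma augmentation_F: "augmentation (F_elem n) = 1"
proof -
  have "augmentation (\<Prod>(i, j)\<in>B. f_elem i j) = 1" if "finite B" for B
    using that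
  proof (induction B rule: finite_induct)
    case empty
    then show ?case by (simp add: augmentation_lin_ext flip: single_one)
  next
    case (insert x B)
    then show ?case by (cases x) (simp add: augmentation_f)
  qed
  moreover have "finite {(i, j). j < i \<and> i < n}"
    by (rule finite_subset[of _ "{..<n} \<times> {..<n}"]) auto
  ultimately show ?thesis unfolding F_elem_def by blast
qed

context cherednik_params
begin

abbreviation torus_lift :: "torus \<Rightarrow> generator free \<Rightarrow> generator free" where
  "torus_lift u \<equiv> free_lift pscale (torus_on_generator n u)"

abbreviation conj_torus :: "torus \<Rightarrow> complex mat \<Rightarrow> complex mat" where
  "conj_torus u g \<equiv> torus_mat n u * g * inv\<^bsub>G_group n\<^esub> (torus_mat n u)"

lemma conj_torus_signed:
  assumes "\<pi> permutes {..<n}"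
  shows "conj_torus u (signed_mat n \<pi> \<epsilon>) =
    signed_mat n \<pi> (\<lambda>k. torus_sign u k * \<epsilon> k * torus_sign u (\<pi> k))"
  using assms torus_sign_cases[of u] unfolding torus_mat_signed
  by (simp add: inv_signed_mat permutes_id signed_mat_mult permutes_compose mult.assoc)

lemma conj_torus_mult:
  assumes "g \<in> signed_perms n" "h \<in> signed_perms n"
  shows "conj_torus u (g * h) = conj_torus u g * conj_torus u h"
proof -
  obtain \<pi> \<epsilon> \<pi>' \<epsilon>' where p: "\<pi> permutes {..<n}" "\<pi>' permutes {..<n}"
    and gh: "g = signed_mat n \<pi> \<epsilon>" "h = signed_mat n \<pi>' \<epsilon>'"
    using assms by (metis signed_permsE)
  have eq: "torus_sign u k * (\<epsilon>' k * \<epsilon> (\<pi>' k)) * torus_sign u (\<pi> (\<pi>' k)) =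
      torus_sign u k * \<epsilon>' k * torus_sign u (\<pi>' k) *
        (torus_sign u (\<pi>' k) * \<epsilon> (\<pi>' k) * torus_sign u (\<pi> (\<pi>' k)))" for k
    using torus_sign_square[of u "\<pi>' k"] by (simp add: algebra_simps)
  have "conj_torus u (g * h) = signed_mat n (\<pi> \<circ> \<pi>')
      (\<lambda>k. torus_sign u k * (\<epsilon>' k * \<epsilon> (\<pi>' k)) * torus_sign u (\<pi> (\<pi>' k)))"
    using p by (simp add: gh signed_mat_mult conj_torus_signed permutes_compose)
  also have "\<dots> = conj_torus u g * conj_torus u h"
    unfolding eq using p by (simp add: gh signed_mat_mult conj_torus_signed)
  finally show ?thesis .
qed

lemma conj_torus_in: "g \<in> signed_perms n \<Longrightarrow> conj_torus u g \<in> signed_perms n"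
  using group.inv_closed[OF group_G_group, of "torus_mat n u" n] by simp

lemma torus_lift_gen:
  "i < n \<Longrightarrow> torus_lift u (gen_x i) = pscale (torus_sign u i) (gen_x i)"
  "i < n \<Longrightarrow> torus_lift u (gen_y i) = pscale (torus_sign u i) (gen_y i)"
  "torus_lift u (gen_g g) = gen_g (conj_torus u g)"
  using on_x_signed[OF permutes_id, of i n "torus_sign u"]
    on_y_signed[where \<pi> = id and \<epsilon> = "torus_sign u", OF permutes_id torus_sign_cases, of i n]
  by (simp_all add: torus_mat_signed)

declare subst.lift_gen [simp del]

lemma torus_lift_simps:
  "torus_lift u (p + r) = torus_lift u p + torus_lift u r"
  "torus_lift u (p - r) = torus_lift u p - torus_lift u r"
  "torus_lift u (p * r) = torus_lift u p * torus_lift u r"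
  "torus_lift u (pscale z p) = pscale z (torus_lift u p)"
  "torus_lift u (sum f B) = (\<Sum>i\<in>B. torus_lift u (f i))"
  "torus_lift u 1 = 1" "torus_lift u 0 = 0"
  by (simp_all add: subst.lift_simps flip: pscale_eq_mult)

lemma torus_lift_F: "p \<in> F \<Longrightarrow> torus_lift u p \<in> F"
proof (rule subst_Fr)
  fix c assume "c \<in> generators n"
  then show "torus_on_generator n u c \<in> F"
    by (cases c) (auto intro: conj_torus_in)
qed

lemma conj_torus_s:
  assumes "i < n" "j < n" "i \<noteq> j" "\<epsilon> \<in> {1, - 1}"
  shows "conj_torus u (s_mat n i j \<epsilon>) = s_mat n i j (torus_sign u i * torus_sign u j * \<epsilon>)"
proof -
  have "torus_sign u i * torus_sign u j * \<epsilon> \<in> {1, - 1}"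
    using torus_sign_cases[of u i] torus_sign_cases[of u j] assms(4) by auto
  then show ?thesis
    using assms torus_sign_square[of u]
    by (simp add: s_mat_signed conj_torus_signed permutes_transpose)
      (auto intro!: signed_mat_cong permutes_transpose simp: mult.commute)
qed

lemma conj_torus_t: "conj_torus u (t_mat n i) = t_mat n i"
  using torus_sign_square[of u]
  by (auto simp: t_mat_signed conj_torus_signed permutes_id intro!: signed_mat_cong)

lemma torus_lift_bracket:
  assumes "i < n" "j < n"
  shows "torus_lift u (bracket i j) = pscale (torus_sign u i * torus_sign u j) (bracket i j)"
proof (cases "i = j")
  case True
  have inner: "(\<Sum>\<epsilon>\<in>{1, - 1}. gen_g (conj_torus u (s_mat n i k \<epsilon>))) = (\<Sum>\<epsilon>\<in>{1, - 1}. gen_g (s_mat n i k \<epsilon>))"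
    if "k < n" "k \<noteq> i" for k
  proof -
    have "torus_sign u i * torus_sign u k \<in> {1, - 1}"
      using torus_sign_cases[of u i] torus_sign_cases[of u k] by auto
    then show ?thesis
      using conj_torus_s[of i k _ u] assms that by (auto simp: add.commute)
  qed
  have "(\<Sum>k\<in>{..<n} - {i}. \<Sum>\<epsilon>\<in>{1, - 1}. gen_g (conj_torus u (s_mat n i k \<epsilon>)))
      = (\<Sum>k\<in>{..<n} - {i}. \<Sum>\<epsilon>\<in>{1, - 1}. gen_g (s_mat n i k \<epsilon>))"
    by (rule sum.cong[OF refl], rule inner) auto
  then show ?thesis
    using True torus_sign_square[of u i]
    by (simp add: bracket_def torus_lift_simps torus_lift_gen conj_torus_t del: sum.insert)
next
  case False
  have "torus_sign u i * torus_sign u j \<in> {1, - 1}"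
    using torus_sign_cases[of u i] torus_sign_cases[of u j] by auto
  then show ?thesis
    using False conj_torus_s[of i j _ u] assms
    by (auto simp: bracket_def torus_lift_simps torus_lift_gen pscale_add pscale_diff mult.commute)
qed

lemma torus_lift_group:
  assumes "r \<in> group_relations n"
  shows "torus_lift u r \<in> I"
proof -
  have rel: "r \<in> group_relations n \<Longrightarrow> r \<in> I" for r
    by (rule relation_in_I) (simp add: cherednik_relations_def)
  have xy: "torus_lift u (gen_g g * gen_x i - on_x n g i * gen_g g) \<in> I \<and>
      torus_lift u (gen_g g * gen_y i - on_y n g i * gen_g g) \<in> I"
    if g: "g \<in> signed_perms n" and i: "i < n" for g i
  proof -
    obtain \<pi> \<epsilon> where p: "\<pi> permutes {..<n}" "\<And>k. \<epsilon> k \<in> {1, - 1}" "g = signed_mat n \<pi> \<epsilon>"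
      using signed_permsE[OF g] by metis
    define \<delta> where "\<delta> k = torus_sign u k * \<epsilon> k * torus_sign u (\<pi> k)" for k
    have \<delta>: "\<delta> k \<in> {1, - 1}" for k
      using p(2)[of k] torus_sign_cases[of u k] torus_sign_cases[of u "\<pi> k"] by (auto simp: \<delta>_def)
    let ?g = "signed_mat n \<pi> \<delta>"
    have c: "conj_torus u g = ?g"
      unfolding p(3) \<delta>_def by (rule conj_torus_signed[OF p(1)])
    have g': "?g \<in> signed_perms n" using p(1) \<delta> by (rule signed_mat_in)
    have "gen_g ?g * gen_x i - on_x n ?g i * gen_g ?g \<in> I"
      "gen_g ?g * gen_y i - on_y n ?g i * gen_g ?g \<in> I"
      using g' i by (intro rel; unfold group_relations_def; blast)+
    then have "pscale (torus_sign u i) (gen_g ?g * gen_x i - pscale (\<delta> i) (gen_x (\<pi> i)) * gen_g ?g) \<in> I"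
      "pscale (torus_sign u i) (gen_g ?g * gen_y i - pscale (\<delta> i) (gen_y (\<pi> i)) * gen_g ?g) \<in> I"
      using on_x_signed[OF p(1) i, of \<delta>] on_y_signed[where \<epsilon> = \<delta>, OF p(1) \<delta> i] by (auto intro: I_pscale)
    moreover have "torus_sign u i * \<delta> i = \<epsilon> i * torus_sign u (\<pi> i)"
      using torus_sign_square[of u i] by (simp add: \<delta>_def mult.assoc[symmetric])
    ultimately show ?thesis
      using on_x_signed[OF p(1) i, of \<epsilon>] on_y_signed[where \<epsilon> = \<epsilon>, OF p(1,2) i] p(1) i c
      by (simp add: p(3)[symmetric] torus_lift_simps torus_lift_gen pscale_mult_left
          pscale_mult_right pscale_diff)
  qed
  have one: "torus_lift u (gen_g (1\<^sub>m n) - 1) \<in> I"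
  proof -
    have "conj_torus u (1\<^sub>m n) = 1\<^sub>m n"
      unfolding signed_mat_one[symmetric] conj_torus_signed[OF permutes_id]
      using torus_sign_square[of u] by simp
    then have "torus_lift u (gen_g (1\<^sub>m n) - 1) = gen_g (1\<^sub>m n) - 1"
      by (simp add: torus_lift_simps torus_lift_gen)
    then show ?thesis by (simp add: rel group_relations_def)
  qed
  have mult: "torus_lift u (gen_g g * gen_g h - gen_g (g * h)) \<in> I"
    if "g \<in> signed_perms n" "h \<in> signed_perms n" for g h
  proof -
    have "gen_g (conj_torus u g) * gen_g (conj_torus u h) - gen_g (conj_torus u g * conj_torus u h) \<in> I"
      using that by (intro rel, unfold group_relations_def) (blast intro: conj_torus_in)
    then show ?thesis
      using that by (simp only: torus_lift_simps torus_lift_gen conj_torus_mult)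
  qed
  from assms show ?thesis
    unfolding group_relations_def using one mult xy by blast
qed

text \<open>
  The torus multiplies each \<open>x\<^sub>i\<close> and \<open>y\<^sub>i\<close> by a sign and conjugates the group.  Every defining relation goes
  to a signed relation of the same family; for the brackets the sign is absorbed by reindexing the
  sum over \<open>\<epsilon>\<close>.
\<close>

lemma torus_lift_I:
  assumes "p \<in> I"
  shows "torus_lift u p \<in> I"
proof -
  have x: "torus_lift u (gen_x i * gen_x j - gen_x j * gen_x i) \<in> I" if "i < n" "j < n" for i j
  proof -
    have "gen_x i * gen_x j - gen_x j * gen_x i \<in> I"
      using that by (intro relation_in_I, unfold cherednik_relations_def) blast
    from I_pscale[OF this, of "torus_sign u i * torus_sign u j"] show ?thesis
      using that by (simp add: torus_lift_simps torus_lift_gen pscale_simps mult.commute)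
  qed
  have y: "torus_lift u (gen_y i * gen_y j - gen_y j * gen_y i) \<in> I" if "i < n" "j < n" for i j
    using I_pscale[of "gen_y i * gen_y j - gen_y j * gen_y i" "torus_sign u i * torus_sign u j"]
      y_commute[OF that] that
    by (simp add: torus_lift_simps torus_lift_gen pscale_simps mult.commute cong_I_def)
  have b: "torus_lift u (gen_y i * gen_x j - gen_x j * gen_y i - bracket i j) \<in> I"
    if "i < n" "j < n" for i j
    using I_pscale[OF y_x_relation[OF that], of "torus_sign u i * torus_sign u j"] that
    by (simp add: torus_lift_simps torus_lift_gen torus_lift_bracket pscale_mult_left
        pscale_mult_right pscale_diff mult.commute)
  have "torus_lift u r \<in> I" if "r \<in> cherednik_relations n c1 cm1" for r
    using that unfolding cherednik_relations_def
  proof (elim UnE)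
    assume "r \<in> {gen_y i * gen_x j - gen_x j * gen_y i -
        pscale c1 (\<Sum>\<epsilon>\<in>{1, - 1}. pscale \<epsilon> (gen_g (s_mat n i j \<epsilon>)))
        | i j. i < n \<and> j < n \<and> i \<noteq> j}"
    then obtain i j where "i < n" "j < n" "r = gen_y i * gen_x j - gen_x j * gen_y i - bracket i j"
      unfolding bracket_def by auto
    then show ?thesis using b by simp
  next
    assume "r \<in> {gen_y i * gen_x i - gen_x i * gen_y i -
        (1 - pscale c1 (\<Sum>j\<in>{..<n} - {i}. \<Sum>\<epsilon>\<in>{1, - 1}. gen_g (s_mat n i j \<epsilon>))
           - pscale cm1 (gen_g (t_mat n i)))
        | i. i < n}"
    then obtain i where "i < n" "r = gen_y i * gen_x i - gen_x i * gen_y i - bracket i i"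
      unfolding bracket_def by auto
    then show ?thesis using b by simp
  qed (use x y torus_lift_group in blast)+
  then have "I \<subseteq> {p \<in> F. torus_lift u p \<in> I}"
    using cherednik_relations_Fr[of n c1 cm1]
    by (intro I_least) (auto simp: torus_lift_simps I_0 intro: I_add I_mult torus_lift_F)
  then show ?thesis using assms by auto
qed

lemma torus_act_q:
  assumes "p \<in> F"
  shows "torus_act n c1 cm1 u (q p) = q (torus_lift u p)"
  unfolding torus_act_def q_coset
  by (rule quot_map_coset[OF module_free submodule_I])
    (use assms torus_lift_I torus_lift_F in \<open>auto simp: torus_lift_simps\<close>)

lemma finsum_q:
  assumes "finite B" "\<And>k. k \<in> B \<Longrightarrow> f k \<in> F"
  shows "finsum H (\<lambda>k. q (f k)) B = q (sum f B)"
proof -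
  interpret module complex_ring H
    unfolding cherednik_def by (rule module_quot[OF module_free submodule_I])
  have 0: "\<zero>\<^bsub>H\<^esub> = q 0"
    using smult_l_null[of "q 0"] H.q_smult[of 0 0] H.carrier_A by auto
  show ?thesis
    using assms
  proof (induction B rule: finite_induct)
    case (insert k B)
    then have "(\<lambda>k. q (f k)) \<in> B \<rightarrow> carrier H" "q (f k) \<in> carrier H"
      by (auto simp: H.carrier_A)
    with insert show ?case
      using H.q_add[of "f k" "sum f B"] by simp
  qed (simp add: 0)
qed

text \<open>
  The twisted product, on representatives in the free algebra.
\<close>

definition star :: "generator free \<Rightarrow> generator free \<Rightarrow> generator free" where
  "star p r = (\<Sum>k\<in>Poly_Mapping.keys (F_elem n).
     pscale (Poly_Mapping.lookup (F_elem n) k) (torus_lift (fst k) p * torus_lift (snd k) r))"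

lemma star_F: "p \<in> F \<Longrightarrow> r \<in> F \<Longrightarrow> star p r \<in> F"
  unfolding star_def by (auto intro!: Fr_sum torus_lift_F)

lemma twist_mult_q:
  assumes "p \<in> F" "r \<in> F"
  shows "q p \<otimes>\<^bsub>cherednik_twist n c1 cm1\<^esub> q r = q (star p r)"
proof -
  have "q p \<otimes>\<^bsub>cherednik_twist n c1 cm1\<^esub> q r =
    finsum H (\<lambda>k. q (pscale (Poly_Mapping.lookup (F_elem n) k) (torus_lift (fst k) p * torus_lift (snd k) r)))
      (Poly_Mapping.keys (F_elem n))"
    using assms
    by (simp add: cherednik_twist_def twist_def F_inverse_eq case_prod_unfold torus_act_q
        H.q_mult H.q_smult torus_lift_F)
  also have "\<dots> = q (star p r)"
    unfolding star_def using assms by (intro finsum_q) (auto intro: torus_lift_F)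
  finally show ?thesis .
qed

end

context character_module
begin

text \<open>
  A linear character does not see conjugation by the torus, so in the twisted product it only
  feels the augmentation of the twisting element, which is \<open>1\<close>.
\<close>

lemma \<chi>_torus:
  assumes "p \<in> F"
  shows "\<chi> (torus_lift u p) = \<chi> p"
  using assms
proof (induction p rule: Fr_induct)
  case (gen c p)
  have "\<chi> (torus_lift u (gen c)) = \<chi> (gen c)"
  proof (cases c)
    case (GG g)
    then have g: "g \<in> signed_perms n" using gen by simp
    have t: "torus_mat n u * torus_mat n u = 1\<^sub>m n"
      unfolding torus_mat_signed signed_mat_mult[OF permutes_id permutes_id] signed_mat_one[symmetric]
      by (simp add: torus_sign_square)
    then have inv: "inv\<^bsub>G_group n\<^esub> (torus_mat n u) = torus_mat n u"
      by (intro group.inv_equality[OF group_G_group]) auto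
    have "\<tau> (conj_torus u g) = \<tau> g * (\<tau> (torus_mat n u) * \<tau> (torus_mat n u))"
      unfolding inv using g by (simp add: \<tau>_values(2) mult.commute)
    also have "\<dots> = \<tau> g"
      using \<tau>_values(2)[of "torus_mat n u" "torus_mat n u"] by (simp add: t \<tau>_values(1))
    finally show ?thesis using GG by (simp only: torus_lift_gen \<chi>_simps char_on_generator.simps)
  qed (use gen in \<open>simp_all only: generators_iff torus_lift_gen \<chi>_simps char_on_generator.simps mult_zero_right\<close>)
  then show ?case using gen by (simp only: torus_lift_simps \<chi>_simps(3))
qed (simp_all add: torus_lift_simps \<chi>_simps)

lemma \<chi>_star:
  assumes "p \<in> F" "r \<in> F"
  shows "\<chi> (star p r) = \<chi> p * \<chi> r"
proof -
  have "\<chi> (star p r) = (\<Sum>k\<in>Poly_Mapping.keys (F_elem n). Poly_Mapping.lookup (F_elem n) k * (\<chi> p * \<chi> r))"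
    using assms by (simp add: star_def \<chi>_simps \<chi>_torus)
  also have "\<dots> = augmentation (F_elem n) * (\<chi> p * \<chi> r)"
    by (simp add: augmentation_def sum_distrib_right)
  finally show ?thesis by (simp add: augmentation_F)
qed

end


section \<open>Twists of the one-dimensional modules\<close>

context cherednik_params
begin

abbreviation "B \<equiv> braided n (- c1) (- cm1)"
abbreviation "qB \<equiv> braided_class n (- c1) (- cm1)"

lemma ideal_B: "ideal (braided_ideal n (- c1) (- cm1)) (free_algebra (generators n))"
  unfolding braided_ideal_def by (rule ideal_genideal_free[OF braided_relations_Fr])

lemma qB_coset: "qB = (\<lambda>p. braided_ideal n (- c1) (- cm1) +>\<^bsub>free_algebra (generators n)\<^esub> p)"
  by (simp add: fun_eq_iff braided_class_def)

lemma presented_B: "presented_algebra (generators n) B qB"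
  unfolding braided_def qB_coset by (rule ideal_quotient_presented[OF ideal_B])

lemma qB_group_relation:
  assumes "p - r \<in> group_relations n" "p \<in> F" "r \<in> F"
  shows "qB p = qB r"
proof -
  have "p - r \<in> braided_ideal n (- c1) (- cm1)"
    unfolding braided_ideal_def
    using assms(1) genideal_free_self[OF braided_relations_Fr[of n "- c1" "- cm1"]]
    by (auto simp: braided_relations_def)
  then show ?thesis
    unfolding qB_coset using coset_eq_iff[OF module_free ideal_quotient_presented(2)[OF ideal_B], of p r] assms
    by simp
qed

end

context character_module
begin

text \<open>
  The condition \<open>a = a' * b\<close> says that \<open>\<tau>'\<close> takes at \<open>\<sigma>\<^sub>i = s\<^sub>i t\<^sub>i\<^sub>+\<^sub>1\<close> the value \<open>\<tau>(s\<^sub>i)\<close> prescribed by \<open>\<phi>\<close>; at the \<open>t\<^sub>i\<close>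
  both characters agree.  As \<open>\<chi> \<circ> \<phi>\<close> and \<open>\<tau>'\<close> are multiplicative on the group, this is enough.
\<close>

theorem twist_of_one_dimensional:
  assumes phi: "is_phi n c1 cm1 \<phi>" and L1: "one_dimensional L"
    and \<tau>': "linear_character n \<tau>' a' b" and a: "a = a' * b"
  shows "is_braided_L n (- c1) (- cm1) \<tau>' L (L_twist_act n c1 cm1 \<tau> \<phi>)"
proof -
  let ?act = "L_twist_act n c1 cm1 \<tau> \<phi>"
  interpret B: presented_algebra "generators n" B qB by (rule presented_B)
  interpret L: cyclic_rep "generators n" H q L actL \<Psi>L
    by (rule L_cyclic[OF one_dimensional_imp_nonzero[OF L1]])
  have hom: "\<phi> \<in> Ring.ring_hom B (cherednik_twist n c1 cm1)"
    using phi by (simp add: is_phi_def algebra_iso_def ring_iso_def)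
  have smult: "\<phi> (z \<odot>\<^bsub>B\<^esub> x) = z \<odot>\<^bsub>cherednik_twist n c1 cm1\<^esub> \<phi> x" if "x \<in> carrier B" for z x
    using phi that by (simp add: is_phi_def algebra_iso_def)
  have twist: "carrier (cherednik_twist n c1 cm1) = carrier H"
    "x \<oplus>\<^bsub>cherednik_twist n c1 cm1\<^esub> y = x \<oplus>\<^bsub>H\<^esub> y" "\<one>\<^bsub>cherednik_twist n c1 cm1\<^esub> = \<one>\<^bsub>H\<^esub>"
    "z \<odot>\<^bsub>cherednik_twist n c1 cm1\<^esub> x = z \<odot>\<^bsub>H\<^esub> x" for x y z
    by (simp_all add: cherednik_twist_def twist_def)
  have lift: "\<exists>p\<in>F. \<phi> x = q p" if "x \<in> carrier B" for x
    using Ring.ring_hom_closed[OF hom that] by (auto simp: twist H.carrier_A)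
  have act: "?act x w = \<chi> p \<odot>\<^bsub>L\<^esub> w" if "\<phi> x = q p" "p \<in> F" "w \<in> carrier L" for x p w
    using one_dimensional_action[OF L1 that(2,3)] that(1) by (simp add: L_twist_act_def)
  have scalar: "\<exists>z. \<forall>w\<in>carrier L. ?act x w = z \<odot>\<^bsub>L\<^esub> w" if "x \<in> carrier B" for x
    using lift[OF that] act by blast
  have act_mult: "?act (x \<otimes>\<^bsub>B\<^esub> y) w = ?act x (?act y w)"
    if x: "x \<in> carrier B" and y: "y \<in> carrier B" and w: "w \<in> carrier L" for x y w
  proof -
    obtain p r where p: "p \<in> F" "\<phi> x = q p" "r \<in> F" "\<phi> y = q r"
      using lift[OF x] lift[OF y] by blast
    then have "\<phi> (x \<otimes>\<^bsub>B\<^esub> y) = q (star p r)"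
      using Ring.ring_hom_mult[OF hom x y] by (simp add: twist_mult_q)
    then have "?act (x \<otimes>\<^bsub>B\<^esub> y) w = (\<chi> p * \<chi> r) \<odot>\<^bsub>L\<^esub> w"
      using act[OF _ star_F[OF p(1,3)] w] p by (simp add: \<chi>_star)
    also have "\<dots> = ?act x (?act y w)"
      using act[OF p(2,1)] act[OF p(4,3)] w L.W.smult_assoc1 by simp
    finally show ?thesis .
  qed
  have act_one: "?act \<one>\<^bsub>B\<^esub> w = w" if "w \<in> carrier L" for w
    using act[of "\<one>\<^bsub>B\<^esub>" 1 w] Ring.ring_hom_one[OF hom] that
      L.W.smult_one[of w] by (simp add: twist H.q_one \<chi>_simps)
  have rep: "alg_representation B L ?act"
    unfolding alg_representation_def
  proof (intro conjI ballI allI)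
    fix x y w v z
    assume x: "x \<in> carrier B" and w: "w \<in> carrier L"
    obtain p where p: "p \<in> F" "\<phi> x = q p" using lift[OF x] by auto
    note px = act[OF p(2,1)]
    show "?act x w \<in> carrier L" using px w by simp
    show "?act x (z \<odot>\<^bsub>L\<^esub> w) = z \<odot>\<^bsub>L\<^esub> ?act x w"
      using px w L.W.smult_assoc1[of "\<chi> p" z w] L.W.smult_assoc1[of z "\<chi> p" w]
      by (simp add: mult.commute)
    have "\<phi> (z \<odot>\<^bsub>B\<^esub> x) = q (pscale z p)"
      using smult[OF x] p by (simp add: twist H.q_smult)
    then show "?act (z \<odot>\<^bsub>B\<^esub> x) w = z \<odot>\<^bsub>L\<^esub> ?act x w"
      using act[of "z \<odot>\<^bsub>B\<^esub> x" "pscale z p" w] px w p L.W.smult_assoc1[of z "\<chi> p" w]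
      by (simp add: \<chi>_simps)
    { assume "v \<in> carrier L"
      then show "?act x (w \<oplus>\<^bsub>L\<^esub> v) = ?act x w \<oplus>\<^bsub>L\<^esub> ?act x v"
        using px w L.W.smult_r_distr[of "\<chi> p" w v] by simp }
    assume y: "y \<in> carrier B"
    then obtain r where r: "r \<in> F" "\<phi> y = q r" using lift by auto
    have "\<phi> (x \<oplus>\<^bsub>B\<^esub> y) = q (p + r)"
      using Ring.ring_hom_add[OF hom x y] p r by (simp add: twist H.q_add)
    then show "?act (x \<oplus>\<^bsub>B\<^esub> y) w = ?act x w \<oplus>\<^bsub>L\<^esub> ?act y w"
      using act[of "x \<oplus>\<^bsub>B\<^esub> y" "p + r" w] px act[OF r(2,1)] w p r L.W.smult_l_distr[of "\<chi> p" "\<chi> r" w]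
      by (simp add: \<chi>_simps)
    show "?act (x \<otimes>\<^bsub>B\<^esub> y) w = ?act x (?act y w)"
      by (rule act_mult[OF x y w])
  qed (use L.module_W act_one in auto)
  have xy: "?act (qB (gen_x i)) w = \<zero>\<^bsub>L\<^esub>" "?act (qB (gen_y i)) w = \<zero>\<^bsub>L\<^esub>"
    if "i < n" "w \<in> carrier L" for i w
    using act[of "qB (gen_x i)" "gen_x i" w] act[of "qB (gen_y i)" "gen_y i" w] phi that
      L.W.smult_l_null[of w]
    by (simp_all add: is_phi_def \<chi>_simps)
  have g: "\<forall>w\<in>carrier L. ?act (qB (gen_g g)) w = \<tau>' g \<odot>\<^bsub>L\<^esub> w" if "g \<in> signed_perms n" for g
    using that
  proof (induction g rule: signed_perms_induct)
    case one
    have "qB (gen_g (1\<^sub>m n)) = \<one>\<^bsub>B\<^esub>"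
      unfolding B.q_one by (rule qB_group_relation) (auto simp: group_relations_def)
    then show ?case using act_one L.W.smult_one \<tau>'
      by (simp add: linear_character_def)
  next
    case (mult g h)
    have "qB (gen_g (g * h)) = qB (gen_g g * gen_g h)"
      by (rule qB_group_relation[symmetric], unfold group_relations_def) (use mult in auto)
    also have "\<dots> = qB (gen_g g) \<otimes>\<^bsub>B\<^esub> qB (gen_g h)"
      using mult by (simp add: B.q_mult)
    finally have "?act (qB (gen_g (g * h))) w = ?act (qB (gen_g g)) (?act (qB (gen_g h)) w)"
      if "w \<in> carrier L" for w
      using act_mult[OF _ _ that] mult.hyps B.carrier_A by auto
    then show ?case
      using mult \<tau>' L.W.smult_assoc1 by (simp add: linear_character_def)
  next
    case (sigma i)
    have "\<phi> (qB (gen_g (sigma_mat n i (Suc i) 1))) = q (gen_g (s_mat n i (Suc i) (- 1)))"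
      using phi sigma by (simp add: is_phi_def)
    moreover have "\<tau>' (sigma_mat n i (Suc i) 1) = a"
      using linear_character_sigma[OF \<tau>', of i "Suc i"] sigma a by simp
    ultimately show ?case
      using act sigma \<tau>_values(3)[of i "Suc i" "- 1"] by (simp add: \<chi>_simps)
  next
    case (t i)
    have "diagonal_mat (t_mat n i)"
      by (auto simp: diagonal_mat_def t_mat_def)
    then have "\<phi> (qB (gen_g (t_mat n i))) = q (gen_g (t_mat n i))"
      using phi by (simp add: is_phi_def)
    then show ?case
      using act t \<tau>_values(4)[OF t] \<tau>' by (simp add: \<chi>_simps linear_character_def)
  qed
  show ?thesis
    unfolding is_braided_L_def using rep L1 xy g by blast
qed

end

section \<open>The four linear characters\<close>

theorem theorem6p3:
  fixes n i k :: nat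
    and c1 cm1 :: complex
    and \<tau> \<tau>' :: "complex mat \<Rightarrow> complex"
    and \<phi> :: "generator free set \<Rightarrow> generator free set"
  assumes "2 \<le> n" and "Suc i < n" and "k < n"
    and "(\<tau>, \<tau>') \<in> {(triv_char n, triv_char n), (kappa_char n, det_char n),
                      (det_char n, kappa_char n), (kappa_det_char n, kappa_det_char n)}"
    and "is_phi n c1 cm1 \<phi>"
  shows "(one_dimensional (L_space n c1 cm1 \<tau>) \<longleftrightarrow>
            0 = 1 - 2 * (of_nat n - 1) * c1 * \<tau> (s_mat n i (Suc i) 1) - cm1 * \<tau> (t_mat n k)) \<and>
         (one_dimensional (L_space n c1 cm1 \<tau>) \<longrightarrow>
            alg_representation (braided n (- c1) (- cm1)) (L_space n c1 cm1 \<tau>)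
              (L_twist_act n c1 cm1 \<tau> \<phi>) \<and>
            is_braided_L n (- c1) (- cm1) \<tau>' (L_space n c1 cm1 \<tau>)
              (L_twist_act n c1 cm1 \<tau> \<phi>))"
proof -
  obtain a b a' where \<tau>: "linear_character n \<tau> a b" and \<tau>': "linear_character n \<tau>' a' b"
    and a: "a = a' * b"
  proof -
    have "\<exists>a b a'. linear_character n \<tau> a b \<and> linear_character n \<tau>' a' b \<and> a = a' * b"
      using assms(4) linear_character_triv[of n] linear_character_kappa[of n]
        linear_character_det[of n] linear_character_kappa_det[of n]
      by (fastforce simp del: One_nat_def)
    then show thesis using that by blast
  qed
  interpret character_module n c1 cm1 \<tau> a b
    by unfold_locales (rule \<tau>)
  have "one_dimensional (L_space n c1 cm1 \<tau>) \<longleftrightarrow> obstruction = 0"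
    using one_dimensional_obstruction obstruction_one_dimensional assms(1) by auto
  moreover have "\<tau> (s_mat n i (Suc i) 1) = a" "\<tau> (t_mat n k) = b"
    using \<tau>_values(3)[of i "Suc i" 1] \<tau>_values(4)[OF assms(3)] assms(2) by auto
  ultimately show ?thesis
    using twist_of_one_dimensional[OF assms(5) _ \<tau>' a]
    by (auto simp: obstruction_def is_braided_L_def)
qed

end
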